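(* Let $F$ be an algebraically closed field of characteristic not equal to $2$ and $R=F[[x,y]]/(x^2)$. Then the modules $\widetilde R$ (the integral closure of $R$ in its quotient ring $Q$), $Q$, and $G=F((y))$ are, up to isomorphism, the only non-finitely generated points in the Cohen--Macaulay part $\mathrm{ZCM}_R$ of the Ziegler spectrum of $R$; that is, the non-finitely generated indecomposable pure injective Cohen--Macaulay $R$-modules are exactly $\widetilde R$, $Q$ and $G$.
   Context: $R=F[[x,y]]/(x^2)$ is a commutative complete local noetherian ring of Krull dimension 1 with maximal ideal $\mathbf m=(x,y)$ and residue field $F$. An $R$-module $N$, not necessarily finitely generated, is called Cohen--Macaulay (CM) if $\mathrm{Hom}_R(F,N)=0$; equivalently, $ny=0$ with $n\in N$ implies $n=0$. $Q=R[y^{-1}]$ is the total quotient ring of $R$; $\widetilde R$ is the integral closure of $R$ in $Q$ (explicitly $\widetilde R=R+xQ$); $G=F((y))$ is the Laurent series field viewed as an $R$-module with $x$ acting as zero. All are regarded as $R$-modules. A module is pure injective if it is injective with respect to pure monomorphisms. The points of $\mathrm{ZCM}_R$ are the isomorphism types of indecomposable pure injective CM $R$-modules (a closed subset of the Ziegler spectrum of $R$, with the induced topology). *)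

theory Defs
  imports "HOL-Algebra.Algebra" "HOL-Algebra.Algebraic_Closure_Type"
    "HOL-Computational_Algebra.Computational_Algebra"
begin

section \<open>Modules over a commutative ring\<close>

definition mod_hom ::
  "('r, 'p) ring_scheme \<Rightarrow> ('r, 'a) module \<Rightarrow> ('r, 'b) module \<Rightarrow> ('a \<Rightarrow> 'b) set"
  where "mod_hom R A B = {h \<in> carrier A \<rightarrow> carrier B.
     (\<forall>a \<in> carrier A. \<forall>a' \<in> carrier A. h (a \<oplus>\<^bsub>A\<^esub> a') = h a \<oplus>\<^bsub>B\<^esub> h a') \<and>
     (\<forall>r \<in> carrier R. \<forall>a \<in> carrier A. h (r \<odot>\<^bsub>A\<^esub> a) = r \<odot>\<^bsub>B\<^esub> h a)}"

definition mod_iso ::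
  "('r, 'p) ring_scheme \<Rightarrow> ('r, 'a) module \<Rightarrow> ('r, 'b) module \<Rightarrow> bool"
  where "mod_iso R A B \<longleftrightarrow> (\<exists>h \<in> mod_hom R A B. bij_betw h (carrier A) (carrier B))"

definition fin_gen :: "('r, 'p) ring_scheme \<Rightarrow> ('r, 'a) module \<Rightarrow> bool"
  where "fin_gen R N \<longleftrightarrow> (\<exists>S. finite S \<and> S \<subseteq> carrier N \<and>
     (\<forall>n \<in> carrier N. \<exists>c \<in> S \<rightarrow> carrier R. n = (\<Oplus>\<^bsub>N\<^esub>s \<in> S. c s \<odot>\<^bsub>N\<^esub> s)))"

definition indecomposable :: "('r, 'p) ring_scheme \<Rightarrow> ('r, 'a) module \<Rightarrow> bool"
  where "indecomposable R N \<longleftrightarrow> carrier N \<noteq> {\<zero>\<^bsub>N\<^esub>} \<and>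
     (\<forall>U V. submodule U R N \<and> submodule V R N \<and>
        U \<inter> V = {\<zero>\<^bsub>N\<^esub>} \<and> U <+>\<^bsub>N\<^esub> V = carrier N
        \<longrightarrow> U = {\<zero>\<^bsub>N\<^esub>} \<or> V = {\<zero>\<^bsub>N\<^esub>})"

text \<open>Purity: a finite system of \<open>R\<close>-linear equations with constants in \<open>A\<close> that is
  solvable in \<open>B\<close> (after applying \<open>f\<close> to the constants) is already solvable in \<open>A\<close>.\<close>

definition pure_mono ::
  "('r, 'p) ring_scheme \<Rightarrow> ('r, 'a) module \<Rightarrow> ('r, 'b) module \<Rightarrow> ('a \<Rightarrow> 'b) \<Rightarrow> bool"
  where "pure_mono R A B f \<longleftrightarrow> f \<in> mod_hom R A B \<and> inj_on f (carrier A) \<and>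
     (\<forall>(k::nat) (l::nat) r a.
        (\<forall>i<k. \<forall>j<l. r i j \<in> carrier R) \<and> (\<forall>i<k. a i \<in> carrier A) \<and>
        (\<exists>b \<in> {..<l} \<rightarrow> carrier B. \<forall>i<k. (\<Oplus>\<^bsub>B\<^esub>j \<in> {..<l}. r i j \<odot>\<^bsub>B\<^esub> b j) = f (a i))
        \<longrightarrow> (\<exists>c \<in> {..<l} \<rightarrow> carrier A. \<forall>i<k. (\<Oplus>\<^bsub>A\<^esub>j \<in> {..<l}. r i j \<odot>\<^bsub>A\<^esub> c j) = a i))"

text \<open>Pure injectivity quantifies over all modules. HOL cannot quantify over types inside a
  formula, so the test modules \<open>A\<close> and \<open>B\<close> range over all modules whose carrier is a
  subset of a universe type \<open>'u\<close>; theorems are stated for every sufficiently large \<open>'u\<close>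
  (once the infinite type \<open>'u\<close> has at least the cardinality of \<open>R\<close>, the notion no longer
  depends on it).\<close>

definition pure_injective ::
  "'u itself \<Rightarrow> ('r, 'p) ring_scheme \<Rightarrow> ('r, 'a) module \<Rightarrow> bool"
  where "pure_injective _ R N \<longleftrightarrow>
     (\<forall>(A :: ('r, 'u) module) (B :: ('r, 'u) module) f g.
        module R A \<and> module R B \<and> pure_mono R A B f \<and> g \<in> mod_hom R A N
        \<longrightarrow> (\<exists>h \<in> mod_hom R B N. \<forall>a \<in> carrier A. h (f a) = g a))"

text \<open>A ring \<open>S\<close> as a module over the source of a ring homomorphism \<open>\<phi>\<close> into \<open>S\<close>.\<close>

definition ring_as_module :: "('r \<Rightarrow> 's) \<Rightarrow> 's ring \<Rightarrow> ('r, 's) module"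
  where "ring_as_module \<phi> S = \<lparr>carrier = carrier S, monoid.mult = (\<otimes>\<^bsub>S\<^esub>), one = \<one>\<^bsub>S\<^esub>,
     ring.zero = \<zero>\<^bsub>S\<^esub>, add = (\<oplus>\<^bsub>S\<^esub>), module.smult = (\<lambda>r s. \<phi> r \<otimes>\<^bsub>S\<^esub> s)\<rparr>"


section \<open>Localization and integral closure\<close>

definition frac_rel :: "('a, 'p) ring_scheme \<Rightarrow> 'a set \<Rightarrow> (('a \<times> 'a) \<times> ('a \<times> 'a)) set"
  where "frac_rel R S = {((a, s), (b, t)). a \<in> carrier R \<and> s \<in> S \<and> b \<in> carrier R \<and> t \<in> S \<and>
     (\<exists>u \<in> S. u \<otimes>\<^bsub>R\<^esub> (t \<otimes>\<^bsub>R\<^esub> a) = u \<otimes>\<^bsub>R\<^esub> (s \<otimes>\<^bsub>R\<^esub> b))}"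

definition frac_class :: "('a, 'p) ring_scheme \<Rightarrow> 'a set \<Rightarrow> 'a \<Rightarrow> 'a \<Rightarrow> ('a \<times> 'a) set"
  where "frac_class R S a s = frac_rel R S `` {(a, s)}"

text \<open>The localization of \<open>R\<close> at a multiplicative set \<open>S\<close>, with the usual operations
  \<open>a/s + b/t = (ta + sb)/(st)\<close> and \<open>(a/s)(b/t) = (ab)/(st)\<close>.\<close>

definition localization :: "('a, 'p) ring_scheme \<Rightarrow> 'a set \<Rightarrow> ('a \<times> 'a) set ring"
  where "localization R S = \<lparr>carrier = (carrier R \<times> S) // frac_rel R S,
     monoid.mult = (\<lambda>p q. \<Union>(a, s) \<in> p. \<Union>(b, t) \<in> q. frac_class R S (a \<otimes>\<^bsub>R\<^esub> b) (s \<otimes>\<^bsub>R\<^esub> t)),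
     one = frac_class R S \<one>\<^bsub>R\<^esub> \<one>\<^bsub>R\<^esub>,
     ring.zero = frac_class R S \<zero>\<^bsub>R\<^esub> \<one>\<^bsub>R\<^esub>,
     add = (\<lambda>p q. \<Union>(a, s) \<in> p. \<Union>(b, t) \<in> q.
        frac_class R S ((t \<otimes>\<^bsub>R\<^esub> a) \<oplus>\<^bsub>R\<^esub> (s \<otimes>\<^bsub>R\<^esub> b)) (s \<otimes>\<^bsub>R\<^esub> t))\<rparr>"

text \<open>Polynomials are coefficient lists with the leading coefficient first, as in
  \<^theory>\<open>HOL-Algebra.Polynomials\<close>; \<open>K\<close> is a subring of \<open>Q\<close>.\<close>

definition integral_closure :: "('q, 'p) ring_scheme \<Rightarrow> 'q set \<Rightarrow> 'q set"
  where "integral_closure Q K = {q \<in> carrier Q.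
     \<exists>p. p \<noteq> [] \<and> set p \<subseteq> K \<and> hd p = \<one>\<^bsub>Q\<^esub> \<and> ring.eval Q p q = \<zero>\<^bsub>Q\<^esub>}"


section \<open>The ring \<open>R = F[[x,y]]/(x\<^sup>2)\<close> and its modules\<close>

text \<open>\<open>F[[x,y]]\<close> is \<open>F[[y]][[x]]\<close>, that is, \<open>'f fps fps\<close>, where \<open>x\<close> is the outer and \<open>y\<close> the
  inner variable.\<close>

definition x2_ideal :: "'f::field fps fps set"
  where "x2_ideal = PIdl\<^bsub>ring_of_type_algebra\<^esub> (fps_X ^ 2)"

definition Rxy :: "'f::field fps fps set ring"
  where "Rxy = ring_of_type_algebra Quot x2_ideal"

definition Ry :: "'f::field fps fps set"
  where "Ry = x2_ideal +>\<^bsub>ring_of_type_algebra\<^esub> fps_const fps_X"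

text \<open>The map on \<open>R\<close> induced by a map \<open>\<phi>\<close> on \<open>F[[x,y]]\<close> that is constant on the cosets
  of \<open>(x\<^sup>2)\<close>.\<close>

definition quot_map :: "('f fps fps \<Rightarrow> 'b) \<Rightarrow> 'f fps fps set \<Rightarrow> 'b"
  where "quot_map \<phi> r = the_elem (\<phi> ` r)"

text \<open>The residue field \<open>F\<close>; the map \<open>R \<rightarrow> F\<close> takes the constant term.\<close>

definition F_mod :: "('f::field fps fps set, 'f) module"
  where "F_mod = ring_as_module (quot_map (\<lambda>p. fps_nth (fps_nth p 0) 0)) ring_of_type_algebra"

definition Q_ring :: "('f::field fps fps set \<times> 'f fps fps set) set ring"
  where "Q_ring = localization Rxy (range (\<lambda>n::nat. Ry [^]\<^bsub>Rxy\<^esub> n))"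

definition Q_map :: "'f::field fps fps set \<Rightarrow> ('f fps fps set \<times> 'f fps fps set) set"
  where "Q_map r = frac_class Rxy (range (\<lambda>n::nat. Ry [^]\<^bsub>Rxy\<^esub> n)) r \<one>\<^bsub>Rxy\<^esub>"

definition Q_mod :: "('f::field fps fps set, ('f fps fps set \<times> 'f fps fps set) set) module"
  where "Q_mod = ring_as_module Q_map Q_ring"

definition Rtilde_mod :: "('f::field fps fps set, ('f fps fps set \<times> 'f fps fps set) set) module"
  where "Rtilde_mod = Q_mod\<lparr>carrier := integral_closure Q_ring (Q_map ` carrier Rxy)\<rparr>"

text \<open>\<open>G = F((y))\<close>; the map \<open>R \<rightarrow> F[[y]] \<rightarrow> F((y))\<close> sets \<open>x\<close> to zero.\<close>

definition G_mod :: "('f::field fps fps set, 'f fls) module"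
  where "G_mod = ring_as_module (quot_map (\<lambda>p. fps_to_fls (fps_nth p 0))) ring_of_type_algebra"

text \<open>\<open>N\<close> is Cohen--Macaulay if \<open>Hom\<^sub>R(F, N) = 0\<close>.\<close>

definition cohen_macaulay :: "('f::field fps fps set, 'a) module \<Rightarrow> bool"
  where "cohen_macaulay N \<longleftrightarrow> (\<forall>h \<in> mod_hom Rxy F_mod N. \<forall>c \<in> carrier F_mod. h c = \<zero>\<^bsub>N\<^esub>)"

definition ZCM_point :: "'u itself \<Rightarrow> ('f::field fps fps set, 'a) module \<Rightarrow> bool"
  where "ZCM_point U N \<longleftrightarrow> module Rxy N \<and> indecomposable Rxy N \<and>
     pure_injective U Rxy N \<and> cohen_macaulay N"

end

(* A Cohen-Macaulay R-module N is a torsion-free F[[y]]-module with an endomorphism x of square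
   zero. The three modules are M(S) = {(a, b). a in S, b in F((y))} with x(a, b) = (0, a), for S = 0
   (the module G), S = F[[y]] (the integral closure) and S = F((y)) (the module Q). An R-linear map
   into M(S) is the same as an F[[y]]-linear map phi into F((y)) with phi(xN) contained in S.

   Let N be an indecomposable pure injective Cohen-Macaulay module.
   If xN is not contained in y^n N for some n, or if xN = 0 and N is not divisible by y, then a
   functional N -> F[[y]] splits off a summand with at most two generators. If xN = 0 and N = yN,
   then N is a vector space over F((y)), so N = G. Otherwise xN lies in every y^n N; pick u = xw,
   outside of yxN if xN is not divisible by y, and a functional on N with value 1 at u. It induces
   a map onto M(S), S = F[[y]] or F((y)), and the generator w splits it in the first case. In the
   second case a splitting requires a map h : F((y)) -> N with x h(c) = cu, and pure injectivity
   provides it.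

   Conversely M(S) is uniform, hence indecomposable; its elements have no common denominator, so it
   is not finitely generated; and it is pure injective because F[[y]] and F((y)) are pure injective
   over F[[y]]. *)

theory Submission
  imports Defs
begin

section \<open>Modules with scalars from a type\<close>

text \<open>Both targets of functionals admit extensions, for opposite reasons: in F((y)) a value is
  free or forced by division, whereas in F[[y]] it is built coefficient by coefficient as long as
  divisibility by powers of y is respected. Summands are never written down: each case produces an
  idempotent endomorphism onto the expected summand, and indecomposability makes it the identity.
  The obstacle is the last case. A section of N -> M(S) needs preimages under x of all elements cu
  that depend linearly on c. For S = F[[y]] the multiples of w form such a choice. For S = F((y))
  each y^-n u has a preimage, but these preimages have no reason to be compatible; only finitely
  many conditions at a time can be met, and pure injectivity turns them into a simultaneous
  solution. Carriers are sets and scalars are a type, so that N and xN over F[[y]] and N over F are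
  instances of one locale.\<close>

locale scalar_module =
  fixes C :: "'m set"
    and add :: "'m \<Rightarrow> 'm \<Rightarrow> 'm" (infixl \<open>\<boxplus>\<close> 65)
    and zr :: 'm
    and sm :: "'d::comm_ring_1 \<Rightarrow> 'm \<Rightarrow> 'm" (infixr \<open>\<star>\<close> 75)
  assumes add_closed [simp, intro]: "m \<in> C \<Longrightarrow> n \<in> C \<Longrightarrow> m \<boxplus> n \<in> C"
    and zr_closed [simp, intro]: "zr \<in> C"
    and sm_closed [simp, intro]: "m \<in> C \<Longrightarrow> d \<star> m \<in> C"
    and add_assoc: "m \<in> C \<Longrightarrow> n \<in> C \<Longrightarrow> p \<in> C \<Longrightarrow> (m \<boxplus> n) \<boxplus> p = m \<boxplus> (n \<boxplus> p)"
    and add_comm: "m \<in> C \<Longrightarrow> n \<in> C \<Longrightarrow> m \<boxplus> n = n \<boxplus> m"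
    and zr_add [simp]: "m \<in> C \<Longrightarrow> zr \<boxplus> m = m"
    and sm_add: "m \<in> C \<Longrightarrow> n \<in> C \<Longrightarrow> d \<star> (m \<boxplus> n) = d \<star> m \<boxplus> d \<star> n"
    and add_sm: "m \<in> C \<Longrightarrow> (d + e) \<star> m = d \<star> m \<boxplus> e \<star> m"
    and mult_sm: "m \<in> C \<Longrightarrow> (d * e) \<star> m = d \<star> e \<star> m"
    and one_sm [simp]: "m \<in> C \<Longrightarrow> 1 \<star> m = m"
    and zero_sm [simp]: "m \<in> C \<Longrightarrow> 0 \<star> m = zr"
begin

lemma add_zr [simp]: "m \<in> C \<Longrightarrow> m \<boxplus> zr = m"
  using add_comm[of m zr] by simp

lemma sm_zr [simp]: "d \<star> zr = zr"
  using mult_sm[of zr d 0] by simp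

lemma add_left_comm: "m \<in> C \<Longrightarrow> n \<in> C \<Longrightarrow> p \<in> C \<Longrightarrow> m \<boxplus> (n \<boxplus> p) = n \<boxplus> (m \<boxplus> p)"
  by (metis add_assoc add_comm)

lemmas add_ac = add_assoc add_comm add_left_comm

lemma add_neg [simp]: "m \<in> C \<Longrightarrow> m \<boxplus> (-1) \<star> m = zr"
  using add_sm[of m 1 "-1"] by simp

lemma eq_neg_iff: "m \<in> C \<Longrightarrow> n \<in> C \<Longrightarrow> m \<boxplus> n = zr \<longleftrightarrow> m = (-1) \<star> n"
  by (metis add_neg add_assoc add_comm add_zr sm_closed zr_add)

lemma add_right_cancel [simp]:
  "m \<in> C \<Longrightarrow> n \<in> C \<Longrightarrow> p \<in> C \<Longrightarrow> m \<boxplus> p = n \<boxplus> p \<longleftrightarrow> m = n"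
  by (metis add_neg add_assoc add_zr sm_closed)

lemma eq_iff_diff: "m \<in> C \<Longrightarrow> n \<in> C \<Longrightarrow> m = n \<longleftrightarrow> m \<boxplus> (-1) \<star> n = zr"
  by (metis add_neg add_right_cancel sm_closed)

text \<open>The scalar map \<open>\<iota>\<close> lets one notion serve functionals into F and
  F[[y]], where it is the identity, and into F((y)), where it is \<open>fps_to_fls\<close>.\<close>

definition linear_to :: "('d \<Rightarrow> 'k::comm_ring_1) \<Rightarrow> ('m \<Rightarrow> 'k) \<Rightarrow> bool"
  where "linear_to \<iota> f \<longleftrightarrow> (\<forall>m\<in>C. \<forall>n\<in>C. f (m \<boxplus> n) = f m + f n) \<and>
    (\<forall>d. \<forall>m\<in>C. f (d \<star> m) = \<iota> d * f m)"

text \<open>Partial linear maps are relations, so that a domain never has to be named. Being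
  single-valued is a separate condition; by linearity it only has to be checked at
  \<open>zr\<close>.\<close>

definition linear_graph :: "('d \<Rightarrow> 'k::comm_ring_1) \<Rightarrow> ('m \<times> 'k) set \<Rightarrow> bool"
  where "linear_graph \<iota> \<Gamma> \<longleftrightarrow> \<Gamma> \<subseteq> C \<times> UNIV \<and> (zr, 0) \<in> \<Gamma> \<and>
    (\<forall>m t n u. (m, t) \<in> \<Gamma> \<longrightarrow> (n, u) \<in> \<Gamma> \<longrightarrow> (m \<boxplus> n, t + u) \<in> \<Gamma>) \<and>
    (\<forall>d m t. (m, t) \<in> \<Gamma> \<longrightarrow> (d \<star> m, \<iota> d * t) \<in> \<Gamma>)"

lemma linear_toD:
  assumes "linear_to \<iota> f"
  shows "m \<in> C \<Longrightarrow> n \<in> C \<Longrightarrow> f (m \<boxplus> n) = f m + f n"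
    and "m \<in> C \<Longrightarrow> f (d \<star> m) = \<iota> d * f m"
  using assms by (auto simp: linear_to_def)

lemma linear_to_zr:
  assumes "linear_to \<iota> f" shows "f zr = 0"
  using linear_toD(1)[OF assms, of zr zr] by simp

lemma linear_graphD:
  assumes "linear_graph \<iota> \<Gamma>"
  shows "(m, t) \<in> \<Gamma> \<Longrightarrow> m \<in> C" and "(zr, 0) \<in> \<Gamma>"
    and "(m, t) \<in> \<Gamma> \<Longrightarrow> (n, u) \<in> \<Gamma> \<Longrightarrow> (m \<boxplus> n, t + u) \<in> \<Gamma>"
    and "(m, t) \<in> \<Gamma> \<Longrightarrow> (d \<star> m, \<iota> d * t) \<in> \<Gamma>"
  using assms by (auto simp: linear_graph_def)

text \<open>A partial linear map into a field is extended one generator \<open>m\<close> at a time; its value at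
  \<open>m\<close> is forced, by division in the field, as soon as some nonzero multiple of \<open>m\<close> lies in
  the domain.\<close>

lemma linear_extension:
  fixes \<iota> :: "'d \<Rightarrow> 'k::field"
  assumes \<iota>_add: "\<And>a b. \<iota> (a + b) = \<iota> a + \<iota> b" and \<iota>_mult: "\<And>a b. \<iota> (a * b) = \<iota> a * \<iota> b"
    and \<iota>_1: "\<iota> 1 = 1" and \<iota>_inj: "\<And>a. \<iota> a = 0 \<Longrightarrow> a = 0"
    and \<Gamma>: "linear_graph \<iota> \<Gamma>" and single: "\<And>t. (zr, t) \<in> \<Gamma> \<Longrightarrow> t = 0"
  obtains f where "linear_to \<iota> f" "\<And>m t. (m, t) \<in> \<Gamma> \<Longrightarrow> f m = t"
proof -
  define \<A> where "\<A> = {\<Delta>. linear_graph \<iota> \<Delta> \<and> \<Gamma> \<subseteq> \<Delta> \<and> (\<forall>t. (zr, t) \<in> \<Delta> \<longrightarrow> t = 0)}"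
  have \<iota>_0: "\<iota> 0 = 0" by (metis \<iota>_add add.right_neutral add_left_cancel)
  have \<iota>_neg: "\<iota> (- a) = - \<iota> a" for a
    using \<iota>_add[of a "-a"] \<iota>_0 by (simp add: eq_neg_iff_add_eq_0 add.commute)
  have "\<exists>\<Delta>\<in>\<A>. \<forall>\<Delta>'\<in>\<A>. \<Delta> \<subseteq> \<Delta>' \<longrightarrow> \<Delta>' = \<Delta>"
  proof (rule subset_Zorn_nonempty)
    show "\<A> \<noteq> {}" using \<Gamma> single by (auto simp: \<A>_def)
    fix \<C> assume ne: "\<C> \<noteq> {}" and chain: "subset.chain \<A> \<C>"
    have sub: "\<C> \<subseteq> \<A>" and tot: "\<And>U V. U \<in> \<C> \<Longrightarrow> V \<in> \<C> \<Longrightarrow> U \<subseteq> V \<or> V \<subseteq> U"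
      using chain by (auto simp: subset_chain_def)
    have "linear_graph \<iota> (\<Union>\<C>)"
      unfolding linear_graph_def
    proof (intro conjI allI impI)
      have U: "linear_graph \<iota> U" if "U \<in> \<C>" for U using sub that by (auto simp: \<A>_def)
      show "\<Union>\<C> \<subseteq> C \<times> UNIV" using linear_graphD(1)[OF U] by auto
      show "(zr, 0) \<in> \<Union>\<C>" using linear_graphD(2)[OF U] ne by blast
      show "(d \<star> m, \<iota> d * t) \<in> \<Union>\<C>" if "(m, t) \<in> \<Union>\<C>" for d m t
        using linear_graphD(4)[OF U] that by blast
      fix m t n u assume "(m, t) \<in> \<Union>\<C>" "(n, u) \<in> \<Union>\<C>"
      then obtain U V where UV: "U \<in> \<C>" "V \<in> \<C>" "(m, t) \<in> U" "(n, u) \<in> V" by auto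
      then obtain W where "W \<in> \<C>" "(m, t) \<in> W" "(n, u) \<in> W"
        using tot by blast
      then show "(m \<boxplus> n, t + u) \<in> \<Union>\<C>"
        using linear_graphD(3)[OF U] by blast
    qed
    then show "\<Union>\<C> \<in> \<A>"
      using sub ne by (auto simp: \<A>_def)
  qed
  then obtain \<Delta> where \<Delta>: "\<Delta> \<in> \<A>" and max: "\<And>\<Delta>'. \<Delta>' \<in> \<A> \<Longrightarrow> \<Delta> \<subseteq> \<Delta>' \<Longrightarrow> \<Delta>' = \<Delta>"
    by blast
  have lg: "linear_graph \<iota> \<Delta>" and sub: "\<Gamma> \<subseteq> \<Delta>" and sg: "\<And>t. (zr, t) \<in> \<Delta> \<Longrightarrow> t = 0"
    using \<Delta> by (auto simp: \<A>_def)
  note lgD = linear_graphD[OF lg]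
  have uniq: "t = u" if "(m, t) \<in> \<Delta>" "(m, u) \<in> \<Delta>" for m t u
  proof -
    have "(m \<boxplus> (-1) \<star> m, t + \<iota> (-1) * u) \<in> \<Delta>" using that lgD by blast
    then have "t - u = 0" using lgD(1)[OF that(1)] by (intro sg) (simp add: \<iota>_neg \<iota>_1)
    then show ?thesis by simp
  qed
  have total: "\<exists>t. (m, t) \<in> \<Delta>" if m: "m \<in> C" for m
  proof -
    obtain t0 where t0: "\<And>d t. (d \<star> m, t) \<in> \<Delta> \<Longrightarrow> t = \<iota> d * t0"
    proof (cases "\<exists>d t. d \<noteq> 0 \<and> (d \<star> m, t) \<in> \<Delta>")
      case True
      then obtain d1 t1 where d1: "d1 \<noteq> 0" "(d1 \<star> m, t1) \<in> \<Delta>" by blast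
      have "t = \<iota> d * (t1 / \<iota> d1)" if "(d \<star> m, t) \<in> \<Delta>" for d t
      proof -
        have "(d1 \<star> d \<star> m, \<iota> d1 * t) \<in> \<Delta>" "(d \<star> d1 \<star> m, \<iota> d * t1) \<in> \<Delta>"
          using that d1 lgD by blast+
        moreover have "d1 \<star> d \<star> m = d \<star> d1 \<star> m"
          using m by (simp flip: mult_sm add: mult.commute)
        ultimately have "\<iota> d1 * t = \<iota> d * t1" using uniq by simp
        moreover have "\<iota> d1 \<noteq> 0" using \<iota>_inj d1 by blast
        ultimately show ?thesis by (simp add: field_simps)
      qed
      then show thesis using that by blast
    next
      case False
      \<comment> \<open>No nonzero multiple of \<open>m\<close> lies in the domain, so the value at
        \<open>m\<close> is free and 0 is taken.\<close>
      have "t = \<iota> d * 0" if "(d \<star> m, t) \<in> \<Delta>" for d t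
        using False that sg m by (metis mult_zero_right zero_sm)
      then show thesis using that by blast
    qed
    define \<Delta>' where "\<Delta>' = {(b \<boxplus> d \<star> m, t + \<iota> d * t0) | b t d. (b, t) \<in> \<Delta>}"
    have \<Delta>'I: "(b \<boxplus> d \<star> m, t + \<iota> d * t0) \<in> \<Delta>'" if "(b, t) \<in> \<Delta>" for b t d
      using that by (auto simp: \<Delta>'_def)
    have "linear_graph \<iota> \<Delta>'"
      unfolding linear_graph_def
    proof (intro conjI allI impI)
      show "\<Delta>' \<subseteq> C \<times> UNIV" using lgD(1) m by (auto simp: \<Delta>'_def)
      show "(zr, 0) \<in> \<Delta>'"
        using \<Delta>'I[OF lgD(2), of 0] m \<iota>_0 by simp
      show "(e \<star> p, \<iota> e * t) \<in> \<Delta>'" if pt: "(p, t) \<in> \<Delta>'" for e p t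
      proof -
        obtain b s d where b: "p = b \<boxplus> d \<star> m" "t = s + \<iota> d * t0" "(b, s) \<in> \<Delta>"
          using pt by (auto simp: \<Delta>'_def)
        have "e \<star> p = e \<star> b \<boxplus> (e * d) \<star> m"
          using lgD(1)[OF b(3)] m by (simp add: b sm_add mult_sm)
        moreover have "\<iota> e * t = \<iota> e * s + \<iota> (e * d) * t0"
          by (simp add: b \<iota>_mult algebra_simps)
        ultimately show ?thesis using \<Delta>'I[OF lgD(4)[OF b(3), of e]] by simp
      qed
      fix p t q u assume pq: "(p, t) \<in> \<Delta>'" "(q, u) \<in> \<Delta>'"
      obtain b s d where b: "p = b \<boxplus> d \<star> m" "t = s + \<iota> d * t0" "(b, s) \<in> \<Delta>"
        using pq by (auto simp: \<Delta>'_def)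
      obtain c v e where c: "q = c \<boxplus> e \<star> m" "u = v + \<iota> e * t0" "(c, v) \<in> \<Delta>"
        using pq by (auto simp: \<Delta>'_def)
      have "p \<boxplus> q = (b \<boxplus> c) \<boxplus> (d + e) \<star> m"
        using lgD(1)[OF b(3)] lgD(1)[OF c(3)] m by (simp add: b c add_sm add_ac)
      moreover have "t + u = (s + v) + \<iota> (d + e) * t0"
        by (simp add: b c \<iota>_add algebra_simps)
      ultimately show "(p \<boxplus> q, t + u) \<in> \<Delta>'"
        using \<Delta>'I[OF lgD(3)[OF b(3) c(3)]] by simp
    qed
    moreover have incl: "\<Delta> \<subseteq> \<Delta>'"
    proof
      fix z assume z: "z \<in> \<Delta>"
      obtain b t where bt: "z = (b, t)" by (cases z)
      then show "z \<in> \<Delta>'" using z \<Delta>'I[of b t 0] lgD(1)[of b t] m \<iota>_0 by simp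
    qed
    moreover have "t = 0" if "(zr, t) \<in> \<Delta>'" for t
    proof -
      obtain b s d where b: "zr = b \<boxplus> d \<star> m" "t = s + \<iota> d * t0" "(b, s) \<in> \<Delta>"
        using \<open>(zr, t) \<in> \<Delta>'\<close> unfolding \<Delta>'_def by blast
      \<comment> \<open>A relation between \<open>b\<close> and \<open>d \<star> m\<close> places a
        multiple of \<open>m\<close> in the old domain, where the choice of \<open>t0\<close>
        already fixes the value.\<close>
      have "b = (-1) \<star> d \<star> m"
        using b(1)[symmetric] eq_neg_iff[of b "d \<star> m"] lgD(1)[OF b(3)] m by simp
      then have "b = (- d) \<star> m" using m by (simp flip: mult_sm)
      then have "s = \<iota> (- d) * t0" using t0 b(3) by simp
      then show "t = 0" using b(2) by (simp add: \<iota>_neg)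
    qed
    ultimately have "\<Delta>' \<in> \<A>" using sub by (auto simp: \<A>_def)
    then have "\<Delta>' = \<Delta>" using max incl by blast
    moreover have "(m, t0) \<in> \<Delta>'"
      using \<Delta>'I[OF lgD(2), of 1] m \<iota>_1 by simp
    ultimately show ?thesis by blast
  qed
  define f where "f m = (THE t. (m, t) \<in> \<Delta>)" for m
  have f_eq: "f m = t" if "(m, t) \<in> \<Delta>" for m t
    unfolding f_def using uniq that by blast
  have f_in: "(m, f m) \<in> \<Delta>" if "m \<in> C" for m
    using total[OF that] f_eq by auto
  have "linear_to \<iota> f"
    unfolding linear_to_def by (auto intro!: f_eq lgD(3,4) f_in)
  moreover have "f m = t" if "(m, t) \<in> \<Gamma>" for m t
    using f_eq that sub by blast
  ultimately show thesis using that by blast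
qed

end

section \<open>Modules over power series\<close>

locale fps_module = scalar_module C add zr sm
  for C :: "'m set" and add (infixl \<open>\<boxplus>\<close> 65) and zr :: 'm
    and sm :: "'f::field fps \<Rightarrow> 'm \<Rightarrow> 'm" (infixr \<open>\<star>\<close> 75)
begin

text \<open>Used for the single coefficients of a functional with values in F[[y]], which are linear
  over F only.\<close>

lemma const_scalar_module: "scalar_module C (\<boxplus>) zr (\<lambda>c. (\<star>) (fps_const c))"
  by unfold_locales
    (auto simp: sm_add add_sm mult_sm add_assoc intro: add_comm
      simp flip: fps_const_add fps_const_mult)

lemma X_power_sm_commute: "m \<in> C \<Longrightarrow> fps_X ^ n \<star> d \<star> m = d \<star> fps_X ^ n \<star> m"
  by (simp flip: mult_sm add: mult.commute)

text \<open>No continuity enters: the defect \<open>\<phi> (d \<star> m) - d * \<phi> m\<close> is y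
  times the defect for the tail of \<open>d\<close>, hence divisible by every power of y, and only 0
  is.\<close>

lemma linear_to_fpsI:
  assumes add: "\<And>m n. m \<in> C \<Longrightarrow> n \<in> C \<Longrightarrow> \<phi> (m \<boxplus> n) = \<phi> m + \<phi> n"
    and const: "\<And>c m. m \<in> C \<Longrightarrow> \<phi> (fps_const c \<star> m) = fps_const c * \<phi> m"
    and X: "\<And>m. m \<in> C \<Longrightarrow> \<phi> (fps_X \<star> m) = fps_X * \<phi> m"
  shows "linear_to (\<lambda>d. d) (\<phi> :: 'm \<Rightarrow> 'f fps)"
proof -
  have dvd: "m \<in> C \<Longrightarrow> fps_X ^ n dvd \<phi> (d \<star> m) - d * \<phi> m" for n d m
  proof (induction n arbitrary: d m)
    case (Suc n)
    define d' where "d' = fps_shift 1 d"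
    have d: "d = fps_const (d $ 0) + fps_X * d'"
      by (rule fps_ext) (auto simp: d'_def gr0_conv_Suc)
    have "d \<star> m = fps_const (d $ 0) \<star> m \<boxplus> fps_X \<star> d' \<star> m"
      by (subst d) (simp only: add_sm mult_sm Suc.prems)
    then have "\<phi> (d \<star> m) = fps_const (d $ 0) * \<phi> m + fps_X * \<phi> (d' \<star> m)"
      using Suc.prems by (simp only: add const X sm_closed)
    moreover have "d * \<phi> m = fps_const (d $ 0) * \<phi> m + fps_X * (d' * \<phi> m)"
      by (subst d) (simp only: algebra_simps)
    ultimately have "\<phi> (d \<star> m) - d * \<phi> m = fps_X * (\<phi> (d' \<star> m) - d' * \<phi> m)"
      by (simp only: algebra_simps)
    then show ?case using Suc by (simp add: mult_dvd_mono)
  qed auto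
  have "\<phi> (d \<star> m) = d * \<phi> m" if m: "m \<in> C" for d m
  proof (rule fps_ext)
    fix n
    obtain e where "\<phi> (d \<star> m) - d * \<phi> m = fps_X ^ Suc n * e"
      using dvd[OF m, of "Suc n" d] by (auto elim: dvdE)
    then have "(\<phi> (d \<star> m) - d * \<phi> m) $ n = 0"
      by (simp only: fps_X_power_mult_nth) simp
    then show "\<phi> (d \<star> m) $ n = (d * \<phi> m) $ n" by simp
  qed
  then show ?thesis using add by (auto simp: linear_to_def)
qed

text \<open>\<open>F[[y]]\<close> is pure injective over itself: a partial linear map extends as soon as it respects
  divisibility by powers of \<open>y\<close>. After saturating its graph, the coefficients of the extension are
  constructed one after the other; each is an \<open>F\<close>-linear form whose values on \<open>yM\<close> are
  prescribed by the previous one.\<close>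

lemma fps_linear_extension:
  fixes \<Gamma> :: "('m \<times> 'f fps) set"
  assumes \<Gamma>: "linear_graph (\<lambda>d. d) \<Gamma>"
    and div: "\<And>n b d. b \<in> C \<Longrightarrow> (fps_X ^ n \<star> b, d) \<in> \<Gamma> \<Longrightarrow> fps_X ^ n dvd d"
  obtains \<phi> where "linear_to (\<lambda>d. d) \<phi>" "\<And>b d. (b, d) \<in> \<Gamma> \<Longrightarrow> \<phi> b = d"
proof -
  interpret const: scalar_module C "(\<boxplus>)" zr "\<lambda>c. (\<star>) (fps_const c)"
    by (rule const_scalar_module)
  note \<Gamma>D = linear_graphD[OF \<Gamma>]
  define \<Delta> where "\<Delta> = {(b, d). b \<in> C \<and> (\<exists>n. (fps_X ^ n \<star> b, fps_X ^ n * d) \<in> \<Gamma>)}"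
  have \<Delta>_add: "(b \<boxplus> c, d + e) \<in> \<Delta>" if bd: "(b, d) \<in> \<Delta>" "(c, e) \<in> \<Delta>" for b c d e
  proof -
    obtain n k where n: "b \<in> C" "(fps_X ^ n \<star> b, fps_X ^ n * d) \<in> \<Gamma>"
      and k: "c \<in> C" "(fps_X ^ k \<star> c, fps_X ^ k * e) \<in> \<Gamma>"
      using bd by (auto simp: \<Delta>_def)
    have "(fps_X ^ k \<star> fps_X ^ n \<star> b \<boxplus> fps_X ^ n \<star> fps_X ^ k \<star> c,
        fps_X ^ k * (fps_X ^ n * d) + fps_X ^ n * (fps_X ^ k * e)) \<in> \<Gamma>"
      using \<Gamma>D(3,4) n k by blast
    also have "(fps_X ^ k \<star> fps_X ^ n \<star> b \<boxplus> fps_X ^ n \<star> fps_X ^ k \<star> c,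
        fps_X ^ k * (fps_X ^ n * d) + fps_X ^ n * (fps_X ^ k * e)) =
        (fps_X ^ (k + n) \<star> (b \<boxplus> c), fps_X ^ (k + n) * (d + e))"
      using n(1) k(1) X_power_sm_commute[of c k "fps_X ^ n"]
      by (simp add: power_add sm_add mult_sm) (simp add: algebra_simps)
    finally show ?thesis using n k by (auto simp: \<Delta>_def)
  qed
  have \<Delta>_sm: "(e \<star> b, e * d) \<in> \<Delta>" if bd: "(b, d) \<in> \<Delta>" for b d e
  proof -
    obtain n where n: "b \<in> C" "(fps_X ^ n \<star> b, fps_X ^ n * d) \<in> \<Gamma>"
      using bd by (auto simp: \<Delta>_def)
    have "(fps_X ^ n \<star> e \<star> b, fps_X ^ n * (e * d)) \<in> \<Gamma>"
      using \<Gamma>D(4)[OF n(2), of e] n(1) by (simp add: X_power_sm_commute mult.left_commute)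
    then show ?thesis using n(1) by (auto simp: \<Delta>_def)
  qed
  have \<Gamma>\<Delta>: "(b, d) \<in> \<Delta>" if "(b, d) \<in> \<Gamma>" for b d
    unfolding \<Delta>_def using that \<Gamma>D(1) by (auto intro!: exI[of _ 0])
  have \<Delta>_C: "b \<in> C" if "(b, d) \<in> \<Delta>" for b d
    using that by (auto simp: \<Delta>_def)
  \<comment> \<open>This is the purpose of saturating: a constraint at
    \<open>fps_X \<star> m\<close> descends to \<open>m\<close>, which makes the prescriptions for
    successive coefficients consistent.\<close>
  have \<Delta>_div: "\<exists>d'. d = fps_X * d' \<and> (m, d') \<in> \<Delta>" if m: "m \<in> C" "(fps_X \<star> m, d) \<in> \<Delta>" for m d
  proof -
    obtain n where n: "(fps_X ^ n \<star> fps_X \<star> m, fps_X ^ n * d) \<in> \<Gamma>"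
      using m by (auto simp: \<Delta>_def)
    have eq: "fps_X ^ n \<star> fps_X \<star> m = fps_X ^ Suc n \<star> m"
      using m by (simp add: mult_sm X_power_sm_commute)
    then have "fps_X ^ Suc n dvd fps_X ^ n * d" using div m n by metis
    then have "fps_X dvd d" by simp
    then obtain d' where d': "d = fps_X * d'" by (auto elim: dvdE)
    have "(fps_X ^ Suc n \<star> m, fps_X ^ Suc n * d') \<in> \<Gamma>"
      using n d' eq by (simp add: ac_simps)
    then show ?thesis using d' m unfolding \<Delta>_def by blast
  qed
  \<comment> \<open>Coefficient \<open>n\<close> of \<open>\<phi> (fps_X \<star> m)\<close> has to
    be coefficient \<open>n - 1\<close> of \<open>\<phi> m\<close>; for \<open>n = 0\<close> there
    is none, and the form vanishes on yC.\<close>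
  define P where "P n c \<longleftrightarrow> const.linear_to (\<lambda>a. a) c \<and> (\<forall>b d. (b, d) \<in> \<Delta> \<longrightarrow> c b = d $ n) \<and>
    (n = 0 \<longrightarrow> (\<forall>m\<in>C. c (fps_X \<star> m) = 0))" for n and c :: "'m \<Rightarrow> 'f"
  have step: "\<exists>c'. const.linear_to (\<lambda>a. a) c' \<and> (\<forall>b d. (b, d) \<in> \<Delta> \<longrightarrow> c' b = d $ n) \<and>
      (\<forall>m\<in>C. c' (fps_X \<star> m) = c m)"
    if c: "const.linear_to (\<lambda>a. a) c"
      and compat: "\<And>m d. m \<in> C \<Longrightarrow> (fps_X \<star> m, d) \<in> \<Delta> \<Longrightarrow> d $ n = c m" for c n
  proof -
    \<comment> \<open>The new form is prescribed on yC by \<open>c\<close> and on the domain of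
      \<open>\<Delta>\<close> by a coefficient; \<open>compat\<close> says that the two agree where
      yC meets that domain.\<close>
    define \<Theta> where "\<Theta> = {(fps_X \<star> m \<boxplus> b, c m + d $ n) | m b d. m \<in> C \<and> (b, d) \<in> \<Delta>}"
    have \<Theta>I: "(fps_X \<star> m \<boxplus> b, c m + d $ n) \<in> \<Theta>" if "m \<in> C" "(b, d) \<in> \<Delta>" for m b d
      using that by (auto simp: \<Theta>_def)
    have zz: "(zr, 0) \<in> \<Delta>" using \<Gamma>\<Delta> \<Gamma>D(2) by blast
    note c0 = const.linear_to_zr[OF c] and cD = const.linear_toD[OF c]
    have "const.linear_graph (\<lambda>a. a) \<Theta>"
      unfolding const.linear_graph_def
    proof (intro conjI allI impI)
      show "\<Theta> \<subseteq> C \<times> UNIV" using \<Delta>_C by (auto simp: \<Theta>_def)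
      show "(zr, 0) \<in> \<Theta>" using \<Theta>I[OF zr_closed zz] c0 by simp
    next
      fix a p t assume "(p, t) \<in> \<Theta>"
      then obtain m b d where m: "p = fps_X \<star> m \<boxplus> b" "t = c m + d $ n" "m \<in> C" "(b, d) \<in> \<Delta>"
        by (auto simp: \<Theta>_def)
      have "fps_const a \<star> p = fps_X \<star> fps_const a \<star> m \<boxplus> fps_const a \<star> b"
        using m(3) \<Delta>_C[OF m(4)] X_power_sm_commute[of m 1 "fps_const a"] by (simp add: m sm_add)
      moreover have "a * t = c (fps_const a \<star> m) + (fps_const a * d) $ n"
        using m by (simp add: cD algebra_simps)
      ultimately show "(fps_const a \<star> p, a * t) \<in> \<Theta>"
        using \<Theta>I[OF sm_closed[OF m(3)] \<Delta>_sm[OF m(4)]] by metis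
    next
      fix p t q u assume "(p, t) \<in> \<Theta>" "(q, u) \<in> \<Theta>"
      then obtain m b d m' b' d' where m: "p = fps_X \<star> m \<boxplus> b" "t = c m + d $ n" "m \<in> C" "(b, d) \<in> \<Delta>"
        and m': "q = fps_X \<star> m' \<boxplus> b'" "u = c m' + d' $ n" "m' \<in> C" "(b', d') \<in> \<Delta>"
        unfolding \<Theta>_def by blast
      have "p \<boxplus> q = fps_X \<star> (m \<boxplus> m') \<boxplus> (b \<boxplus> b')"
        using m(3) m'(3) \<Delta>_C[OF m(4)] \<Delta>_C[OF m'(4)] by (simp add: m m' sm_add add_ac)
      moreover have "t + u = c (m \<boxplus> m') + (d + d') $ n"
        using m m' by (simp add: cD)
      ultimately show "(p \<boxplus> q, t + u) \<in> \<Theta>"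
        using \<Theta>I[OF add_closed[OF m(3) m'(3)] \<Delta>_add[OF m(4) m'(4)]] by metis
    qed
    moreover have "t = 0" if zt: "(zr, t) \<in> \<Theta>" for t
    proof -
      obtain m b d where m: "fps_X \<star> m \<boxplus> b = zr" "t = c m + d $ n" "m \<in> C" "(b, d) \<in> \<Delta>"
        using zt unfolding \<Theta>_def by auto
      have "b = (-1) \<star> fps_X \<star> m"
        using m \<Delta>_C[OF m(4)] eq_neg_iff[of b "fps_X \<star> m"] by (simp add: add_comm)
      then have "b = fps_X \<star> (-1) \<star> m" using m(3) X_power_sm_commute[of m 1 "-1"] by simp
      then have "d $ n = c ((-1) \<star> m)" using compat[of "(-1) \<star> m" d] m by simp
      also have "\<dots> = - c m"
        using cD(2)[OF m(3), of "-1"] by (simp flip: fps_const_neg)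
      finally show ?thesis using m by simp
    qed
    ultimately obtain f where f: "const.linear_to (\<lambda>a. a) f" "\<And>m t. (m, t) \<in> \<Theta> \<Longrightarrow> f m = t"
      using const.linear_extension[of "\<lambda>a. a" \<Theta>] by blast
    have "f b = d $ n" if "(b, d) \<in> \<Delta>" for b d
      using f(2)[OF \<Theta>I[OF zr_closed that]] \<Delta>_C[OF that] c0 by simp
    moreover have "f (fps_X \<star> m) = c m" if "m \<in> C" for m
      using f(2)[OF \<Theta>I[OF that zz]] that by simp
    ultimately show ?thesis using f(1) by blast
  qed
  have "\<exists>c. \<forall>n. P n (c n) \<and> (\<forall>m\<in>C. c (Suc n) (fps_X \<star> m) = c n m)"
  proof (rule dependent_nat_choice)
    have "d $ 0 = 0" if "m \<in> C" "(fps_X \<star> m, d) \<in> \<Delta>" for m d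
      using \<Delta>_div[OF that] by auto
    moreover have "const.linear_to (\<lambda>a. a) (\<lambda>m. 0)" by (simp add: const.linear_to_def)
    ultimately show "\<exists>c. P 0 c" using step[of "\<lambda>m. 0" 0] by (simp add: P_def)
    fix c n assume c: "P n c"
    have "d $ Suc n = c m" if "m \<in> C" "(fps_X \<star> m, d) \<in> \<Delta>" for m d
      using \<Delta>_div[OF that] c by (auto simp: P_def)
    then show "\<exists>c'. P (Suc n) c' \<and> (\<forall>m\<in>C. c' (fps_X \<star> m) = c m)"
      using step[of c "Suc n"] c by (simp add: P_def)
  qed
  then obtain c where c: "\<And>n. P n (c n)" "\<And>n m. m \<in> C \<Longrightarrow> c (Suc n) (fps_X \<star> m) = c n m"
    by blast
  have c_lin: "const.linear_to (\<lambda>a. a) (c n)" for n using c(1) by (simp add: P_def)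
  define \<phi> where "\<phi> m = Abs_fps (\<lambda>n. c n m)" for m
  have "linear_to (\<lambda>d. d) \<phi>"
  proof (rule linear_to_fpsI; rule fps_ext)
    show "\<phi> (m \<boxplus> m') $ n = (\<phi> m + \<phi> m') $ n" if "m \<in> C" "m' \<in> C" for m m' n
      using const.linear_toD(1)[OF c_lin that] by (simp add: \<phi>_def)
    show "\<phi> (fps_const a \<star> m) $ n = (fps_const a * \<phi> m) $ n" if "m \<in> C" for m a n
      using const.linear_toD(2)[OF c_lin that] by (simp add: \<phi>_def)
    show "\<phi> (fps_X \<star> m) $ n = (fps_X * \<phi> m) $ n" if "m \<in> C" for m n
      using c that by (cases n) (auto simp: \<phi>_def P_def)
  qed
  moreover have "\<phi> b = d" if "(b, d) \<in> \<Gamma>" for b d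
    using c(1) \<Gamma>\<Delta>[OF that] by (intro fps_ext) (simp add: \<phi>_def P_def)
  ultimately show thesis using that by blast
qed

end

lemma fps_unit_decomposition:
  fixes d :: "'f::field fps"
  assumes "d \<noteq> 0"
  obtains u v where "d = u * fps_X ^ subdegree d" "v * u = 1"
proof
  show "d = fps_shift (subdegree d) d * fps_X ^ subdegree d" by (rule subdegree_decompose)
  show "inverse (fps_shift (subdegree d) d) * fps_shift (subdegree d) d = 1"
    using assms by (intro inverse_mult_eq_1) simp
qed

lemma fls_denominator:
  fixes c :: "'f::field fls"
  obtains n d where "fps_to_fls (fps_X ^ n) * c = fps_to_fls d"
proof
  let ?n = "nat (- fls_subdegree c)"
  have "fls_subdegree (fps_to_fls (fps_X ^ ?n) * c) \<ge> 0"
    by (cases "c = 0") (auto simp: fps_to_fls_power fls_subdegree_fls_to_fps)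
  then show "fps_to_fls (fps_X ^ ?n) * c = fps_to_fls (fls_regpart (fps_to_fls (fps_X ^ ?n) * c))"
    by simp
qed

lemma (in fps_module) linear_extension_fls:
  assumes "linear_graph fps_to_fls \<Gamma>" "\<And>t. (zr, t) \<in> \<Gamma> \<Longrightarrow> t = 0"
  obtains f where "linear_to fps_to_fls f" "\<And>m t. (m, t) \<in> \<Gamma> \<Longrightarrow> f m = t"
  using linear_extension[of fps_to_fls \<Gamma>] assms by (auto simp: fls_times_fps_to_fls)

section \<open>Torsion-free modules: functionals on them and maps from F((y)) into them\<close>

locale torsion_free_fps_module = fps_module +
  assumes torsion_free: "m \<in> C \<Longrightarrow> fps_X \<star> m = zr \<Longrightarrow> m = zr"
begin

lemma X_power_torsion_free: "m \<in> C \<Longrightarrow> fps_X ^ n \<star> m = zr \<Longrightarrow> m = zr"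
proof (induction n)
  case (Suc n)
  then show ?case using torsion_free[of "fps_X ^ n \<star> m"] by (simp add: mult_sm)
qed simp

lemma X_power_cancel:
  assumes "m \<in> C" "m' \<in> C" "fps_X ^ n \<star> m = fps_X ^ n \<star> m'"
  shows "m = m'"
proof -
  have "fps_X ^ n \<star> (m \<boxplus> (-1) \<star> m') = fps_X ^ n \<star> m \<boxplus> (-1) \<star> fps_X ^ n \<star> m'"
    using assms(1,2) by (simp add: sm_add X_power_sm_commute)
  also have "\<dots> = zr" using assms by simp
  finally show ?thesis
    using assms(1,2) X_power_torsion_free[of "m \<boxplus> (-1) \<star> m'" n] eq_iff_diff[of m m'] by simp
qed

text \<open>F[[y]] is a discrete valuation ring: \<open>d\<close> is a unit times a power of y, so
  torsion-freeness with respect to y is enough.\<close>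

lemma sm_eq_zr:
  assumes "m \<in> C" "d \<star> m = zr" "m \<noteq> zr"
  shows "d = 0"
proof (rule ccontr)
  assume "d \<noteq> 0"
  then obtain u v where uv: "d = u * fps_X ^ subdegree d" "v * u = 1"
    by (rule fps_unit_decomposition)
  have "fps_X ^ subdegree d \<star> m = v \<star> d \<star> m"
    using assms(1) uv by (metis mult.assoc mult.left_neutral mult_sm)
  then show False using assms X_power_torsion_free[of m "subdegree d"] by simp
qed

lemma linear_graph_multiples:
  assumes "v \<in> C" "\<And>a b. \<iota> (a + b) = \<iota> a + \<iota> b" "\<And>a b. \<iota> (a * b) = \<iota> a * \<iota> b"
  shows "linear_graph \<iota> {(d \<star> v, \<iota> d) | d. True}"
proof -
  have "\<iota> 0 = 0" by (metis assms(2) add.right_neutral add_left_cancel)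
  then have "(zr, 0) \<in> {(d \<star> v, \<iota> d) | d. True}" using assms(1) by (auto intro!: exI[of _ 0])
  then show ?thesis
    unfolding linear_graph_def using assms
    by (auto simp flip: add_sm mult_sm)
qed

text \<open>An element outside yC generates a pure submodule: if
  \<open>fps_X ^ n \<star> b = d \<star> v\<close>, where \<open>d\<close> is a unit times y^k with
  k < n, then cancelling y^k exhibits \<open>v\<close> as a multiple of y. So the partial functional
  that sends \<open>v\<close> to 1 respects divisibility.\<close>

lemma functional_one:
  assumes v: "v \<in> C" "\<And>w. w \<in> C \<Longrightarrow> fps_X \<star> w \<noteq> v"
  obtains \<beta> where "linear_to (\<lambda>d. d) \<beta>" "\<beta> v = 1"
proof (rule fps_linear_extension)
  show "linear_graph (\<lambda>d. d) {(d \<star> v, d) | d. True}"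
    using linear_graph_multiples[of v "\<lambda>d. d"] v by simp
  fix n b d assume b: "b \<in> C" "(fps_X ^ n \<star> b, d) \<in> {(d \<star> v, d) | d. True}"
  show "fps_X ^ n dvd d"
  proof (rule ccontr)
    assume nd: "\<not> fps_X ^ n dvd d"
    define k where "k = subdegree d"
    have "d \<noteq> 0" using nd by auto
    have k: "k < n" using nd \<open>d \<noteq> 0\<close> by (auto simp: fps_dvd_iff k_def)
    obtain u w where uw: "d = u * fps_X ^ k" "w * u = 1"
      using fps_unit_decomposition[OF \<open>d \<noteq> 0\<close>] unfolding k_def by blast
    \<comment> \<open>The exponent leaves exactly one further factor y once \<open>fps_X ^ k\<close>
      is cancelled.\<close>
    define e where "e = fps_X ^ (n - k - 1) \<star> b"
    have e: "e \<in> C" using b by (simp add: e_def)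
    have "(fps_X ^ n :: 'b fps) = fps_X ^ k * (fps_X * fps_X ^ (n - k - 1))"
      using k by (simp flip: power_add power_Suc)
    then have "fps_X ^ k \<star> fps_X \<star> e = fps_X ^ n \<star> b"
      unfolding e_def using b(1) by (simp only: mult_sm sm_closed)
    also have "\<dots> = fps_X ^ k \<star> u \<star> v"
    proof -
      have "fps_X ^ n \<star> b = (u * fps_X ^ k) \<star> v" using b(2) uw(1) by auto
      then show ?thesis using v(1) by (simp only: mult.commute[of u] mult_sm)
    qed
    finally have "fps_X \<star> e = u \<star> v"
      by (rule X_power_cancel[rotated 2]) (use e v(1) in auto)
    then have "w \<star> fps_X \<star> e = (w * u) \<star> v" using v(1) by (simp add: mult_sm)
    then have "fps_X \<star> w \<star> e = v"
      using uw v(1) e X_power_sm_commute[of e 1 w] by simp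
    then show False using v(2)[of "w \<star> e"] e by simp
  qed
next
  fix \<phi> assume "linear_to (\<lambda>d. d) \<phi>" "\<And>b d. (b, d) \<in> {(d \<star> v, d) | d. True} \<Longrightarrow> \<phi> b = d"
  moreover from this(2)[of "1 \<star> v" 1] have "\<phi> v = 1" using v(1) by auto
  ultimately show thesis using that by blast
qed

lemma functional_fls_one:
  assumes u: "u \<in> C" "u \<noteq> zr"
  obtains f where "linear_to fps_to_fls f" "f u = 1"
proof (rule linear_extension_fls)
  show "linear_graph fps_to_fls {(d \<star> u, fps_to_fls d) | d. True}"
    using linear_graph_multiples[of u fps_to_fls] u by (simp add: fls_times_fps_to_fls)
  show "t = 0" if zt: "(zr, t) \<in> {(d \<star> u, fps_to_fls d) | d. True}" for t
  proof -
    obtain d where d: "d \<star> u = zr" "t = fps_to_fls d" using zt by auto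
    then show ?thesis using sm_eq_zr[OF u(1) d(1) u(2)] by simp
  qed
  fix f assume "linear_to fps_to_fls f"
    "\<And>m t. (m, t) \<in> {(d \<star> u, fps_to_fls d) | d. True} \<Longrightarrow> f m = t"
  moreover from this(2)[of "1 \<star> u" "fps_to_fls 1"] have "f u = 1" using u(1) by fastforce
  ultimately show thesis using that by blast
qed

text \<open>An F[[y]]-linear map from F((y)) to C. Torsion-freeness makes it determined by its value
  at 1.\<close>

definition fls_line :: "('b fls \<Rightarrow> 'a) \<Rightarrow> bool"
  where "fls_line g \<longleftrightarrow> range g \<subseteq> C \<and> (\<forall>c c'. g (c + c') = g c \<boxplus> g c') \<and>
    (\<forall>d c. g (fps_to_fls d * c) = d \<star> g c)"

lemma fls_lineD:
  assumes "fls_line g"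
  shows "g c \<in> C" and "g (c + c') = g c \<boxplus> g c'" and "g (fps_to_fls d * c) = d \<star> g c"
  using assms by (auto simp: fls_line_def)

lemma fls_line_denominator:
  assumes "fls_line g" "fps_to_fls (fps_X ^ n) * c = fps_to_fls d"
  shows "fps_X ^ n \<star> g c = d \<star> g 1"
  using assms by (metis fls_lineD(3) mult.right_neutral)

text \<open>Clearing the denominator of \<open>c\<close> shows that an F[[y]]-linear map from F((y))
  to itself is linear over F((y)), hence multiplication by its value at 1; here the map is
  \<open>f\<close> composed with \<open>g\<close>.\<close>

lemma linear_to_fls_line:
  assumes g: "fls_line g" and f: "linear_to fps_to_fls f"
  shows "f (g c) = c * f (g 1)"
proof -
  obtain n d where n: "fps_to_fls (fps_X ^ n) * c = fps_to_fls d" by (rule fls_denominator)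
  have "fps_to_fls (fps_X ^ n) * f (g c) = f (d \<star> g 1)"
    using fls_line_denominator[OF g n] linear_toD(2)[OF f fls_lineD(1)[OF g]] by metis
  also have "\<dots> = fps_to_fls (fps_X ^ n) * (c * f (g 1))"
    using linear_toD(2)[OF f fls_lineD(1)[OF g]] n by (simp add: mult.assoc[symmetric])
  finally show ?thesis by (simp add: fps_to_fls_power)
qed

text \<open>Fractions of \<open>u\<close> are unique in a torsion-free module, so divisibility of
  the single element \<open>u\<close> by all powers of y suffices to define all cu
  consistently.\<close>

lemma fls_line_exists:
  assumes u: "u \<in> C" and div: "\<And>n. \<exists>v\<in>C. fps_X ^ n \<star> v = u"
  obtains g where "fls_line g" "g 1 = u"
proof -
  \<comment> \<open>\<open>P c v\<close> says v = cu with the denominator of \<open>c\<close>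
    cleared.\<close>
  define P where "P c v \<longleftrightarrow> v \<in> C \<and>
    (\<exists>n d. fps_to_fls (fps_X ^ n) * c = fps_to_fls d \<and> fps_X ^ n \<star> v = d \<star> u)" for c :: "'b fls" and v
  have "\<exists>v. P c v" for c
  proof -
    obtain n d where n: "fps_to_fls (fps_X ^ n) * c = fps_to_fls d" by (rule fls_denominator)
    obtain v where "v \<in> C" "fps_X ^ n \<star> v = u" using div by blast
    then have "P c (d \<star> v)" using n by (auto simp: P_def X_power_sm_commute intro!: exI[of _ n])
    then show ?thesis ..
  qed
  then obtain g where g: "\<And>c. P c (g c)" by metis
  have uniq: "v = v'" if v: "P c v" and v': "P c v'" for c v v'
  proof -
    obtain n d m e where n: "fps_to_fls (fps_X ^ n) * c = fps_to_fls d" "fps_X ^ n \<star> v = d \<star> u"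
      and m: "fps_to_fls (fps_X ^ m) * c = fps_to_fls e" "fps_X ^ m \<star> v' = e \<star> u"
      and C: "v \<in> C" "v' \<in> C"
      using v v' by (auto simp: P_def)
    have "fps_to_fls (fps_X ^ m * d) = fps_to_fls (fps_X ^ n * e)"
      by (simp add: fls_times_fps_to_fls flip: n(1) m(1))
    then have eq: "fps_X ^ m * d = fps_X ^ n * e" by simp
    have "fps_X ^ m \<star> fps_X ^ n \<star> v = (fps_X ^ m * d) \<star> u"
      using n u by (simp add: mult_sm)
    also have "\<dots> = fps_X ^ n \<star> fps_X ^ m \<star> v'"
      unfolding eq using m u by (simp add: mult_sm)
    also have "\<dots> = fps_X ^ m \<star> fps_X ^ n \<star> v'"
      using C by (intro X_power_sm_commute)
    finally show ?thesis using C X_power_cancel sm_closed by metis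
  qed
  have "g (c + c') = g c \<boxplus> g c'" for c c'
  proof -
    obtain n d m e where n: "fps_to_fls (fps_X ^ n) * c = fps_to_fls d" "fps_X ^ n \<star> g c = d \<star> u"
      and m: "fps_to_fls (fps_X ^ m) * c' = fps_to_fls e" "fps_X ^ m \<star> g c' = e \<star> u"
      and C: "g c \<in> C" "g c' \<in> C"
      using g[of c] g[of c'] by (auto simp: P_def)
    have "fps_X ^ (m + n) \<star> (g c \<boxplus> g c') = fps_X ^ m \<star> fps_X ^ n \<star> g c \<boxplus> fps_X ^ n \<star> fps_X ^ m \<star> g c'"
      using C X_power_sm_commute[of "g c'" n "fps_X ^ m"] by (simp add: power_add mult_sm sm_add)
    also have "\<dots> = (fps_X ^ m * d + fps_X ^ n * e) \<star> u"
      using n m u by (simp add: add_sm mult_sm)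
    finally have 1: "fps_X ^ (m + n) \<star> (g c \<boxplus> g c') = (fps_X ^ m * d + fps_X ^ n * e) \<star> u" .
    have 2: "fps_to_fls (fps_X ^ (m + n)) * (c + c') = fps_to_fls (fps_X ^ m * d + fps_X ^ n * e)"
      by (simp add: fls_times_fps_to_fls power_add algebra_simps flip: n(1) m(1))
    have "P (c + c') (g c \<boxplus> g c')" unfolding P_def using 1 2 C by blast
    then show ?thesis using g uniq by blast
  qed
  moreover have "g (fps_to_fls e * c) = e \<star> g c" for e c
  proof -
    obtain n d where n: "fps_to_fls (fps_X ^ n) * c = fps_to_fls d" "fps_X ^ n \<star> g c = d \<star> u"
      and C: "g c \<in> C"
      using g[of c] by (auto simp: P_def)
    have 1: "fps_X ^ n \<star> e \<star> g c = (e * d) \<star> u"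
      using C u n by (simp add: X_power_sm_commute mult_sm)
    have 2: "fps_to_fls (fps_X ^ n) * (fps_to_fls e * c) = fps_to_fls (e * d)"
      by (simp add: fls_times_fps_to_fls algebra_simps flip: n(1))
    have "P (fps_to_fls e * c) (e \<star> g c)" unfolding P_def using 1 2 C by blast
    then show ?thesis using g uniq by blast
  qed
  moreover have "range g \<subseteq> C" using g by (auto simp: P_def)
  ultimately have "fls_line g" by (simp add: fls_line_def)
  moreover have "g 1 = u"
  proof -
    have "P 1 u" unfolding P_def using u by (auto intro!: exI[of _ 0] exI[of _ 1])
    then show ?thesis using g uniq by blast
  qed
  ultimately show thesis using that by blast
qed

end

section \<open>Modules over \<open>F[[y]][x]/(x\<^sup>2)\<close>\<close>

locale dual_module = fps_module C add zr sm
  for C :: "'m set" and add (infixl \<open>\<boxplus>\<close> 65) and zr :: 'm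
    and sm :: "'f::field fps \<Rightarrow> 'm \<Rightarrow> 'm" (infixr \<open>\<star>\<close> 75) +
  fixes xi :: "'m \<Rightarrow> 'm"
  assumes xi_closed [simp, intro]: "m \<in> C \<Longrightarrow> xi m \<in> C"
    and xi_add: "m \<in> C \<Longrightarrow> n \<in> C \<Longrightarrow> xi (m \<boxplus> n) = xi m \<boxplus> xi n"
    and xi_sm: "m \<in> C \<Longrightarrow> xi (d \<star> m) = d \<star> xi m"
    and xi_xi [simp]: "m \<in> C \<Longrightarrow> xi (xi m) = zr"
begin

lemma xi_zr [simp]: "xi zr = zr"
  using xi_sm[of zr 0] by simp

text \<open>Making xC a module of its own allows divisibility by y to be tested inside xC, which is
  more restrictive than divisibility in C.\<close>

lemma xi_image_module: "fps_module (xi ` C) (\<boxplus>) zr (\<star>)"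
proof unfold_locales
  show "m \<boxplus> n \<in> xi ` C" if "m \<in> xi ` C" "n \<in> xi ` C" for m n
    using that by (auto simp flip: xi_add)
  show "zr \<in> xi ` C" using xi_zr zr_closed by (metis image_eqI)
  show "d \<star> m \<in> xi ` C" if "m \<in> xi ` C" for m d
    using that by (auto simp flip: xi_sm)
qed (auto simp: sm_add add_sm mult_sm add_assoc intro: add_comm)

definition endomorphism :: "('m \<Rightarrow> 'm) \<Rightarrow> bool"
  where "endomorphism e \<longleftrightarrow> (\<forall>m\<in>C. e m \<in> C) \<and> (\<forall>m\<in>C. \<forall>n\<in>C. e (m \<boxplus> n) = e m \<boxplus> e n) \<and>
    (\<forall>d. \<forall>m\<in>C. e (d \<star> m) = d \<star> e m) \<and> (\<forall>m\<in>C. e (xi m) = xi (e m))"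

definition trivial_idempotents :: bool
  where "trivial_idempotents \<longleftrightarrow> (\<forall>e. endomorphism e \<longrightarrow> (\<forall>m\<in>C. e (e m) = e m) \<longrightarrow>
    (\<exists>m\<in>C. e m \<noteq> zr) \<longrightarrow> (\<forall>m\<in>C. e m = m))"

text \<open>The two generators may coincide, so that a summand F[[y]]v on which x vanishes is
  covered as well.\<close>

definition two_generated :: bool
  where "two_generated \<longleftrightarrow> (\<exists>w\<in>C. \<exists>v\<in>C. \<forall>m\<in>C. \<exists>a b. m = a \<star> w \<boxplus> b \<star> v)"

text \<open>The modules \<open>G\<close>, \<open>R + xQ\<close> and \<open>Q\<close> are \<open>{(a, b). a \<in> S, b \<in> F((y))}\<close> with
  \<open>x(a, b) = (0, a)\<close>, where \<open>S\<close> is \<open>0\<close>, \<open>F[[y]]\<close> and \<open>F((y))\<close>, respectively. An isomorphism onto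
  such a module is determined by its second component \<open>\<beta>\<close>.\<close>

definition coordinate :: "'f fls set \<Rightarrow> ('m \<Rightarrow> 'f fls) \<Rightarrow> bool"
  where "coordinate S \<beta> \<longleftrightarrow> linear_to fps_to_fls \<beta> \<and>
    bij_betw (\<lambda>m. (\<beta> (xi m), \<beta> m)) C (S \<times> UNIV)"

end

section \<open>Splitting off a summand from a Cohen-Macaulay module\<close>

locale cm_dual_module = dual_module + torsion_free_fps_module
begin

text \<open>The functional \<open>f\<close> induces m |-> (f(xm), f(m)) into M(S), and
  \<open>\<tau>\<close> is a section of it: \<open>h\<close> gives an element with prescribed image
  under x, and a correction along the line \<open>g\<close>, which x annihilates, adjusts the value
  of \<open>f\<close>. The composite \<open>e\<close> is therefore idempotent, and triviality of
  idempotents makes the induced map bijective.\<close>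

lemma coordinateI_split:
  assumes triv: trivial_idempotents
    and f: "linear_to fps_to_fls f" "\<And>m. m \<in> C \<Longrightarrow> f (xi m) \<in> S"
    and g: "fls_line g" "f (g 1) = 1" "\<And>c. xi (g c) = zr"
    and S: "0 \<in> S"
    and h: "\<And>a. a \<in> S \<Longrightarrow> h a \<in> C" "\<And>a b. a \<in> S \<Longrightarrow> b \<in> S \<Longrightarrow> h (a + b) = h a \<boxplus> h b"
      "\<And>d a. a \<in> S \<Longrightarrow> h (fps_to_fls d * a) = d \<star> h a" "\<And>a. a \<in> S \<Longrightarrow> xi (h a) = g a"
  shows "coordinate S f"
proof -
  have fg: "f (g c) = c" for c using linear_to_fls_line[OF g(1) f(1)] g(2) by simp
  note fD = linear_toD[OF f(1)] and gD = fls_lineD[OF g(1)]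
  define \<tau> where "\<tau> a b = h a \<boxplus> g (b - f (h a))" for a b
  have \<tau>C: "\<tau> a b \<in> C" if "a \<in> S" for a b
    using that h(1) gD(1) by (simp add: \<tau>_def)
  have xi\<tau>: "xi (\<tau> a b) = g a" if "a \<in> S" for a b
    using that h(1,4) gD(1) g(3) by (simp add: \<tau>_def xi_add)
  have f\<tau>: "f (\<tau> a b) = b" if "a \<in> S" for a b
    using that h(1) gD(1) fg by (simp add: \<tau>_def fD)
  have h0: "h 0 = zr" using h(1)[OF S] h(3)[OF S, of 0] by simp
  define e where "e m = \<tau> (f (xi m)) (f m)" for m
  have "endomorphism e"
    unfolding endomorphism_def
  proof (intro conjI ballI allI)
    fix m assume m: "m \<in> C"
    show "e m \<in> C" using m f(2) \<tau>C by (simp add: e_def)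
    show "e (d \<star> m) = d \<star> e m" for d
    proof -
      have "fps_to_fls d * f m - fps_to_fls d * f (h (f (xi m))) = fps_to_fls d * (f m - f (h (f (xi m))))"
        by (simp add: algebra_simps)
      then show ?thesis
        using m f(2)[OF m] h(1,3) gD(1)
        by (simp add: e_def \<tau>_def xi_sm fD sm_add flip: gD(3))
    qed
    have "e (xi m) = g (f (xi m))"
      using m h0 gD(1) linear_to_zr[OF f(1)] by (simp add: e_def \<tau>_def)
    then show "e (xi m) = xi (e m)" using xi\<tau> f(2) m by (simp add: e_def)
    fix n assume n: "n \<in> C"
    have "f m + f n - (f (h (f (xi m))) + f (h (f (xi n)))) =
        (f m - f (h (f (xi m)))) + (f n - f (h (f (xi n))))" by simp
    then have "g (f m + f n - (f (h (f (xi m))) + f (h (f (xi n))))) =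
        g (f m - f (h (f (xi m)))) \<boxplus> g (f n - f (h (f (xi n))))" by (simp only: gD(2))
    then show "e (m \<boxplus> n) = e m \<boxplus> e n"
      using m n f(2) h(1,2) gD(1) by (simp add: e_def \<tau>_def xi_add fD add_ac)
  qed
  moreover have "e (e m) = e m" if "m \<in> C" for m
    using that f(2) by (simp add: e_def xi\<tau> f\<tau> fg)
  moreover have "g 1 \<in> C" "e (g 1) \<noteq> zr"
    using gD(1) f\<tau>[OF S, of 1] g linear_to_zr[OF f(1)] by (auto simp: e_def)
  ultimately have e: "e m = m" if "m \<in> C" for m
    using triv that unfolding trivial_idempotents_def by blast
  have "bij_betw (\<lambda>m. (f (xi m), f m)) C (S \<times> UNIV)"
    by (rule bij_betwI[where g = "\<lambda>(a, b). \<tau> a b"])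
      (use e f(2) \<tau>C xi\<tau> f\<tau> fg in \<open>auto simp: e_def\<close>)
  then show ?thesis using f(1) by (simp add: coordinate_def)
qed

lemma xi_zero_divisible_imp_G:
  assumes triv: trivial_idempotents and nz: "C \<noteq> {zr}"
    and xi0: "\<And>m. m \<in> C \<Longrightarrow> xi m = zr" and div: "\<And>m. m \<in> C \<Longrightarrow> \<exists>v\<in>C. fps_X \<star> v = m"
  shows "\<exists>f. coordinate {0} f"
proof -
  obtain u where u: "u \<in> C" "u \<noteq> zr" using nz zr_closed by blast
  have "\<exists>v\<in>C. fps_X ^ n \<star> v = m" if "m \<in> C" for n m
    using that
  proof (induction n arbitrary: m)
    case (Suc n)
    then obtain v where v: "v \<in> C" "fps_X \<star> v = m" using div by blast
    obtain w where w: "w \<in> C" "fps_X ^ n \<star> w = v" using Suc.IH[OF v(1)] by blast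
    then show ?case using v by (auto simp: mult_sm intro!: bexI[of _ w])
  qed auto
  then obtain g where g: "fls_line g" "g 1 = u" using fls_line_exists[OF u(1)] u(1) by metis
  obtain f where f: "linear_to fps_to_fls f" "f u = 1" using functional_fls_one[OF u] .
  have "g 0 = zr" using fls_lineD(3)[OF g(1), of 0 1] u g by simp
  \<comment> \<open>Since S = {0}, nothing has to be lifted along x and \<open>h\<close> is the zero
    map.\<close>
  then have "coordinate {0} f"
    using g f xi0 fls_lineD(1)[OF g(1)] linear_to_zr[OF f(1)]
    by (intro coordinateI_split[OF triv f(1) _ g(1), where h = "\<lambda>_. zr"]) auto
  then show ?thesis by blast
qed

lemma not_divisible_imp_two_generated:
  assumes triv: trivial_idempotents
    and xi0: "\<And>m. m \<in> C \<Longrightarrow> xi m = zr" and v: "v \<in> C" "\<And>w. w \<in> C \<Longrightarrow> fps_X \<star> w \<noteq> v"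
  shows two_generated
proof -
  obtain \<beta> where \<beta>: "linear_to (\<lambda>d. d) \<beta>" "\<beta> v = 1" using functional_one[OF v] by blast
  note \<beta>D = linear_toD[OF \<beta>(1)]
  \<comment> \<open>The projection onto F[[y]]v; it commutes with x because both composites
    vanish.\<close>
  define e where "e m = \<beta> m \<star> v" for m
  have "endomorphism e"
    unfolding endomorphism_def e_def using v(1) xi0 linear_to_zr[OF \<beta>(1)]
    by (auto simp: \<beta>D add_sm mult_sm)
  moreover have "\<forall>m\<in>C. e (e m) = e m" using v(1) \<beta> by (simp add: e_def \<beta>D)
  moreover have "v \<noteq> zr" using \<beta> linear_to_zr[OF \<beta>(1)] by auto
  then have "\<exists>m\<in>C. e m \<noteq> zr" using v(1) \<beta> by (auto simp: e_def intro!: bexI[of _ v])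
  ultimately have e: "\<beta> m \<star> v = m" if "m \<in> C" for m
    using triv that unfolding trivial_idempotents_def e_def by blast
  have "\<exists>a b. m = a \<star> v \<boxplus> b \<star> v" if "m \<in> C" for m
    using e[OF that] v(1) that by (intro exI[of _ "\<beta> m"] exI[of _ 0]) simp
  then show ?thesis unfolding two_generated_def using v(1) by blast
qed

text \<open>Minimality of the failing exponent n + 1 gives xw = y^n v with \<open>v\<close> outside
  yC, and torsion-freeness gives xv = 0. So \<open>w\<close> and \<open>v\<close> span a copy of the
  ideal (x, y^n) of R, with \<open>w\<close> in the role of y^n and \<open>v\<close> in that of x.
  Its projection comes from a functional with value 1 at \<open>v\<close>, whose values on xC are
  divisible by y^n because xC lies in y^n C.\<close>

lemma bounded_divisibility_imp_two_generated:
  assumes triv: trivial_idempotents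
    and ex: "\<exists>n. \<exists>w\<in>C. \<forall>v\<in>C. fps_X ^ n \<star> v \<noteq> xi w"
  shows two_generated
proof -
  define k where "k = (LEAST n. \<exists>w\<in>C. \<forall>v\<in>C. fps_X ^ n \<star> v \<noteq> xi w)"
  obtain w where w: "w \<in> C" "\<And>v. v \<in> C \<Longrightarrow> fps_X ^ k \<star> v \<noteq> xi w"
    using LeastI_ex[OF ex] unfolding k_def by blast
  \<comment> \<open>At exponent 0 the equation is solved by xw itself.\<close>
  have "k \<noteq> 0" using w(2)[of "xi w"] w(1) by (intro notI) simp
  then obtain n where n: "k = Suc n" using not0_implies_Suc by blast
  have div: "\<exists>v\<in>C. fps_X ^ n \<star> v = xi m" if "m \<in> C" for m
    using not_less_Least[of n "\<lambda>n. \<exists>w\<in>C. \<forall>v\<in>C. fps_X ^ n \<star> v \<noteq> xi w"] that n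
    unfolding k_def by auto
  obtain v where v: "v \<in> C" "fps_X ^ n \<star> v = xi w" using div[OF w(1)] by blast
  have "fps_X \<star> p \<noteq> v" if "p \<in> C" for p
    using w(2)[OF that] that v(2) n X_power_sm_commute[of p n fps_X] by (auto simp: mult_sm)
  then obtain \<beta> where \<beta>: "linear_to (\<lambda>d. d) \<beta>" "\<beta> v = 1" using functional_one[OF v(1)] by blast
  note \<beta>D = linear_toD[OF \<beta>(1)] and \<beta>0 = linear_to_zr[OF \<beta>(1)]
  have "\<exists>d. \<beta> (xi m) = fps_X ^ n * d" if "m \<in> C" for m
    using div[OF that] \<beta>D(2) by metis
  then obtain \<alpha> where \<alpha>: "\<And>m. m \<in> C \<Longrightarrow> \<beta> (xi m) = fps_X ^ n * \<alpha> m" by metis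
  have cancel: "a = b" if "fps_X ^ n * a = fps_X ^ n * b" for a b :: "'b fps"
    using that by simp
  have \<alpha>_add: "\<alpha> (m \<boxplus> m') = \<alpha> m + \<alpha> m'" if "m \<in> C" "m' \<in> C" for m m'
    by (rule cancel) (use that \<alpha>[of "m \<boxplus> m'"] \<alpha>[of m] \<alpha>[of m'] in \<open>simp add: xi_add \<beta>D algebra_simps\<close>)
  have \<alpha>_sm: "\<alpha> (d \<star> m) = d * \<alpha> m" if "m \<in> C" for d m
    by (rule cancel) (use that \<alpha>[of "d \<star> m"] \<alpha>[of m] in \<open>simp add: xi_sm \<beta>D algebra_simps\<close>)
  have \<alpha>_xi: "\<alpha> (xi m) = 0" if "m \<in> C" for m
    using that \<alpha>[of "xi m"] \<beta>0 by simp
  have \<alpha>_w: "\<alpha> w = 1"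
    by (rule cancel) (use \<alpha>[OF w(1)] v \<beta>(2) \<beta>D(2)[of v "fps_X ^ n"] in simp)
  have xi_v: "xi v = zr"
  proof -
    have "fps_X ^ n \<star> xi v = zr" using v w(1) xi_sm[OF v(1), of "fps_X ^ n"] by simp
    then show ?thesis using X_power_torsion_free v(1) by blast
  qed
  have \<alpha>_v: "\<alpha> v = 0" using \<alpha>[OF v(1)] xi_v \<beta>0 by simp
  \<comment> \<open>The coordinate along \<open>w\<close> is \<open>\<alpha>\<close>; since
    \<open>\<beta> w\<close> may be nonzero, its contribution is subtracted from the coordinate
    along \<open>v\<close>.\<close>
  define e where "e m = \<alpha> m \<star> w \<boxplus> (\<beta> m - \<alpha> m * \<beta> w) \<star> v" for m
  have "endomorphism e"
    unfolding endomorphism_def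
  proof (intro conjI ballI allI)
    fix m assume m: "m \<in> C"
    show "e m \<in> C" using v(1) w(1) by (simp add: e_def)
    show "e (d \<star> m) = d \<star> e m" for d
    proof -
      have "d * \<beta> m - d * \<alpha> m * \<beta> w = d * (\<beta> m - \<alpha> m * \<beta> w)" by (simp add: algebra_simps)
      then show ?thesis using m v(1) w(1) by (simp add: e_def \<alpha>_sm \<beta>D sm_add mult_sm)
    qed
    have "e (xi m) = \<alpha> m \<star> fps_X ^ n \<star> v"
      using m v(1) w(1) \<alpha>[OF m] \<alpha>_xi[OF m] by (simp add: e_def mult.commute[of _ "\<alpha> m"] mult_sm)
    also have "\<dots> = xi (e m)"
      using v w(1) xi_v by (simp add: e_def xi_add xi_sm)
    finally show "e (xi m) = xi (e m)" .
    fix m' assume m': "m' \<in> C"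
    have "\<beta> m + \<beta> m' - (\<alpha> m + \<alpha> m') * \<beta> w = (\<beta> m - \<alpha> m * \<beta> w) + (\<beta> m' - \<alpha> m' * \<beta> w)"
      by (simp add: algebra_simps)
    then have "(\<beta> m + \<beta> m' - (\<alpha> m + \<alpha> m') * \<beta> w) \<star> v =
        (\<beta> m - \<alpha> m * \<beta> w) \<star> v \<boxplus> (\<beta> m' - \<alpha> m' * \<beta> w) \<star> v"
      using v(1) by (simp only: add_sm)
    moreover have "e (m \<boxplus> m') = (\<alpha> m + \<alpha> m') \<star> w \<boxplus> (\<beta> m + \<beta> m' - (\<alpha> m + \<alpha> m') * \<beta> w) \<star> v"
      using m m' by (simp add: e_def \<alpha>_add \<beta>D)
    ultimately show "e (m \<boxplus> m') = e m \<boxplus> e m'"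
      using v(1) w(1) by (simp add: e_def add_sm[of w] add_ac)
  qed
  moreover have "\<forall>m\<in>C. e (e m) = e m"
    using v(1) w(1) by (simp add: e_def \<alpha>_add \<alpha>_sm \<alpha>_w \<alpha>_v \<beta>D \<beta>(2))
  moreover have "e v = v" using v(1) w(1) \<alpha>_v \<beta>(2) by (simp add: e_def)
  moreover have "v \<noteq> zr" using \<beta> \<beta>0 by auto
  ultimately have e: "e m = m" if "m \<in> C" for m
    using triv that v(1) unfolding trivial_idempotents_def by metis
  then have "\<exists>a b. m = a \<star> w \<boxplus> b \<star> v" if "m \<in> C" for m
    using that unfolding e_def by metis
  then show ?thesis unfolding two_generated_def using v(1) w(1) by blast
qed

lemma xi_image_torsion_free: "torsion_free_fps_module (xi ` C) (\<boxplus>) zr (\<star>)"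
proof -
  interpret im: fps_module "xi ` C" "(\<boxplus>)" zr "(\<star>)" by (rule xi_image_module)
  show ?thesis by unfold_locales (use torsion_free in blast)
qed

text \<open>In C the element xw is divisible by every power of y, so a functional that is 1 there
  cannot have all its values in F[[y]]. In xC it is not divisible by y, hence an integral functional
  on xC exists; extending it to C inside F((y)) keeps its values on xC in F[[y]].\<close>

lemma xi_not_divisible_imp_Rtilde:
  assumes triv: trivial_idempotents
    and div: "\<And>m n. m \<in> C \<Longrightarrow> \<exists>v\<in>C. fps_X ^ n \<star> v = xi m"
    and w: "w \<in> C" "\<And>m. m \<in> C \<Longrightarrow> fps_X \<star> xi m \<noteq> xi w"
  shows "\<exists>f. coordinate (range fps_to_fls) f"
proof -
  interpret im: torsion_free_fps_module "xi ` C" "(\<boxplus>)" zr "(\<star>)" by (rule xi_image_torsion_free)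
  obtain \<phi> where \<phi>: "im.linear_to (\<lambda>d. d) \<phi>" "\<phi> (xi w) = 1"
    using im.functional_one[of "xi w"] w by blast
  note \<phi>D = im.linear_toD[OF \<phi>(1)]
  have "linear_graph fps_to_fls {(m, fps_to_fls (\<phi> m)) | m. m \<in> xi ` C}"
    unfolding linear_graph_def using im.linear_to_zr[OF \<phi>(1)] im.zr_closed
    by (auto simp: \<phi>D fls_times_fps_to_fls simp del: im.zr_closed simp flip: xi_add xi_sm
        intro: im.zr_closed)
  then obtain f where f: "linear_to fps_to_fls f"
      "\<And>m t. (m, t) \<in> {(m, fps_to_fls (\<phi> m)) | m. m \<in> xi ` C} \<Longrightarrow> f m = t"
    using linear_extension_fls im.linear_to_zr[OF \<phi>(1)]
    by (smt (verit) Pair_inject fps_zero_to_fls mem_Collect_eq)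
  have f_xi: "f (xi m) = fps_to_fls (\<phi> (xi m))" if "m \<in> C" for m
    using f(2) that by blast
  obtain g where g: "fls_line g" "g 1 = xi w"
    using fls_line_exists[of "xi w"] div[OF w(1)] w(1) by blast
  have xi_g: "xi (g c) = zr" for c
  proof -
    obtain n d where n: "fps_to_fls (fps_X ^ n) * c = fps_to_fls d" by (rule fls_denominator)
    note gC = fls_lineD(1)[OF g(1)]
    have "fps_X ^ n \<star> xi (g c) = xi (d \<star> g 1)"
      using fls_line_denominator[OF g(1) n] gC by (simp flip: xi_sm)
    also have "\<dots> = zr" using gC[of 1] g(2) w(1) by (simp add: xi_sm)
    finally show ?thesis using X_power_torsion_free gC by blast
  qed
  have g_fps: "g (fps_to_fls d) = d \<star> xi w" for d
    using fls_lineD(3)[OF g(1), of d 1] g(2) by simp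
  have "coordinate (range fps_to_fls) f"
  \<comment> \<open>Here S = F[[y]] is free on 1, so the lift is a |-> aw;
    \<open>fls_regpart\<close> reads a as a power series.\<close>
  proof (rule coordinateI_split[OF triv f(1) _ g(1) _ xi_g, where h = "\<lambda>a. fls_regpart a \<star> w"])
    show "f (g 1) = 1" using f_xi[OF w(1)] \<phi>(2) g(2) by simp
    show "fls_regpart (fps_to_fls d * a) \<star> w = d \<star> fls_regpart a \<star> w"
      if "a \<in> range fps_to_fls" for d a
      using that w(1) by (auto simp: mult_sm simp flip: fls_times_fps_to_fls)
  qed (use f_xi w(1) g_fps in \<open>auto simp: add_sm xi_sm\<close>)
  then show ?thesis by blast
qed

text \<open>The line is constructed inside xC, not merely through an element of xC, because all its
  points must have preimages under x.\<close>

lemma xi_divisible_line: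
  assumes div: "\<And>m. m \<in> C \<Longrightarrow> \<exists>p\<in>C. fps_X \<star> xi p = xi m" and u: "u \<in> xi ` C"
  obtains g where "fls_line g" "g 1 = u" "range g \<subseteq> xi ` C"
proof -
  interpret im: torsion_free_fps_module "xi ` C" "(\<boxplus>)" zr "(\<star>)" by (rule xi_image_torsion_free)
  have "\<exists>v\<in>xi ` C. fps_X ^ n \<star> v = m" if "m \<in> xi ` C" for n m
    using that
  proof (induction n arbitrary: m)
    case (Suc n)
    then obtain v where v: "v \<in> xi ` C" "fps_X \<star> v = m" using div by blast
    obtain p where p: "p \<in> xi ` C" "fps_X ^ n \<star> p = v" using Suc.IH[OF v(1)] by blast
    have "p \<in> C" using p by auto
    then have "fps_X ^ Suc n \<star> p = m" using p v by (simp add: mult_sm)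
    then show ?case using p by blast
  qed auto
  then obtain g where "im.fls_line g" "g 1 = u" using im.fls_line_exists[OF u] u by metis
  moreover from this have "fls_line g" "range g \<subseteq> xi ` C"
    by (auto simp: im.fls_line_def fls_line_def)
  ultimately show thesis using that by blast
qed

text \<open>The hypothesis \<open>lift\<close> is where pure injectivity will be used.\<close>

lemma coordinate_trichotomy:
  assumes triv: trivial_idempotents and nz: "C \<noteq> {zr}" and nfg: "\<not> two_generated"
    and lift: "\<And>g. fls_line g \<Longrightarrow> range g \<subseteq> xi ` C \<Longrightarrow>
      (\<And>n m. m \<in> C \<Longrightarrow> \<exists>p\<in>C. fps_X ^ n \<star> xi p = xi m) \<Longrightarrow>
      \<exists>h. fls_line h \<and> (\<forall>c. xi (h c) = g c)"
  shows "\<exists>S\<in>{{0}, range fps_to_fls, UNIV}. \<exists>f. coordinate S f"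
proof -
  have div: "\<exists>v\<in>C. fps_X ^ n \<star> v = xi m" if "m \<in> C" for m n
    using bounded_divisibility_imp_two_generated[OF triv] nfg that by blast
  \<comment> \<open>The last two cases differ in divisibility by y inside xC; within C every element
    of xC is already divisible by all powers of y.\<close>
  consider "\<forall>m\<in>C. xi m = zr" | "\<exists>w\<in>C. \<forall>m\<in>C. fps_X \<star> xi m \<noteq> xi w"
    | "\<exists>m\<in>C. xi m \<noteq> zr" "\<forall>w\<in>C. \<exists>m\<in>C. fps_X \<star> xi m = xi w"
    by metis
  then show ?thesis
  proof cases
    case 1
    then have 1: "\<And>m. m \<in> C \<Longrightarrow> xi m = zr" by simp
    then have "\<exists>v\<in>C. fps_X \<star> v = m" if "m \<in> C" for m
      using not_divisible_imp_two_generated[OF triv] nfg that by blast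
    then show ?thesis using xi_zero_divisible_imp_G[OF triv nz 1] by blast
  next
    case 2
    then show ?thesis using xi_not_divisible_imp_Rtilde[OF triv div] by blast
  next
    case 3
    then obtain u where u: "u \<in> xi ` C" "u \<noteq> zr" by blast
    have div3: "\<exists>p\<in>C. fps_X \<star> xi p = xi m" if "m \<in> C" for m using 3(2) that by simp
    obtain g where g: "fls_line g" "g 1 = u" "range g \<subseteq> xi ` C"
      using xi_divisible_line[OF div3 u(1)] .
    have "\<exists>p\<in>C. fps_X ^ n \<star> xi p = xi m" if "m \<in> C" for n m
      using that
    proof (induction n arbitrary: m)
      case (Suc n)
      then obtain v where v: "v \<in> C" "fps_X \<star> xi v = xi m" using div3 by blast
      obtain p where p: "p \<in> C" "fps_X ^ n \<star> xi p = xi v" using Suc.IH[OF v(1)] by blast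
      then show ?case using v by (auto simp: mult_sm intro!: bexI[of _ p])
    qed auto
    then obtain h where h: "fls_line h" "\<And>c. xi (h c) = g c" using lift[OF g(1,3)] by blast
    have uC: "u \<in> C" using u by auto
    obtain f where f: "linear_to fps_to_fls f" "f u = 1" using functional_fls_one[OF uC u(2)] .
    have "xi (g c) = zr" for c
    proof -
      obtain m where "m \<in> C" "g c = xi m" using g(3) by blast
      then show ?thesis by simp
    qed
    then have "coordinate UNIV f"
      using fls_lineD[OF h(1)] h(2) f g
      by (intro coordinateI_split[OF triv f(1) _ g(1), where h = h]) auto
    then show ?thesis by blast
  qed
qed

end

section \<open>Modules with a coordinate: uniformity, unbounded denominators, extension of
  maps\<close>

context dual_module
begin

lemma coordinateD:
  assumes "coordinate S \<beta>"
  shows "linear_to fps_to_fls \<beta>" and "m \<in> C \<Longrightarrow> \<beta> (xi m) \<in> S"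
    and "m \<in> C \<Longrightarrow> n \<in> C \<Longrightarrow> \<beta> m = \<beta> n \<Longrightarrow> \<beta> (xi m) = \<beta> (xi n) \<Longrightarrow> m = n"
    and "a \<in> S \<Longrightarrow> \<exists>m\<in>C. \<beta> (xi m) = a \<and> \<beta> m = b"
proof -
  have bij: "bij_betw (\<lambda>m. (\<beta> (xi m), \<beta> m)) C (S \<times> UNIV)"
    and "linear_to fps_to_fls \<beta>" using assms by (auto simp: coordinate_def)
  then show "linear_to fps_to_fls \<beta>" by simp
  show "\<beta> (xi m) \<in> S" if "m \<in> C" using bij_betwE[OF bij] that by auto
  show "m = n" if "m \<in> C" "n \<in> C" "\<beta> m = \<beta> n" "\<beta> (xi m) = \<beta> (xi n)"
    using bij_betw_imp_inj_on[OF bij] that by (auto simp: inj_on_def)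
  show "\<exists>m\<in>C. \<beta> (xi m) = a \<and> \<beta> m = b" if "a \<in> S"
  proof -
    have "(a, b) \<in> (\<lambda>m. (\<beta> (xi m), \<beta> m)) ` C"
      using bij_betw_imp_surj_on[OF bij] that by simp
    then show ?thesis by auto
  qed
qed

lemma coordinate_torsion_free:
  assumes "coordinate S \<beta>" "m \<in> C" "fps_X \<star> m = zr"
  shows "m = zr"
proof -
  note lin = coordinateD(1)[OF assms(1)]
  have "fps_to_fls fps_X * \<beta> m = 0" "fps_to_fls fps_X * \<beta> (xi m) = 0"
    using linear_toD(2)[OF lin, of _ fps_X, symmetric] xi_sm[OF assms(2), of fps_X, symmetric] assms
      linear_to_zr[OF lin] by simp_all
  then show ?thesis
    using coordinateD(3)[OF assms(1,2), of zr] linear_to_zr[OF lin] by simp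
qed

text \<open>The elements killed by x embed into F((y)) by \<open>\<beta>\<close>, and there any two
  nonzero elements have a common nonzero multiple. Every nonzero submodule contains such an element:
  multiply by x unless x already kills the given one.\<close>

lemma coordinate_uniform:
  assumes \<beta>: "coordinate S \<beta>"
    and U: "U \<subseteq> C" "\<And>m d. m \<in> U \<Longrightarrow> d \<star> m \<in> U" "\<And>m. m \<in> U \<Longrightarrow> xi m \<in> U" "\<exists>m\<in>U. m \<noteq> zr"
    and V: "V \<subseteq> C" "\<And>m d. m \<in> V \<Longrightarrow> d \<star> m \<in> V" "\<And>m. m \<in> V \<Longrightarrow> xi m \<in> V" "\<exists>m\<in>V. m \<noteq> zr"
  shows "\<exists>m\<in>U \<inter> V. m \<noteq> zr"
proof -
  note lin = coordinateD(1)[OF \<beta>]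
  have socle: "\<exists>p\<in>W. \<exists>d. d \<noteq> 0 \<and> xi p = zr \<and> \<beta> p = fps_to_fls d"
    if W: "W \<subseteq> C" "\<And>m d. m \<in> W \<Longrightarrow> d \<star> m \<in> W" "\<And>m. m \<in> W \<Longrightarrow> xi m \<in> W" "\<exists>m\<in>W. m \<noteq> zr" for W
  proof -
    obtain m where m: "m \<in> W" "m \<noteq> zr" using W by blast
    have "\<exists>p\<in>W. p \<noteq> zr \<and> xi p = zr"
    proof (cases "xi m = zr")
      case False
      then show ?thesis using m W by (intro bexI[of _ "xi m"]) auto
    qed (use m in blast)
    then obtain p where p: "p \<in> W" "p \<noteq> zr" "xi p = zr" by blast
    have pC: "p \<in> C" using p W by blast
    have nz: "\<beta> p \<noteq> 0"
      using coordinateD(3)[OF \<beta> pC, of zr] p linear_to_zr[OF lin] by auto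
    obtain n d where n: "fps_to_fls (fps_X ^ n) * \<beta> p = fps_to_fls d" by (rule fls_denominator)
    then have "\<beta> (fps_X ^ n \<star> p) = fps_to_fls d" using linear_toD(2)[OF lin pC] by simp
    moreover have "d \<noteq> 0" using n nz by (auto simp: fps_to_fls_power)
    moreover have "xi (fps_X ^ n \<star> p) = zr" using p pC by (simp add: xi_sm)
    ultimately show ?thesis using W(2)[OF p(1)] by blast
  qed
  obtain p d where p: "p \<in> U" "d \<noteq> 0" "xi p = zr" "\<beta> p = fps_to_fls d" using socle[OF U] by blast
  obtain q e where q: "q \<in> V" "e \<noteq> 0" "xi q = zr" "\<beta> q = fps_to_fls e" using socle[OF V] by blast
  have C: "p \<in> C" "q \<in> C" using p q U V by auto
  have "e \<star> p = d \<star> q"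
    using C p q by (intro coordinateD(3)[OF \<beta>]) (auto simp: xi_sm linear_toD(2)[OF lin])
  then have "e \<star> p \<in> U \<inter> V" using U(2)[OF p(1), of e] V(2)[OF q(1), of d] by simp
  moreover have "\<beta> (e \<star> p) \<noteq> 0" using p q C by (simp add: linear_toD(2)[OF lin])
  then have "e \<star> p \<noteq> zr" using linear_to_zr[OF lin] by auto
  ultimately show ?thesis by blast
qed

text \<open>No finite set generates a module with a coordinate: the denominators would be bounded.\<close>

definition bounded_denominator :: "('m \<Rightarrow> 'f fls) \<Rightarrow> nat \<Rightarrow> 'm \<Rightarrow> bool"
  where "bounded_denominator \<beta> k m \<longleftrightarrow> m \<in> C \<and>
    fls_subdegree (fls_X ^ k * \<beta> m) \<ge> 0 \<and> fls_subdegree (fls_X ^ k * \<beta> (xi m)) \<ge> 0"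

text \<open>Nonnegative subdegree means being a power series; this includes 0, whose subdegree is 0
  by convention.\<close>

lemma fls_subdegree_nonneg_add:
  "fls_subdegree (a :: 'f fls) \<ge> 0 \<Longrightarrow> fls_subdegree b \<ge> 0 \<Longrightarrow> fls_subdegree (a + b) \<ge> 0"
  by (metis fls_regpart_to_fls_trivial fls_subdegree_fls_to_fps_gt0 fps_to_fls_plus)

lemma fls_subdegree_nonneg_mult:
  "fls_subdegree (b :: 'f fls) \<ge> 0 \<Longrightarrow> fls_subdegree (fps_to_fls a * b) \<ge> 0"
  by (metis fls_regpart_to_fls_trivial fls_subdegree_fls_to_fps_gt0 fls_times_fps_to_fls)

lemma bounded_denominator_closed:
  assumes \<beta>: "linear_to fps_to_fls \<beta>"
  shows "bounded_denominator \<beta> k zr"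
    and "bounded_denominator \<beta> k m \<Longrightarrow> bounded_denominator \<beta> k n \<Longrightarrow> bounded_denominator \<beta> k (m \<boxplus> n)"
    and "bounded_denominator \<beta> k m \<Longrightarrow> bounded_denominator \<beta> k (d \<star> m)"
    and "bounded_denominator \<beta> k m \<Longrightarrow> bounded_denominator \<beta> k (xi m)"
    and "bounded_denominator \<beta> k m \<Longrightarrow> k \<le> k' \<Longrightarrow> bounded_denominator \<beta> k' m"
    and "m \<in> C \<Longrightarrow> \<exists>k. bounded_denominator \<beta> k m"
proof -
  note lin = linear_to_zr[OF \<beta>] linear_toD[OF \<beta>]
  show "bounded_denominator \<beta> k zr" by (simp add: bounded_denominator_def lin)
  show "bounded_denominator \<beta> k (m \<boxplus> n)" if "bounded_denominator \<beta> k m" "bounded_denominator \<beta> k n"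
    using that by (auto simp: bounded_denominator_def lin xi_add distrib_left fls_subdegree_nonneg_add)
  show "bounded_denominator \<beta> k (d \<star> m)" if "bounded_denominator \<beta> k m"
    using that
    by (auto simp: bounded_denominator_def lin xi_sm mult.left_commute[of "fls_X ^ k"]
        fls_subdegree_nonneg_mult simp del: fls_X_power_times_conv_shift)
  show "bounded_denominator \<beta> k (xi m)" if "bounded_denominator \<beta> k m"
    using that by (simp add: bounded_denominator_def lin)
  have mono: "bounded_denominator \<beta> k' m" if "bounded_denominator \<beta> k m" "k \<le> k'" for k k'
  proof -
    have eq: "fls_X ^ k' * a = fps_to_fls (fps_X ^ (k' - k)) * (fls_X ^ k * a)" for a :: "'f fls"
      using that(2) by (simp add: fps_to_fls_power mult.assoc[symmetric] flip: power_add)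
    show ?thesis
      using that(1) unfolding bounded_denominator_def eq by (blast intro: fls_subdegree_nonneg_mult)
  qed
  then show "k \<le> k' \<Longrightarrow> bounded_denominator \<beta> k' m" if "bounded_denominator \<beta> k m"
    using that by blast
  show "\<exists>k. bounded_denominator \<beta> k m" if "m \<in> C"
  proof -
    obtain n d where n: "fps_to_fls (fps_X ^ n) * \<beta> m = fps_to_fls d" by (rule fls_denominator)
    obtain k e where k: "fps_to_fls (fps_X ^ k) * \<beta> (xi m) = fps_to_fls e" by (rule fls_denominator)
    have "fls_X ^ (n + k) * \<beta> m = fps_to_fls (fps_X ^ k * d)"
      by (simp add: fls_times_fps_to_fls fps_to_fls_power power_add algebra_simps flip: n)
    moreover have "fls_X ^ (n + k) * \<beta> (xi m) = fps_to_fls (fps_X ^ n * e)"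
      by (simp add: fls_times_fps_to_fls fps_to_fls_power power_add algebra_simps flip: k)
    ultimately have "bounded_denominator \<beta> (n + k) m"
      using that fls_subdegree_fls_to_fps_gt0 unfolding bounded_denominator_def by metis
    then show ?thesis ..
  qed
qed

lemma coordinate_unbounded:
  assumes \<beta>: "coordinate S \<beta>" and S: "0 \<in> S"
  shows "\<exists>m\<in>C. \<not> bounded_denominator \<beta> k m"
proof -
  \<comment> \<open>The exponent exceeds \<open>k\<close> by one, so a simple pole remains after
    multiplication by \<open>fls_X ^ k\<close>.\<close>
  obtain m where m: "m \<in> C" "\<beta> m = fls_X_intpow (- int (Suc k))"
    using coordinateD(4)[OF \<beta> S] by blast
  have "fls_subdegree (fls_X ^ k * \<beta> m) < 0"
    by (simp add: m fls_X_power_times_conv_shift)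
  then have "\<not> bounded_denominator \<beta> k m" unfolding bounded_denominator_def by linarith
  then show ?thesis using m(1) by blast
qed

text \<open>Linear maps into a module with coordinate \<open>\<beta>\<close> correspond, by composition with \<open>\<beta>\<close>, to
  the linear maps \<open>\<phi>\<close> into \<open>F((y))\<close> over \<open>F[[y]]\<close> with \<open>\<phi>(xM) \<subseteq> S\<close>; this is the extension
  property behind pure injectivity.\<close>

lemma pure_extension:
  assumes A: "dual_module A addA zrA smA xiA"
    and f: "\<And>a. a \<in> A \<Longrightarrow> f a \<in> C" "\<And>a b. a \<in> A \<Longrightarrow> b \<in> A \<Longrightarrow> f (addA a b) = f a \<boxplus> f b"
      "\<And>d a. a \<in> A \<Longrightarrow> f (smA d a) = d \<star> f a" "inj_on f A"
    and pure: "\<And>n b a. b \<in> C \<Longrightarrow> a \<in> A \<Longrightarrow> fps_X ^ n \<star> xi b = f a \<Longrightarrow> \<exists>a'\<in>A. smA (fps_X ^ n) (xiA a') = a"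
    and \<alpha>: "scalar_module.linear_to A addA smA fps_to_fls \<alpha>" "\<And>a. a \<in> A \<Longrightarrow> \<alpha> (xiA a) \<in> S"
    and S: "S \<in> {{0}, range fps_to_fls, UNIV}"
  obtains \<phi> where "linear_to fps_to_fls \<phi>" "\<And>a. a \<in> A \<Longrightarrow> \<phi> (f a) = \<alpha> a"
    "\<And>b. b \<in> C \<Longrightarrow> \<phi> (xi b) \<in> S"
proof -
  interpret A: dual_module A addA zrA smA xiA by (rule A)
  interpret im: fps_module "xi ` C" "(\<boxplus>)" zr "(\<star>)" by (rule xi_image_module)
  note \<alpha>D = A.linear_toD[OF \<alpha>(1)] and \<alpha>0 = A.linear_to_zr[OF \<alpha>(1)]
  have f0: "f zrA = zr" using f(3)[of zrA 0] f(1) by simp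
  \<comment> \<open>The constraint concerns xC only, so the extension is made there before it is
    made on C, where every value in F((y)) is allowed.\<close>
  have "\<exists>\<psi>. im.linear_to fps_to_fls \<psi> \<and> (\<forall>a\<in>A. f a \<in> xi ` C \<longrightarrow> \<psi> (f a) = \<alpha> a) \<and>
    (\<forall>p\<in>xi ` C. \<psi> p \<in> S)"
  proof -
    \<comment> \<open>Purity at exponent 0: an element of A whose image lies in xC already lies in
      xA.\<close>
    have in_xi: "\<exists>a'\<in>A. a = xiA a'" if "a \<in> A" "f a \<in> xi ` C" for a
      using that pure[of _ a 0] by fastforce
    consider "S = {0}" | "S = range fps_to_fls" | "S = UNIV" using S by blast
    then show ?thesis
    proof cases
      case 1
      then have "im.linear_to fps_to_fls (\<lambda>_. 0) \<and> (\<forall>a\<in>A. f a \<in> xi ` C \<longrightarrow> 0 = \<alpha> a) \<and>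
        (\<forall>p\<in>xi ` C. 0 \<in> S)"
        using in_xi \<alpha>(2) unfolding im.linear_to_def by fastforce
      then show ?thesis by (rule exI[of _ "\<lambda>_. 0"])
    next
      case 2
      define \<Gamma> where "\<Gamma> = {(f a, d) | a d. a \<in> A \<and> f a \<in> xi ` C \<and> \<alpha> a = fps_to_fls d}"
      have "im.linear_graph (\<lambda>d. d) \<Gamma>"
        unfolding im.linear_graph_def
      proof (intro conjI allI impI)
        show "\<Gamma> \<subseteq> xi ` C \<times> UNIV" by (auto simp: \<Gamma>_def)
        show "(zr, 0) \<in> \<Gamma>"
          unfolding \<Gamma>_def using f0 \<alpha>0 im.zr_closed
          by (intro CollectI exI[of _ zrA] exI[of _ 0]) auto
        show "(e \<star> m, e * t) \<in> \<Gamma>" if mt: "(m, t) \<in> \<Gamma>" for e m t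
        proof -
          obtain a where a: "m = f a" "a \<in> A" "f a \<in> xi ` C" "\<alpha> a = fps_to_fls t"
            using mt by (auto simp: \<Gamma>_def)
          then show ?thesis
            unfolding \<Gamma>_def using f(3) \<alpha>D(2) im.sm_closed
            by (intro CollectI exI[of _ "smA e a"] exI[of _ "e * t"]) (auto simp: fls_times_fps_to_fls)
        qed
        fix m t n u assume mn: "(m, t) \<in> \<Gamma>" "(n, u) \<in> \<Gamma>"
        obtain a b where a: "m = f a" "a \<in> A" "f a \<in> xi ` C" "\<alpha> a = fps_to_fls t"
          and b: "n = f b" "b \<in> A" "f b \<in> xi ` C" "\<alpha> b = fps_to_fls u"
          using mn by (auto simp: \<Gamma>_def)
        have "f (addA a b) \<in> xi ` C" using f(2) a b im.add_closed by simp
        then show "(m \<boxplus> n, t + u) \<in> \<Gamma>"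
          unfolding \<Gamma>_def using f(2) \<alpha>D(1) a b
          by (intro CollectI exI[of _ "addA a b"] exI[of _ "t + u"]) auto
      qed
      \<comment> \<open>The equation y^n x z = a, solvable in C, is by purity solvable in A; since
        \<open>\<alpha>\<close> is integral on xA, its value at \<open>a\<close> is divisible by
        y^n.\<close>
      moreover have "fps_X ^ n dvd d" if b: "b \<in> xi ` C" "(fps_X ^ n \<star> b, d) \<in> \<Gamma>" for n b d
      proof -
        obtain c where c: "c \<in> C" "b = xi c" using b by blast
        obtain a where a: "fps_X ^ n \<star> xi c = f a" "a \<in> A" "\<alpha> a = fps_to_fls d"
          using b c by (auto simp: \<Gamma>_def)
        obtain a' where a': "a' \<in> A" "smA (fps_X ^ n) (xiA a') = a" using pure[OF c(1) a(2,1)] by blast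
        obtain d' where "\<alpha> (xiA a') = fps_to_fls d'" using \<alpha>(2)[OF a'(1)] 2 by blast
        then have "fps_to_fls d = fps_to_fls (fps_X ^ n * d')"
          using a(3) a' \<alpha>D(2)[of "xiA a'" "fps_X ^ n"] by (simp add: fls_times_fps_to_fls)
        then show ?thesis by simp
      qed
      ultimately obtain \<theta> where \<theta>: "im.linear_to (\<lambda>d. d) \<theta>" "\<And>b d. (b, d) \<in> \<Gamma> \<Longrightarrow> \<theta> b = d"
        using im.fps_linear_extension by blast
      have "fps_to_fls (\<theta> (f a)) = \<alpha> a" if a: "a \<in> A" "f a \<in> xi ` C" for a
      proof -
        obtain d where d: "\<alpha> a = fps_to_fls d" using in_xi[OF a] \<alpha>(2) 2 by blast
        then have "(f a, d) \<in> \<Gamma>" using a by (auto simp: \<Gamma>_def)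
        then show ?thesis using \<theta>(2) d by simp
      qed
      moreover have "im.linear_to fps_to_fls (\<lambda>p. fps_to_fls (\<theta> p))"
        using \<theta>(1) by (simp add: im.linear_to_def fls_times_fps_to_fls)
      ultimately show ?thesis using 2 by (intro exI[of _ "\<lambda>p. fps_to_fls (\<theta> p)"]) auto
    next
      case 3
      \<comment> \<open>With S = F((y)) there is no constraint, and the restriction to xC of any
        extension to C serves.\<close>
      define \<Gamma> where "\<Gamma> = {(f a, \<alpha> a) | a. a \<in> A}"
      have \<Gamma>I: "(f a, \<alpha> a) \<in> \<Gamma>" if "a \<in> A" for a using that by (auto simp: \<Gamma>_def)
      have "linear_graph fps_to_fls \<Gamma>"
        unfolding linear_graph_def
      proof (intro conjI allI impI)
        show "\<Gamma> \<subseteq> C \<times> UNIV" using f(1) by (auto simp: \<Gamma>_def)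
        show "(zr, 0) \<in> \<Gamma>" using \<Gamma>I[of zrA] f0 \<alpha>0 by simp
        show "(d \<star> m, fps_to_fls d * t) \<in> \<Gamma>" if mt: "(m, t) \<in> \<Gamma>" for d m t
          using mt \<Gamma>I[OF A.sm_closed] f(3) \<alpha>D(2) by (force simp: \<Gamma>_def)
        show "(m \<boxplus> n, t + u) \<in> \<Gamma>" if mt: "(m, t) \<in> \<Gamma>" "(n, u) \<in> \<Gamma>" for m t n u
        proof -
          obtain a b where "a \<in> A" "b \<in> A" "m = f a" "t = \<alpha> a" "n = f b" "u = \<alpha> b"
            using mt by (auto simp: \<Gamma>_def)
          then show ?thesis using \<Gamma>I[of "addA a b"] f(2) \<alpha>D(1) by simp
        qed
      qed
      moreover have "t = 0" if zt: "(zr, t) \<in> \<Gamma>" for t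
      proof -
        obtain a where a: "a \<in> A" "f a = zr" "t = \<alpha> a" using zt unfolding \<Gamma>_def by auto
        then have "a = zrA" using f(4) f0 by (auto simp: inj_on_def)
        then show ?thesis using a \<alpha>0 by simp
      qed
      ultimately obtain \<psi> where \<psi>: "linear_to fps_to_fls \<psi>" "\<And>m t. (m, t) \<in> \<Gamma> \<Longrightarrow> \<psi> m = t"
        using linear_extension_fls by blast
      have "im.linear_to fps_to_fls \<psi>"
        using \<psi>(1) unfolding linear_to_def im.linear_to_def by blast
      then show ?thesis using \<psi>(2)[OF \<Gamma>I] 3 by blast
    qed
  qed
  then obtain \<psi> where \<psi>: "im.linear_to fps_to_fls \<psi>" "\<And>a. a \<in> A \<Longrightarrow> f a \<in> xi ` C \<Longrightarrow> \<psi> (f a) = \<alpha> a"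
    "\<And>p. p \<in> xi ` C \<Longrightarrow> \<psi> p \<in> S" by blast
  note \<psi>D = im.linear_toD[OF \<psi>(1)] and \<psi>0 = im.linear_to_zr[OF \<psi>(1)]
  have xiC: "p \<in> C" if "p \<in> xi ` C" for p using that by blast
  \<comment> \<open>Glue \<open>\<alpha>\<close> on the image of A with \<open>\<psi>\<close> on xC.
    They agree where both are defined, so the result is single-valued.\<close>
  define \<Gamma> where "\<Gamma> = {(f a \<boxplus> p, \<alpha> a + \<psi> p) | a p. a \<in> A \<and> p \<in> xi ` C}"
  have \<Gamma>I: "(f a \<boxplus> p, \<alpha> a + \<psi> p) \<in> \<Gamma>" if "a \<in> A" "p \<in> xi ` C" for a p
    using that by (auto simp: \<Gamma>_def)
  have "linear_graph fps_to_fls \<Gamma>"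
    unfolding linear_graph_def
  proof (intro conjI allI impI)
    show "\<Gamma> \<subseteq> C \<times> UNIV" using f(1) by (auto simp: \<Gamma>_def)
    show "(zr, 0) \<in> \<Gamma>" using \<Gamma>I[OF A.zr_closed im.zr_closed] f0 \<alpha>0 \<psi>0 by simp
    show "(d \<star> m, fps_to_fls d * t) \<in> \<Gamma>" if mt: "(m, t) \<in> \<Gamma>" for d m t
    proof -
      obtain a p where a: "a \<in> A" "p \<in> xi ` C" "m = f a \<boxplus> p" "t = \<alpha> a + \<psi> p"
        using mt unfolding \<Gamma>_def by blast
      have "d \<star> m = f (smA d a) \<boxplus> d \<star> p" using a(1,3) f xiC[OF a(2)] by (simp add: sm_add)
      moreover have "fps_to_fls d * t = \<alpha> (smA d a) + \<psi> (d \<star> p)"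
        using a(1,4) \<alpha>D(2) \<psi>D(2)[OF a(2)] by (simp add: distrib_left)
      ultimately show ?thesis
        using \<Gamma>I[OF A.sm_closed[OF a(1)] im.sm_closed[OF a(2)], of d d] by simp
    qed
    show "(m \<boxplus> n, t + u) \<in> \<Gamma>" if mt: "(m, t) \<in> \<Gamma>" "(n, u) \<in> \<Gamma>" for m t n u
    proof -
      obtain a p b q where a: "a \<in> A" "p \<in> xi ` C" "m = f a \<boxplus> p" "t = \<alpha> a + \<psi> p"
        and b: "b \<in> A" "q \<in> xi ` C" "n = f b \<boxplus> q" "u = \<alpha> b + \<psi> q"
        using mt unfolding \<Gamma>_def by blast
      have "m \<boxplus> n = f (addA a b) \<boxplus> (p \<boxplus> q)"
        using a(1,3) b(1,3) f xiC[OF a(2)] xiC[OF b(2)] by (simp add: add_ac)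
      moreover have "t + u = \<alpha> (addA a b) + \<psi> (p \<boxplus> q)"
        using a(1,4) b(1,4) \<alpha>D(1) \<psi>D(1)[OF a(2) b(2)] by simp
      ultimately show ?thesis
        using \<Gamma>I[OF A.add_closed[OF a(1) b(1)] im.add_closed[OF a(2) b(2)]] by simp
    qed
  qed
  moreover have "t = 0" if zt: "(zr, t) \<in> \<Gamma>" for t
  proof -
    obtain a p where a: "a \<in> A" "p \<in> xi ` C" "f a \<boxplus> p = zr" "t = \<alpha> a + \<psi> p"
      using zt unfolding \<Gamma>_def by auto
    have fa: "f a = (-1) \<star> p" using a(3) eq_neg_iff[OF f(1)[OF a(1)] xiC[OF a(2)]] by simp
    then have "f a \<in> xi ` C" using im.sm_closed[OF a(2), of "-1"] by metis
    then have "\<alpha> a = - \<psi> p" using \<psi>(2)[OF a(1)] fa \<psi>D(2)[OF a(2), of "-1"] by simp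
    then show ?thesis using a(4) by simp
  qed
  ultimately obtain \<phi> where \<phi>: "linear_to fps_to_fls \<phi>" "\<And>m t. (m, t) \<in> \<Gamma> \<Longrightarrow> \<phi> m = t"
    using linear_extension_fls by blast
  show thesis
  proof (rule that[OF \<phi>(1)])
    show "\<phi> (f a) = \<alpha> a" if "a \<in> A" for a
      using \<phi>(2)[OF \<Gamma>I[OF that im.zr_closed]] f(1)[OF that] \<psi>0 by simp
    show "\<phi> (xi b) \<in> S" if "b \<in> C" for b
      using \<phi>(2)[OF \<Gamma>I[OF A.zr_closed, of "xi b"]] that f0 \<alpha>0 \<psi>(3)[of "xi b"] by simp
  qed
qed

end

section \<open>The ring \<open>R\<close> and its modules\<close>

text \<open>The coset of a + bx modulo x^2: x is the outer variable, so a coset consists of all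
  series with the given first two outer coefficients.\<close>

definition rr :: "'f::field fps \<Rightarrow> 'f fps \<Rightarrow> 'f fps fps set"
  where "rr a b = {q. fps_nth q 0 = a \<and> fps_nth q 1 = b}"

lemma rr_nonempty: "fps_const a + fps_X * fps_const b \<in> rr a b"
  by (simp add: rr_def)

lemma rr_eq_iff [simp]: "rr a b = rr c d \<longleftrightarrow> a = c \<and> b = d"
proof
  assume "rr a b = rr c d"
  then have "fps_const a + fps_X * fps_const b \<in> rr c d" using rr_nonempty[of a b] by simp
  then show "a = c \<and> b = d" by (simp add: rr_def)
qed simp

lemma ring_of_type_algebra_simps:
  "carrier (ring_of_type_algebra :: 'a::ring_1 ring) = UNIV"
  "x \<oplus>\<^bsub>ring_of_type_algebra\<^esub> y = x + y" "x \<otimes>\<^bsub>ring_of_type_algebra\<^esub> y = x * y"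
  "\<zero>\<^bsub>ring_of_type_algebra\<^esub> = (0 :: 'a)" "\<one>\<^bsub>ring_of_type_algebra\<^esub> = (1 :: 'a)"
  by (simp_all add: ring_of_type_algebra_def)

lemma x2_ideal_eq: "(x2_ideal :: 'f::field fps fps set) = rr 0 0"
proof -
  have "q \<in> rr 0 0 \<longleftrightarrow> (\<exists>p. q = p * fps_X ^ 2)" for q :: "'f fps fps"
  proof
    assume q: "q \<in> rr 0 0"
    have "q = fps_shift 2 q * fps_X ^ 2"
    proof (rule fps_ext)
      fix n
      show "fps_nth q n = fps_nth (fps_shift 2 q * fps_X ^ 2) n"
        using q by (cases "n < 2")
          (auto simp: fps_X_power_mult_right_nth rr_def less_2_cases_iff simp del: add_2_eq_Suc')
    qed
    then show "\<exists>p. q = p * fps_X ^ 2" ..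
  qed (auto simp: rr_def fps_X_power_mult_right_nth)
  then show ?thesis by (auto simp: x2_ideal_def cgenideal_def ring_of_type_algebra_simps)
qed

lemma x2_coset: "x2_ideal +>\<^bsub>ring_of_type_algebra\<^esub> q = rr (fps_nth q 0) (fps_nth q 1)"
proof -
  have "p \<in> rr (fps_nth q 0) (fps_nth q 1) \<longleftrightarrow> (\<exists>h\<in>rr 0 0. p = h + q)" for p
    by (auto simp: rr_def intro!: exI[of _ "p - q"])
  then show ?thesis by (auto simp: a_r_coset_def' x2_ideal_eq ring_of_type_algebra_simps)
qed

lemma carrier_Rxy: "carrier (Rxy :: 'f::field fps fps set ring) = {rr a b | a b. True}"
proof -
  have "\<exists>q. rr a b = rr (fps_nth q 0) (fps_nth q 1)" for a b :: "'f fps"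
    using rr_nonempty[of a b] by (intro exI[of _ "fps_const a + fps_X * fps_const b"]) (simp add: rr_def)
  then show ?thesis
    by (auto simp: Rxy_def FactRing_def A_RCOSETS_def' x2_coset ring_of_type_algebra_simps)
qed

lemma rr_closed [simp, intro]: "rr a b \<in> carrier Rxy"
  by (auto simp: carrier_Rxy)

lemma Rxy_zero: "\<zero>\<^bsub>Rxy\<^esub> = rr 0 0"
  by (simp add: Rxy_def FactRing_def x2_ideal_eq)

lemma Rxy_one: "\<one>\<^bsub>Rxy\<^esub> = rr 1 0"
  by (simp add: Rxy_def FactRing_def x2_coset ring_of_type_algebra_simps)

lemma Rxy_add [simp]: "rr a b \<oplus>\<^bsub>Rxy\<^esub> rr c d = rr (a + c) (b + d)"
proof -
  have "q \<in> rr (a + c) (b + d) \<longleftrightarrow> (\<exists>h\<in>rr a b. \<exists>k\<in>rr c d. q = h + k)" for q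
  proof
    assume "q \<in> rr (a + c) (b + d)"
    then show "\<exists>h\<in>rr a b. \<exists>k\<in>rr c d. q = h + k"
      using rr_nonempty[of a b]
      by (intro bexI[of _ "fps_const a + fps_X * fps_const b"]
          bexI[of _ "q - (fps_const a + fps_X * fps_const b)"]) (auto simp: rr_def)
  qed (auto simp: rr_def)
  then show ?thesis by (auto simp: Rxy_def FactRing_def set_add_def' ring_of_type_algebra_simps)
qed

lemma Rxy_mult [simp]: "rr a b \<otimes>\<^bsub>Rxy\<^esub> rr c d = rr (a * c) (a * d + b * c)"
proof -
  have "(\<Union>p\<in>rr a b. \<Union>q\<in>rr c d. rr (fps_nth (p * q) 0) (fps_nth (p * q) 1)) =
    (\<Union>p\<in>rr a b. \<Union>q\<in>rr c d. rr (a * c) (a * d + b * c))"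
    by (intro SUP_cong refl) (auto simp: rr_def fps_mult_nth)
  also have "\<dots> = rr (a * c) (a * d + b * c)" using rr_nonempty by fastforce
  finally show ?thesis by (simp add: Rxy_def FactRing_def rcoset_mult_def x2_coset ring_of_type_algebra_simps)
qed

lemma cring_Rxy: "cring (Rxy :: 'f::field fps fps set ring)"
proof -
  interpret cring "ring_of_type_algebra :: 'f fps fps ring" by (rule cring_from_type_algebra)
  have "ideal (x2_ideal :: 'f fps fps set) ring_of_type_algebra"
    unfolding x2_ideal_def by (rule cgenideal_ideal) (simp add: ring_of_type_algebra_simps)
  then show ?thesis
    unfolding Rxy_def by (intro ideal.quotient_is_cring) (auto simp: is_cring cring_from_type_algebra)
qed

lemma Ry_eq: "Ry = rr fps_X 0"
  by (simp add: Ry_def x2_coset)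

lemma Ry_pow: "Ry [^]\<^bsub>Rxy\<^esub> n = rr (fps_X ^ n) 0"
  by (induction n) (auto simp: Ry_eq Rxy_one ac_simps)

lemma quot_map_rr:
  assumes "\<And>p. p \<in> rr a b \<Longrightarrow> \<phi> p = c"
  shows "quot_map \<phi> (rr a b) = c"
proof -
  have "\<phi> ` rr a b = {c}" using assms rr_nonempty[of a b] by fastforce
  then show ?thesis by (simp add: quot_map_def)
qed

section \<open>Dictionary between R-modules and F[[y]]-modules with an endomorphism of square
  zero\<close>

lemma module_dual_module:
  assumes "module Rxy N"
  shows "dual_module (carrier N) (add N) \<zero>\<^bsub>N\<^esub> (\<lambda>d m. rr d 0 \<odot>\<^bsub>N\<^esub> m) (\<lambda>m. rr 0 1 \<odot>\<^bsub>N\<^esub> m)"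
proof -
  interpret module Rxy N by fact
  have l: "rr (a + c) (b + d) \<odot>\<^bsub>N\<^esub> m = rr a b \<odot>\<^bsub>N\<^esub> m \<oplus>\<^bsub>N\<^esub> rr c d \<odot>\<^bsub>N\<^esub> m"
    if "m \<in> carrier N" for a b c d m
    using smult_l_distr[OF rr_closed rr_closed that, of a b c d] by simp
  have mu: "rr (a * c) (a * d + b * c) \<odot>\<^bsub>N\<^esub> m = rr a b \<odot>\<^bsub>N\<^esub> (rr c d \<odot>\<^bsub>N\<^esub> m)"
    if "m \<in> carrier N" for a b c d m
    using smult_assoc1[OF rr_closed rr_closed that, of a b c d] by simp
  have z: "rr 0 0 \<odot>\<^bsub>N\<^esub> m = \<zero>\<^bsub>N\<^esub>" if "m \<in> carrier N" for m
    using l[OF that, of 0 0 0 0] that by simp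
  show ?thesis
  proof unfold_locales
    show "rr 0 1 \<odot>\<^bsub>N\<^esub> (rr d 0 \<odot>\<^bsub>N\<^esub> m) = rr d 0 \<odot>\<^bsub>N\<^esub> (rr 0 1 \<odot>\<^bsub>N\<^esub> m)"
      if "m \<in> carrier N" for d m
      using mu[OF that, of 0 d 0 1] mu[OF that, of d 0 1 0] by simp
    show "rr 0 1 \<odot>\<^bsub>N\<^esub> (rr 0 1 \<odot>\<^bsub>N\<^esub> m) = \<zero>\<^bsub>N\<^esub>" if "m \<in> carrier N" for m
      using mu[OF that, of 0 0 1 1] z[OF that] by simp
    show "rr (d * e) 0 \<odot>\<^bsub>N\<^esub> m = rr d 0 \<odot>\<^bsub>N\<^esub> (rr e 0 \<odot>\<^bsub>N\<^esub> m)" if "m \<in> carrier N" for d e m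
      using mu[OF that, of d e 0 0] by simp
    show "rr (d + e) 0 \<odot>\<^bsub>N\<^esub> m = rr d 0 \<odot>\<^bsub>N\<^esub> m \<oplus>\<^bsub>N\<^esub> rr e 0 \<odot>\<^bsub>N\<^esub> m" if "m \<in> carrier N" for d e m
      using l[OF that, of d e 0 0] by simp
    show "rr 1 0 \<odot>\<^bsub>N\<^esub> m = m" if "m \<in> carrier N" for m
      using smult_one[OF that] by (simp add: Rxy_one)
  qed (auto simp: smult_r_distr z M.a_assoc intro: M.a_comm)
qed

lemma smult_rr:
  assumes "module Rxy N" "m \<in> carrier N"
  shows "rr a b \<odot>\<^bsub>N\<^esub> m = rr a 0 \<odot>\<^bsub>N\<^esub> m \<oplus>\<^bsub>N\<^esub> rr b 0 \<odot>\<^bsub>N\<^esub> (rr 0 1 \<odot>\<^bsub>N\<^esub> m)"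
proof -
  interpret module Rxy N by fact
  show ?thesis
    using smult_l_distr[OF rr_closed rr_closed assms(2), of a 0 0 b]
      smult_assoc1[OF rr_closed rr_closed assms(2), of b 0 0 1] by simp
qed

text \<open>The ring operations of the record play no role for a module.\<close>

definition dual_to_module ::
  "'m set \<Rightarrow> ('m \<Rightarrow> 'm \<Rightarrow> 'm) \<Rightarrow> 'm \<Rightarrow> ('f::field fps \<Rightarrow> 'm \<Rightarrow> 'm) \<Rightarrow> ('m \<Rightarrow> 'm) \<Rightarrow>
    ('f fps fps set, 'm) module"
  where "dual_to_module C ad zr sm xi = \<lparr>carrier = C, monoid.mult = ad, one = zr, ring.zero = zr,
    ring.add = ad, module.smult = (\<lambda>r m. ad (sm (quot_map (\<lambda>p. fps_nth p 0) r) m)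
      (sm (quot_map (\<lambda>p. fps_nth p 1) r) (xi m)))\<rparr>"

lemma dual_to_module_simps [simp]:
  "carrier (dual_to_module C ad zr sm xi) = C"
  "\<zero>\<^bsub>dual_to_module C ad zr sm xi\<^esub> = zr"
  "m \<oplus>\<^bsub>dual_to_module C ad zr sm xi\<^esub> n = ad m n"
  "rr a b \<odot>\<^bsub>dual_to_module C ad zr sm xi\<^esub> m = ad (sm a m) (sm b (xi m))"
proof -
  have "quot_map (\<lambda>p. fps_nth p 0) (rr a b) = a" "quot_map (\<lambda>p. fps_nth p 1) (rr a b) = b"
    by (rule quot_map_rr, simp add: rr_def)+
  then show "rr a b \<odot>\<^bsub>dual_to_module C ad zr sm xi\<^esub> m = ad (sm a m) (sm b (xi m))"
    by (simp add: dual_to_module_def)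
qed (simp_all add: dual_to_module_def)

lemma module_dual_to_module:
  fixes sm :: "'b::field fps \<Rightarrow> 'm \<Rightarrow> 'm"
  assumes "dual_module C ad zr sm xi"
  shows "module Rxy (dual_to_module C ad zr sm xi)"
proof -
  interpret dual_module C ad zr sm xi by fact
  let ?M = "dual_to_module C ad zr sm xi"
  have "abelian_group ?M"
  proof (rule abelian_groupI)
    show "\<exists>n\<in>carrier ?M. n \<oplus>\<^bsub>?M\<^esub> m = \<zero>\<^bsub>?M\<^esub>" if "m \<in> carrier ?M" for m
      using that add_neg[of m] by (intro bexI[of _ "sm (-1) m"]) (auto simp: add_comm)
  qed (auto simp: add_assoc intro: add_comm)
  then show ?thesis
  proof (rule module.intro[OF cring_Rxy _ module_axioms.intro])
    fix r t :: "'b fps fps set" and m n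
    assume r: "r \<in> carrier Rxy" and t: "t \<in> carrier Rxy" and m: "m \<in> carrier ?M" and n: "n \<in> carrier ?M"
    obtain a b where rab: "r = rr a b" using r by (auto simp: carrier_Rxy)
    obtain c d where tcd: "t = rr c d" using t by (auto simp: carrier_Rxy)
    show "(r \<oplus>\<^bsub>Rxy\<^esub> t) \<odot>\<^bsub>?M\<^esub> m = r \<odot>\<^bsub>?M\<^esub> m \<oplus>\<^bsub>?M\<^esub> t \<odot>\<^bsub>?M\<^esub> m"
      using m by (simp add: rab tcd add_sm add_ac)
    show "r \<odot>\<^bsub>?M\<^esub> (m \<oplus>\<^bsub>?M\<^esub> n) = r \<odot>\<^bsub>?M\<^esub> m \<oplus>\<^bsub>?M\<^esub> r \<odot>\<^bsub>?M\<^esub> n"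
      using m n by (simp add: rab sm_add xi_add add_ac)
    show "(r \<otimes>\<^bsub>Rxy\<^esub> t) \<odot>\<^bsub>?M\<^esub> m = r \<odot>\<^bsub>?M\<^esub> (t \<odot>\<^bsub>?M\<^esub> m)"
      using m by (simp add: rab tcd add_sm sm_add xi_add xi_sm mult_sm add_ac)
  qed (auto simp: Rxy_one carrier_Rxy)
qed

lemma mod_hom_iff:
  assumes A: "module Rxy A" and B: "module Rxy B"
  shows "h \<in> mod_hom Rxy A B \<longleftrightarrow> (\<forall>m\<in>carrier A. h m \<in> carrier B) \<and>
    (\<forall>m\<in>carrier A. \<forall>n\<in>carrier A. h (m \<oplus>\<^bsub>A\<^esub> n) = h m \<oplus>\<^bsub>B\<^esub> h n) \<and>
    (\<forall>d. \<forall>m\<in>carrier A. h (rr d 0 \<odot>\<^bsub>A\<^esub> m) = rr d 0 \<odot>\<^bsub>B\<^esub> h m) \<and>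
    (\<forall>m\<in>carrier A. h (rr 0 1 \<odot>\<^bsub>A\<^esub> m) = rr 0 1 \<odot>\<^bsub>B\<^esub> h m)" (is "?L \<longleftrightarrow> ?R")
proof
  interpret A: module Rxy A by fact
  assume R: ?R
  have "h (rr a b \<odot>\<^bsub>A\<^esub> m) = rr a b \<odot>\<^bsub>B\<^esub> h m" if "m \<in> carrier A" for a b m
    using that R by (simp add: smult_rr[OF A, of _ a b] smult_rr[OF B, of _ a b])
  then show ?L using R by (auto simp: mod_hom_def carrier_Rxy)
qed (auto simp: mod_hom_def)

text \<open>Additivity is required only on \<open>D\<close>, because the retraction in the purity
  argument lives on a submodule. With \<open>P\<close> the identity, the first half says that
  \<open>D\<close> is closed under finite sums.\<close>

lemma finsum_partial_hom:
  assumes A: "abelian_monoid A" and B: "abelian_monoid B"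
    and D: "D \<subseteq> carrier B" "\<zero>\<^bsub>B\<^esub> \<in> D" "\<And>x y. x \<in> D \<Longrightarrow> y \<in> D \<Longrightarrow> x \<oplus>\<^bsub>B\<^esub> y \<in> D"
    and P: "\<And>x. x \<in> D \<Longrightarrow> P x \<in> carrier A" "P \<zero>\<^bsub>B\<^esub> = \<zero>\<^bsub>A\<^esub>"
      "\<And>x y. x \<in> D \<Longrightarrow> y \<in> D \<Longrightarrow> P (x \<oplus>\<^bsub>B\<^esub> y) = P x \<oplus>\<^bsub>A\<^esub> P y"
    and J: "finite J" "\<And>j. j \<in> J \<Longrightarrow> b j \<in> D"
  shows "finsum B b J \<in> D \<and> P (finsum B b J) = (\<Oplus>\<^bsub>A\<^esub>j\<in>J. P (b j))"
  using J
proof (induction J)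
  case empty
  then show ?case
    using D P by (simp add: abelian_monoid.finsum_empty[OF A] abelian_monoid.finsum_empty[OF B])
next
  case (insert i J)
  have "finsum B b (insert i J) = b i \<oplus>\<^bsub>B\<^esub> finsum B b J"
    using insert D(1) by (intro abelian_monoid.finsum_insert[OF B]) auto
  moreover have "(\<Oplus>\<^bsub>A\<^esub>j\<in>insert i J. P (b j)) = P (b i) \<oplus>\<^bsub>A\<^esub> (\<Oplus>\<^bsub>A\<^esub>j\<in>J. P (b j))"
    using insert P(1) by (intro abelian_monoid.finsum_insert[OF A]) auto
  ultimately show ?case using insert D(3) P(3) by simp
qed

locale Rxy_module =
  fixes N :: "('f::field fps fps set, 'm) module"
  assumes module: "module Rxy N"

sublocale Rxy_module \<subseteq> N: module Rxy N
  by (rule module)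

sublocale Rxy_module \<subseteq> dual_module "carrier N" "add N" "\<zero>\<^bsub>N\<^esub>" "\<lambda>d m. rr d 0 \<odot>\<^bsub>N\<^esub> m" "\<lambda>m. rr 0 1 \<odot>\<^bsub>N\<^esub> m"
  by (rule module_dual_module[OF module])

context Rxy_module
begin

lemma smult_eq:
  "m \<in> carrier N \<Longrightarrow> rr a b \<odot>\<^bsub>N\<^esub> m = rr a 0 \<odot>\<^bsub>N\<^esub> m \<oplus>\<^bsub>N\<^esub> rr b 0 \<odot>\<^bsub>N\<^esub> (rr 0 1 \<odot>\<^bsub>N\<^esub> m)"
  by (rule smult_rr[OF module])

lemma F_mod_simps:
  "carrier (F_mod :: ('f fps fps set, 'f) module) = UNIV" "c \<oplus>\<^bsub>F_mod\<^esub> c' = c + (c' :: 'f)"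
  "rr a b \<odot>\<^bsub>F_mod\<^esub> c = fps_nth a 0 * (c :: 'f)"
proof -
  have "quot_map (\<lambda>p. fps_nth (fps_nth p 0) 0) (rr a b) = fps_nth a 0"
    by (rule quot_map_rr) (simp add: rr_def)
  then show "rr a b \<odot>\<^bsub>F_mod\<^esub> c = fps_nth a 0 * (c :: 'f)"
    by (simp add: F_mod_def ring_as_module_def ring_of_type_algebra_simps)
qed (simp_all add: F_mod_def ring_as_module_def ring_of_type_algebra_simps)

text \<open>A homomorphism from F amounts to an element killed by x and y. If ym = 0, then xm is
  killed by both and so vanishes, which makes \<open>m\<close> itself such an element.\<close>

lemma cohen_macaulay_iff:
  "cohen_macaulay N \<longleftrightarrow> (\<forall>m\<in>carrier N. rr fps_X 0 \<odot>\<^bsub>N\<^esub> m = \<zero>\<^bsub>N\<^esub> \<longrightarrow> m = \<zero>\<^bsub>N\<^esub>)"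
proof
  assume cm: "cohen_macaulay N"
  have socle: "m = \<zero>\<^bsub>N\<^esub>"
    if m: "m \<in> carrier N" "rr fps_X 0 \<odot>\<^bsub>N\<^esub> m = \<zero>\<^bsub>N\<^esub>" "rr 0 1 \<odot>\<^bsub>N\<^esub> m = \<zero>\<^bsub>N\<^esub>" for m
  proof -
    \<comment> \<open>The homomorphism c |-> cm; a power series acts on \<open>m\<close> through its
      constant term, since y kills \<open>m\<close>.\<close>
    define h where "h c = rr (fps_const c) 0 \<odot>\<^bsub>N\<^esub> m" for c
    have "h (fps_nth a 0 * c) = rr a b \<odot>\<^bsub>N\<^esub> h c" for a b c
    proof -
      define a' where "a' = fps_shift 1 a"
      have a: "a = fps_const (fps_nth a 0) + a' * fps_X"
        by (rule fps_ext) (auto simp: a'_def gr0_conv_Suc)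
      have "rr a 0 \<odot>\<^bsub>N\<^esub> m = rr (fps_const (fps_nth a 0)) 0 \<odot>\<^bsub>N\<^esub> m"
        by (subst a) (simp add: add_sm mult_sm m)
      then have "rr a 0 \<odot>\<^bsub>N\<^esub> h c = h (fps_nth a 0 * c)"
        using m(1) unfolding h_def
        by (metis fps_const_mult mult.commute mult_sm)
      moreover have "rr 0 1 \<odot>\<^bsub>N\<^esub> h c = \<zero>\<^bsub>N\<^esub>" using m by (simp add: h_def xi_sm)
      moreover have "h c \<in> carrier N" for c using m by (simp add: h_def)
      ultimately show ?thesis using smult_eq[of "h c" a b] by simp
    qed
    moreover have "h (c + c') = h c \<oplus>\<^bsub>N\<^esub> h c'" for c c'
      using m(1) by (simp add: h_def add_sm flip: fps_const_add)
    ultimately have "h \<in> mod_hom Rxy F_mod N"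
      using m(1) by (auto simp: mod_hom_def F_mod_simps carrier_Rxy h_def)
    then have "h 1 = \<zero>\<^bsub>N\<^esub>" using cm by (simp add: cohen_macaulay_def F_mod_simps)
    then show ?thesis using m(1) by (simp add: h_def)
  qed
  show "\<forall>m\<in>carrier N. rr fps_X 0 \<odot>\<^bsub>N\<^esub> m = \<zero>\<^bsub>N\<^esub> \<longrightarrow> m = \<zero>\<^bsub>N\<^esub>"
  proof (intro ballI impI)
    fix m assume m: "m \<in> carrier N" "rr fps_X 0 \<odot>\<^bsub>N\<^esub> m = \<zero>\<^bsub>N\<^esub>"
    have "rr fps_X 0 \<odot>\<^bsub>N\<^esub> (rr 0 1 \<odot>\<^bsub>N\<^esub> m) = \<zero>\<^bsub>N\<^esub>" using m by (simp flip: xi_sm)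
    then have "rr 0 1 \<odot>\<^bsub>N\<^esub> m = \<zero>\<^bsub>N\<^esub>" by (rule socle[rotated]) (use m in simp_all)
    then show "m = \<zero>\<^bsub>N\<^esub>" using m socle by blast
  qed
next
  assume tf: "\<forall>m\<in>carrier N. rr fps_X 0 \<odot>\<^bsub>N\<^esub> m = \<zero>\<^bsub>N\<^esub> \<longrightarrow> m = \<zero>\<^bsub>N\<^esub>"
  have "h c = \<zero>\<^bsub>N\<^esub>" if h: "h \<in> mod_hom Rxy F_mod N" for h c
  proof -
    have hD: "h c \<in> carrier N" "h (rr a b \<odot>\<^bsub>F_mod\<^esub> c) = rr a b \<odot>\<^bsub>N\<^esub> h c" for a b c
      using h by (auto simp: mod_hom_def F_mod_simps(1))
    have "rr fps_X 0 \<odot>\<^bsub>N\<^esub> h c = h 0"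
      using hD(2)[of fps_X 0 c] by (simp add: F_mod_simps)
    also have "\<dots> = \<zero>\<^bsub>N\<^esub>" using hD(2)[of 0 0 0] hD(1) by (simp add: F_mod_simps)
    finally show ?thesis using tf hD(1) by blast
  qed
  then show "cohen_macaulay N" by (simp add: cohen_macaulay_def)
qed

lemma submodule_iff:
  "submodule U Rxy N \<longleftrightarrow> U \<subseteq> carrier N \<and> \<zero>\<^bsub>N\<^esub> \<in> U \<and> (\<forall>m\<in>U. \<forall>n\<in>U. m \<oplus>\<^bsub>N\<^esub> n \<in> U) \<and>
    (\<forall>d. \<forall>m\<in>U. rr d 0 \<odot>\<^bsub>N\<^esub> m \<in> U) \<and> (\<forall>m\<in>U. rr 0 1 \<odot>\<^bsub>N\<^esub> m \<in> U)" (is "?L \<longleftrightarrow> ?R")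
proof
  assume ?L
  then interpret submodule U Rxy N .
  show ?R using subset one_closed m_closed smult_closed by auto
next
  assume R: ?R
  have neg: "\<ominus>\<^bsub>N\<^esub> m = rr (-1) 0 \<odot>\<^bsub>N\<^esub> m" if "m \<in> carrier N" for m
    using that add_neg[of m] by (intro N.minus_equality) (auto simp: N.a_comm)
  show ?L
  proof (rule N.submoduleI)
    show "r \<odot>\<^bsub>N\<^esub> m \<in> U" if rm: "r \<in> carrier Rxy" "m \<in> U" for r m
    proof -
      obtain a b where "r = rr a b" using rm by (auto simp: carrier_Rxy)
      then show ?thesis using rm R smult_eq[of m a b] by auto
    qed
  qed (use R neg in auto)
qed

text \<open>An idempotent e decomposes N into eN and its kernel, which contains every m - em; if e
  is nonzero, the kernel has to vanish.\<close>

lemma indecomposable_trivial_idempotents: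
  assumes "indecomposable Rxy N"
  shows trivial_idempotents "carrier N \<noteq> {\<zero>\<^bsub>N\<^esub>}"
proof -
  show "carrier N \<noteq> {\<zero>\<^bsub>N\<^esub>}" using assms by (simp add: indecomposable_def)
  show trivial_idempotents
    unfolding trivial_idempotents_def
  proof (intro allI impI)
    fix e assume e: "endomorphism e" "\<forall>m\<in>carrier N. e (e m) = e m" "\<exists>m\<in>carrier N. e m \<noteq> \<zero>\<^bsub>N\<^esub>"
    define U where "U = e ` carrier N"
    define V where "V = {m \<in> carrier N. e m = \<zero>\<^bsub>N\<^esub>}"
    have e0: "e \<zero>\<^bsub>N\<^esub> = \<zero>\<^bsub>N\<^esub>"
    proof -
      have "e (rr 0 0 \<odot>\<^bsub>N\<^esub> \<zero>\<^bsub>N\<^esub>) = rr 0 0 \<odot>\<^bsub>N\<^esub> e \<zero>\<^bsub>N\<^esub>"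
        using e(1) unfolding endomorphism_def by blast
      then show ?thesis using e(1) by (simp add: endomorphism_def)
    qed
    have "submodule U Rxy N"
      unfolding submodule_iff U_def
    proof (intro conjI ballI allI)
      show "\<zero>\<^bsub>N\<^esub> \<in> e ` carrier N" using e0 by (metis N.zero_closed image_eqI)
      show "e ` carrier N \<subseteq> carrier N" using e(1) by (auto simp: endomorphism_def)
      fix m assume m: "m \<in> e ` carrier N"
      then obtain p where p: "p \<in> carrier N" "m = e p" by blast
      show "rr d 0 \<odot>\<^bsub>N\<^esub> m \<in> e ` carrier N" for d
        using e(1) p by (intro image_eqI[of _ _ "rr d 0 \<odot>\<^bsub>N\<^esub> p"]) (auto simp: endomorphism_def)
      show "rr 0 1 \<odot>\<^bsub>N\<^esub> m \<in> e ` carrier N"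
        using e(1) p by (intro image_eqI[of _ _ "rr 0 1 \<odot>\<^bsub>N\<^esub> p"]) (auto simp: endomorphism_def)
      fix n assume "n \<in> e ` carrier N"
      then obtain q where q: "q \<in> carrier N" "n = e q" by blast
      show "m \<oplus>\<^bsub>N\<^esub> n \<in> e ` carrier N"
        using e(1) p q by (intro image_eqI[of _ _ "p \<oplus>\<^bsub>N\<^esub> q"]) (auto simp: endomorphism_def)
    qed
    moreover have "submodule V Rxy N"
      unfolding submodule_iff V_def using e(1) e0 by (auto simp: endomorphism_def)
    moreover have "U \<inter> V = {\<zero>\<^bsub>N\<^esub>}"
      using e e0 by (auto simp: U_def V_def image_iff endomorphism_def intro!: bexI[of _ "\<zero>\<^bsub>N\<^esub>"])
    moreover have diff: "m \<oplus>\<^bsub>N\<^esub> rr (-1) 0 \<odot>\<^bsub>N\<^esub> e m \<in> V" if "m \<in> carrier N" for m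
      using that e by (auto simp: V_def endomorphism_def)
    moreover have "U <+>\<^bsub>N\<^esub> V = carrier N"
    proof -
      have "m \<in> U <+>\<^bsub>N\<^esub> V" if m: "m \<in> carrier N" for m
      proof -
        have em: "e m \<in> carrier N" using e(1) m by (simp add: endomorphism_def)
        have "m = e m \<oplus>\<^bsub>N\<^esub> (m \<oplus>\<^bsub>N\<^esub> rr (-1) 0 \<odot>\<^bsub>N\<^esub> e m)"
          using m em add_left_comm[of "e m" m "rr (-1) 0 \<odot>\<^bsub>N\<^esub> e m"] by simp
        then show ?thesis using diff[OF m] m by (auto simp: set_add_def' U_def)
      qed
      then show ?thesis using e(1) by (auto simp: set_add_def' U_def V_def endomorphism_def)
    qed
    ultimately have "U = {\<zero>\<^bsub>N\<^esub>} \<or> V = {\<zero>\<^bsub>N\<^esub>}"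
      using assms unfolding indecomposable_def by blast
    then have V: "V = {\<zero>\<^bsub>N\<^esub>}" using e(3) by (auto simp: U_def)
    show "\<forall>m\<in>carrier N. e m = m"
    proof
      fix m assume m: "m \<in> carrier N"
      have "m \<oplus>\<^bsub>N\<^esub> rr (-1) 0 \<odot>\<^bsub>N\<^esub> e m = \<zero>\<^bsub>N\<^esub>" using diff[OF m] V by blast
      then show "e m = m" using eq_iff_diff[of m "e m"] m e(1) by (simp add: endomorphism_def)
    qed
  qed
qed

lemma two_generated_fin_gen:
  assumes two_generated
  shows "fin_gen Rxy N"
proof -
  obtain w v where wv: "w \<in> carrier N" "v \<in> carrier N"
    "\<And>m. m \<in> carrier N \<Longrightarrow> \<exists>a b. m = rr a 0 \<odot>\<^bsub>N\<^esub> w \<oplus>\<^bsub>N\<^esub> rr b 0 \<odot>\<^bsub>N\<^esub> v"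
    using assms unfolding two_generated_def by blast
  have "\<exists>c\<in>{w, v} \<rightarrow> carrier Rxy. m = (\<Oplus>\<^bsub>N\<^esub>s\<in>{w, v}. c s \<odot>\<^bsub>N\<^esub> s)" if m: "m \<in> carrier N" for m
  proof -
    obtain a b where ab: "m = rr a 0 \<odot>\<^bsub>N\<^esub> w \<oplus>\<^bsub>N\<^esub> rr b 0 \<odot>\<^bsub>N\<^esub> v" using wv(3)[OF m] by blast
    show ?thesis
    \<comment> \<open>The sum runs over a set, where equal generators are counted once, so their
      coefficients have to be added.\<close>
    proof (cases "w = v")
      case True
      then show ?thesis
        using ab wv(1,2) by (intro bexI[of _ "\<lambda>_. rr (a + b) 0"]) (simp_all add: add_sm)
    next
      case False
      then have "(\<Oplus>\<^bsub>N\<^esub>s\<in>{w, v}. (if s = w then rr a 0 else rr b 0) \<odot>\<^bsub>N\<^esub> s) = m"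
        using ab wv(1,2) by (subst N.finsum_insert) auto
      then show ?thesis by (intro bexI[of _ "\<lambda>s. if s = w then rr a 0 else rr b 0"]) auto
    qed
  qed
  then show ?thesis unfolding fin_gen_def using wv(1,2) by (intro exI[of _ "{w, v}"]) auto
qed

end

section \<open>Lifting a line along x by pure injectivity\<close>

locale cm_Rxy_module = Rxy_module +
  assumes X_torsion_free: "m \<in> carrier N \<Longrightarrow> rr fps_X 0 \<odot>\<^bsub>N\<^esub> m = \<zero>\<^bsub>N\<^esub> \<Longrightarrow> m = \<zero>\<^bsub>N\<^esub>"

sublocale cm_Rxy_module \<subseteq> cm_dual_module "carrier N" "add N" "\<zero>\<^bsub>N\<^esub>"
    "\<lambda>d m. rr d 0 \<odot>\<^bsub>N\<^esub> m" "\<lambda>m. rr 0 1 \<odot>\<^bsub>N\<^esub> m"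
  by unfold_locales (rule X_torsion_free)

text \<open>The module \<open>B = N \<oplus> F((y))\<close> with \<open>x(n, c) = (xn + g(c), 0)\<close> contains \<open>N\<close> as a pure
  submodule: the submodule \<open>N \<oplus> y\<^sup>-\<^sup>n F[[y]]\<close> retracts onto \<open>N\<close> by \<open>y\<^sup>-\<^sup>n \<mapsto> p\<close> where
  \<open>y\<^sup>n xp = g(1)\<close>. A retraction \<open>B \<rightarrow> N\<close>, which exists if \<open>N\<close> is pure injective, lifts \<open>g\<close>
  along \<open>x\<close>.\<close>

lemma (in cm_Rxy_module) pure_injective_lift:
  fixes j :: "'a \<times> 'b fls \<Rightarrow> 'u"
  assumes pi: "pure_injective TYPE('u) Rxy N" and j: "inj j"
    and g: "fls_line g" "range g \<subseteq> (\<lambda>m. rr 0 1 \<odot>\<^bsub>N\<^esub> m) ` carrier N"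
    and div: "\<And>n m. m \<in> carrier N \<Longrightarrow>
      \<exists>p\<in>carrier N. rr (fps_X ^ n) 0 \<odot>\<^bsub>N\<^esub> (rr 0 1 \<odot>\<^bsub>N\<^esub> p) = rr 0 1 \<odot>\<^bsub>N\<^esub> m"
  shows "\<exists>h. fls_line h \<and> (\<forall>c. rr 0 1 \<odot>\<^bsub>N\<^esub> h c = g c)"
proof -
  \<comment> \<open>Test modules must be carried by \<open>'u\<close>: the set N x F((y)) is moved
    there along \<open>j\<close>, and \<open>i\<close> reads elements back.\<close>
  define i where "i = inv_into UNIV j"
  have ij [simp]: "i (j z) = z" for z using j by (simp add: i_def inv_f_f)
  have jj [simp]: "j z = j z' \<longleftrightarrow> z = z'" for z z' using j by (simp add: inj_eq)
  note gD = fls_lineD[OF g(1)]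
  have xi_g: "rr 0 1 \<odot>\<^bsub>N\<^esub> g c = \<zero>\<^bsub>N\<^esub>" for c
  proof -
    obtain m where "m \<in> carrier N" "g c = rr 0 1 \<odot>\<^bsub>N\<^esub> m" using g(2) by blast
    then show ?thesis by simp
  qed
  have g0: "g 0 = \<zero>\<^bsub>N\<^esub>" using gD(3)[of 0 0] gD(1) by simp
  define ad where "ad u v = j (fst (i u) \<oplus>\<^bsub>N\<^esub> fst (i v), snd (i u) + snd (i v))" for u v
  define sm where "sm d u = j (rr d 0 \<odot>\<^bsub>N\<^esub> fst (i u), fps_to_fls d * snd (i u))" for d u
  define x where "x u = j (rr 0 1 \<odot>\<^bsub>N\<^esub> fst (i u) \<oplus>\<^bsub>N\<^esub> g (snd (i u)), 0)" for u
  have op_simps [simp]: "ad (j (m, c)) (j (n, d)) = j (m \<oplus>\<^bsub>N\<^esub> n, c + d)"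
    "sm e (j (m, c)) = j (rr e 0 \<odot>\<^bsub>N\<^esub> m, fps_to_fls e * c)"
    "x (j (m, c)) = j (rr 0 1 \<odot>\<^bsub>N\<^esub> m \<oplus>\<^bsub>N\<^esub> g c, 0)" for m n c d e
    by (simp_all add: ad_def sm_def x_def)
  \<comment> \<open>\<open>T\<close> = {0} will give the copy of N, and \<open>T\<close> =
    \<open>UNIV\<close> the test module that contains it.\<close>
  have dual: "dual_module (j ` (carrier N \<times> T)) ad (j (\<zero>\<^bsub>N\<^esub>, 0)) sm x"
    if T: "0 \<in> T" "\<And>c d. c \<in> T \<Longrightarrow> d \<in> T \<Longrightarrow> c + d \<in> T" "\<And>e c. c \<in> T \<Longrightarrow> fps_to_fls e * c \<in> T" for T
    by unfold_locales
      (use T in \<open>auto simp: add_assoc add_sm sm_add mult_sm gD xi_add xi_sm xi_g g0 distrib_left distrib_right mult.assoc add.assoc add.commute add.left_commute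
        fls_times_fps_to_fls add_ac intro!: imageI\<close>)
  define A where "A = dual_to_module (j ` (carrier N \<times> {0})) ad (j (\<zero>\<^bsub>N\<^esub>, 0)) sm x"
  define B where "B = dual_to_module (j ` (carrier N \<times> UNIV)) ad (j (\<zero>\<^bsub>N\<^esub>, 0)) sm x"
  have mA: "module Rxy A" unfolding A_def by (intro module_dual_to_module dual) auto
  have mB: "module Rxy B" unfolding B_def by (intro module_dual_to_module dual) auto
  interpret A: module Rxy A by (rule mA)
  interpret B: module Rxy B by (rule mB)
  have cA: "carrier A = j ` (carrier N \<times> {0})" and cB: "carrier B = j ` (carrier N \<times> UNIV)"
    by (simp_all add: A_def B_def)
  have smA: "rr a b \<odot>\<^bsub>A\<^esub> u = ad (sm a u) (sm b (x u))" and smB: "rr a b \<odot>\<^bsub>B\<^esub> u = ad (sm a u) (sm b (x u))"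
    and adA: "u \<oplus>\<^bsub>A\<^esub> v = ad u v" and adB: "u \<oplus>\<^bsub>B\<^esub> v = ad u v"
    and zA: "\<zero>\<^bsub>A\<^esub> = j (\<zero>\<^bsub>N\<^esub>, 0)" and zB: "\<zero>\<^bsub>B\<^esub> = j (\<zero>\<^bsub>N\<^esub>, 0)" for a b u v
    by (simp_all add: A_def B_def)
  have hom_id: "(\<lambda>u. u) \<in> mod_hom Rxy A B"
    unfolding mod_hom_def by (auto simp: cA cB smA smB adA adB carrier_Rxy)
  have solve: "\<exists>c\<in>{..<l} \<rightarrow> carrier A. \<forall>i<k. (\<Oplus>\<^bsub>A\<^esub>q\<in>{..<l}. r i q \<odot>\<^bsub>A\<^esub> c q) = a i"
    if r: "\<forall>i<k. \<forall>q<l. r i q \<in> carrier Rxy" and a: "\<forall>i<k. a i \<in> carrier A"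
      and b: "b \<in> {..<l} \<rightarrow> carrier B" "\<forall>i<k. (\<Oplus>\<^bsub>B\<^esub>q\<in>{..<l}. r i q \<odot>\<^bsub>B\<^esub> b q) = a i"
    for k l :: nat and r a b
  proof -
    \<comment> \<open>Finitely many unknowns have a common denominator y^n; this is where finiteness
      of the system is used.\<close>
    have "\<exists>n. \<forall>q\<in>{..<l'}. snd (i (b q)) \<in> {c. fls_subdegree (fps_to_fls (fps_X ^ n) * c) \<ge> 0}" for l'
    proof (induction l')
      case (Suc l')
      then obtain n where n: "\<forall>q\<in>{..<l'}. fls_subdegree (fps_to_fls (fps_X ^ n) * snd (i (b q))) \<ge> 0" by auto
      obtain m d where m: "fps_to_fls (fps_X ^ m) * snd (i (b l')) = fps_to_fls d" by (rule fls_denominator)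
      have "fls_subdegree (fps_to_fls (fps_X ^ (m + n)) * snd (i (b q))) \<ge> 0" if "q < Suc l'" for q
      proof (cases "q = l'")
        case True
        have "fps_to_fls (fps_X ^ (m + n)) * snd (i (b q)) = fps_to_fls (fps_X ^ n * d)"
          using True by (simp add: power_add fls_times_fps_to_fls mult_ac flip: m)
        then show ?thesis using fls_subdegree_fls_to_fps_gt0 by metis
      next
        case False
        then have "fls_subdegree (fps_to_fls (fps_X ^ n) * snd (i (b q))) \<ge> 0" using n \<open>q < Suc l'\<close> by simp
        then have "fls_subdegree (fps_to_fls (fps_X ^ m) * (fps_to_fls (fps_X ^ n) * snd (i (b q)))) \<ge> 0"
          by (rule fls_subdegree_nonneg_mult)
        then show ?thesis by (simp add: power_add fls_times_fps_to_fls mult_ac)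
      qed
      then show ?case by (intro exI[of _ "m + n"]) auto
    qed auto
    then obtain n where n: "\<And>q. q < l \<Longrightarrow> fls_subdegree (fps_to_fls (fps_X ^ n) * snd (i (b q))) \<ge> 0"
      by blast
    obtain p where p: "p \<in> carrier N" "rr (fps_X ^ n) 0 \<odot>\<^bsub>N\<^esub> (rr 0 1 \<odot>\<^bsub>N\<^esub> p) = g 1"
    proof -
      obtain m where "m \<in> carrier N" "g 1 = rr 0 1 \<odot>\<^bsub>N\<^esub> m" using g(2) by blast
      then show thesis using div[of m n] that by metis
    qed
    define T where "T = {c :: 'b fls. fls_subdegree (fps_to_fls (fps_X ^ n) * c) \<ge> 0}"
    define D where "D = j ` (carrier N \<times> T)"
    define nu where "nu c = fls_regpart (fps_to_fls (fps_X ^ n) * c)" for c :: "'b fls"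
    have nu: "fps_to_fls (nu c) = fps_to_fls (fps_X ^ n) * c" if "c \<in> T" for c
      using that by (simp add: nu_def T_def)
    have T_closed: "0 \<in> T" "c \<in> T \<Longrightarrow> d \<in> T \<Longrightarrow> c + d \<in> T" "c \<in> T \<Longrightarrow> fps_to_fls e * c \<in> T" for c d e
      using fls_subdegree_nonneg_add fls_subdegree_nonneg_mult
      by (auto simp: T_def distrib_left mult.left_commute[of "fps_to_fls (fps_X ^ n)"])
    have nu_simps: "nu 0 = 0" "c \<in> T \<Longrightarrow> d \<in> T \<Longrightarrow> nu (c + d) = nu c + nu d"
      "c \<in> T \<Longrightarrow> nu (fps_to_fls e * c) = e * nu c" for c d e
    proof -
      show "nu 0 = 0" by (simp add: nu_def)
      show "nu (c + d) = nu c + nu d" by (simp add: nu_def distrib_left)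
      show "nu (fps_to_fls e * c) = e * nu c" if "c \<in> T"
      proof -
        have "fps_to_fls (nu (fps_to_fls e * c)) = fps_to_fls (e * nu c)"
          using nu[OF that] nu[OF T_closed(3)[OF that]]
          by (simp only: fls_times_fps_to_fls mult.left_commute)
        then show ?thesis by simp
      qed
    qed
    \<comment> \<open>\<open>nu c\<close> is y^n c as a power series, and multiplication by y^n
      turns both sides into \<open>nu c\<close> times g(1). The identity makes the retraction
      \<open>P\<close>, which sends c to \<open>nu c\<close> times \<open>p\<close>, compatible with
      x.\<close>
    have nu_xi: "rr (nu c) 0 \<odot>\<^bsub>N\<^esub> (rr 0 1 \<odot>\<^bsub>N\<^esub> p) = g c" if "c \<in> T" for c
    proof (rule X_power_cancel)
      have "rr (fps_X ^ n) 0 \<odot>\<^bsub>N\<^esub> (rr (nu c) 0 \<odot>\<^bsub>N\<^esub> (rr 0 1 \<odot>\<^bsub>N\<^esub> p)) = rr (nu c) 0 \<odot>\<^bsub>N\<^esub> g 1"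
        using p X_power_sm_commute[of "rr 0 1 \<odot>\<^bsub>N\<^esub> p" n "nu c"] by simp
      also have "\<dots> = rr (fps_X ^ n) 0 \<odot>\<^bsub>N\<^esub> g c"
        using nu[OF that] by (simp flip: gD(3))
      finally show "rr (fps_X ^ n) 0 \<odot>\<^bsub>N\<^esub> (rr (nu c) 0 \<odot>\<^bsub>N\<^esub> (rr 0 1 \<odot>\<^bsub>N\<^esub> p)) = rr (fps_X ^ n) 0 \<odot>\<^bsub>N\<^esub> g c" .
    qed (use p gD(1) in auto)
    define P where "P u = j (fst (i u) \<oplus>\<^bsub>N\<^esub> rr (nu (snd (i u))) 0 \<odot>\<^bsub>N\<^esub> p, 0)" for u
    have P_j: "P (j (m, c)) = j (m \<oplus>\<^bsub>N\<^esub> rr (nu c) 0 \<odot>\<^bsub>N\<^esub> p, 0)" for m c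
      by (simp add: P_def)
    have D_closed: "D \<subseteq> carrier B" "\<zero>\<^bsub>B\<^esub> \<in> D" "u \<in> D \<Longrightarrow> v \<in> D \<Longrightarrow> u \<oplus>\<^bsub>B\<^esub> v \<in> D"
      "u \<in> D \<Longrightarrow> s \<in> carrier Rxy \<Longrightarrow> s \<odot>\<^bsub>B\<^esub> u \<in> D" for u v s
      using T_closed gD(1) by (auto simp: D_def cB zB adB smB carrier_Rxy)
    have P_hom: "u \<in> D \<Longrightarrow> P u \<in> carrier A" "P \<zero>\<^bsub>B\<^esub> = \<zero>\<^bsub>A\<^esub>"
      "u \<in> D \<Longrightarrow> v \<in> D \<Longrightarrow> P (u \<oplus>\<^bsub>B\<^esub> v) = P u \<oplus>\<^bsub>A\<^esub> P v" for u v
      using p by (auto simp: D_def cA zA zB adA adB P_j nu_simps add_sm add_ac)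
    have P_smult: "P (s \<odot>\<^bsub>B\<^esub> u) = s \<odot>\<^bsub>A\<^esub> P u" if u: "u \<in> D" and s: "s \<in> carrier Rxy" for u s
    proof -
      obtain m c where m: "u = j (m, c)" "m \<in> carrier N" "c \<in> T" using u by (auto simp: D_def)
      obtain a e where ae: "s = rr a e" using s by (auto simp: carrier_Rxy)
      show ?thesis
        using m p gD(1)[of c] nu_xi[OF m(3)] T_closed(3)[OF m(3)]
        by (simp add: m ae smA smB P_j nu_simps sm_add xi_add xi_sm mult_sm g0 add_ac)
    qed
    have P_id: "P u = u" if "u \<in> carrier A" for u
      using that p by (auto simp: cA P_j nu_simps)
    have bD: "b q \<in> D" if q: "q < l" for q
    proof -
      obtain m c where m: "b q = j (m, c)" "m \<in> carrier N" using funcset_mem[OF b(1), of q] q unfolding cB by blast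
      then show ?thesis using n[OF q] by (auto simp: D_def T_def)
    qed
    have "(\<Oplus>\<^bsub>A\<^esub>q\<in>{..<l}. r i q \<odot>\<^bsub>A\<^esub> P (b q)) = a i" if i: "i < k" for i
    proof -
      have "P (\<Oplus>\<^bsub>B\<^esub>q\<in>{..<l}. r i q \<odot>\<^bsub>B\<^esub> b q) = (\<Oplus>\<^bsub>A\<^esub>q\<in>{..<l}. P (r i q \<odot>\<^bsub>B\<^esub> b q))"
        using finsum_partial_hom[OF A.abelian_monoid_axioms B.abelian_monoid_axioms D_closed(1-3) P_hom,
            of "{..<l}" "\<lambda>q. r i q \<odot>\<^bsub>B\<^esub> b q"] r i bD D_closed(4) by blast
      also have "\<dots> = (\<Oplus>\<^bsub>A\<^esub>q\<in>{..<l}. r i q \<odot>\<^bsub>A\<^esub> P (b q))"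
        using r i bD P_hom(1) P_smult by (intro A.finsum_cong') auto
      finally show ?thesis using b(2) a i P_id by simp
    qed
    moreover have "(\<lambda>q. P (b q)) \<in> {..<l} \<rightarrow> carrier A" using bD P_hom(1) by blast
    ultimately show ?thesis by (intro bexI[of _ "\<lambda>q. P (b q)"]) auto
  qed
  have "pure_mono Rxy A B (\<lambda>u. u)"
    unfolding pure_mono_def using hom_id solve by (auto simp: inj_on_def)
  moreover have "(\<lambda>u. fst (i u)) \<in> mod_hom Rxy A N"
    unfolding mod_hom_iff[OF mA module] by (auto simp: cA smA adA g0)
  ultimately obtain H where H: "H \<in> mod_hom Rxy B N" "\<And>u. u \<in> carrier A \<Longrightarrow> H u = fst (i u)"
    using pi mA mB unfolding pure_injective_def by metis
  have HB: "H (j (m, c)) \<in> carrier N"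
      "H (j (m \<oplus>\<^bsub>N\<^esub> n, c + d)) = H (j (m, c)) \<oplus>\<^bsub>N\<^esub> H (j (n, d))"
      "H (rr a e \<odot>\<^bsub>B\<^esub> j (m, c)) = rr a e \<odot>\<^bsub>N\<^esub> H (j (m, c))"
    if "m \<in> carrier N" "n \<in> carrier N" for m n c d a e
    using H(1) that op_simps(1)[of m c n d] unfolding mod_hom_def cB adB
    by (auto simp del: op_simps) (metis UNIV_I imageI mem_Sigma_iff)+
  define h where "h c = H (j (\<zero>\<^bsub>N\<^esub>, c))" for c
  have "fls_line h"
    unfolding fls_line_def
  proof (intro conjI allI)
    show "range h \<subseteq> carrier N" using HB(1) by (auto simp: h_def)
    show "h (c + d) = h c \<oplus>\<^bsub>N\<^esub> h d" for c d
      using HB(2)[of "\<zero>\<^bsub>N\<^esub>" "\<zero>\<^bsub>N\<^esub>" c d] by (simp add: h_def)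
    show "h (fps_to_fls d * c) = rr d 0 \<odot>\<^bsub>N\<^esub> h c" for d c
      using HB(3)[of "\<zero>\<^bsub>N\<^esub>" "\<zero>\<^bsub>N\<^esub>" d 0 c] gD(1)[of c] by (simp add: h_def smB)
  qed
  \<comment> \<open>In the test module x(0, c) = (g(c), 0), and on such elements \<open>H\<close> is
    the projection to N.\<close>
  moreover have "rr 0 1 \<odot>\<^bsub>N\<^esub> h c = g c" for c
    using HB(3)[of "\<zero>\<^bsub>N\<^esub>" "\<zero>\<^bsub>N\<^esub>" 0 1 c] H(2)[of "j (g c, 0)"] gD(1)[of c]
    by (simp add: h_def smB cA)
  ultimately show ?thesis by blast
qed

text \<open>The given injection starts from a double power set, so a pair is wrapped into
  singletons. A Laurent series is coded by two power series: its regular part and its coefficients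
  at the exponents 0, -1, -2 and so on.\<close>

lemma inj_prod_fls:
  assumes "inj (\<iota> :: ('m \<times> 'f::field fps fps) set set \<Rightarrow> 'u)"
  obtains j :: "'m \<times> 'f::field fls \<Rightarrow> 'u" where "inj j"
proof -
  define \<kappa> where "\<kappa> c = fps_const (fls_regpart c) + fps_X * fps_const (Abs_fps (\<lambda>n. fls_nth c (- int n)))"
    for c :: "'f fls"
  have "c = d" if cd: "\<kappa> c = \<kappa> d" for c d
  proof (rule fls_eqI)
    fix n
    have eq: "fls_regpart c = fls_regpart d" "Abs_fps (\<lambda>n. fls_nth c (- int n)) = Abs_fps (\<lambda>n. fls_nth d (- int n))"
      using arg_cong[OF cd, of "\<lambda>p. fps_nth p 0"] arg_cong[OF cd, of "\<lambda>p. fps_nth p 1"]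
      by (simp_all add: \<kappa>_def)
    show "fls_nth c n = fls_nth d n"
    proof (cases "n \<ge> 0")
      case True
      then show ?thesis using arg_cong[OF eq(1), of "\<lambda>p. fps_nth p (nat n)"] by simp
    next
      case False
      then show ?thesis using arg_cong[OF eq(2), of "\<lambda>p. fps_nth p (nat (- n))"] by simp
    qed
  qed
  then have "inj (\<lambda>(m, c). \<iota> {{(m, \<kappa> c)}})"
    using assms by (auto simp: inj_def)
  then show thesis using that by blast
qed

section \<open>Coordinates and points of the spectrum\<close>

context Rxy_module
begin

theorem ZCM_point_coordinate:
  fixes \<iota> :: "('m \<times> 'f fps fps) set set \<Rightarrow> 'u"
  assumes N: "ZCM_point TYPE('u) N" "\<not> fin_gen Rxy N" and \<iota>: "inj \<iota>"
  shows "\<exists>S\<in>{{0}, range fps_to_fls, UNIV}. \<exists>f. coordinate S f"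
proof -
  have "cohen_macaulay N" using N(1) by (simp add: ZCM_point_def)
  note tf = this[unfolded cohen_macaulay_iff]
  interpret cm_Rxy_module N by unfold_locales (use tf in blast)
  obtain j :: "'m \<times> 'f fls \<Rightarrow> 'u" where j: "inj j" using inj_prod_fls[OF \<iota>] .
  have ind: "indecomposable Rxy N" and pi: "pure_injective TYPE('u) Rxy N"
    using N by (auto simp: ZCM_point_def)
  show ?thesis
    by (rule coordinate_trichotomy[OF indecomposable_trivial_idempotents[OF ind]])
      (use N(2) two_generated_fin_gen in blast, rule pure_injective_lift[OF pi j])
qed

lemma coordinate_indecomposable:
  assumes \<beta>: "coordinate S \<beta>" and S: "0 \<in> S"
  shows "indecomposable Rxy N"
  unfolding indecomposable_def
proof (intro conjI allI impI)
  obtain m where "m \<in> carrier N" "\<beta> m = 1" using coordinateD(4)[OF \<beta> S] by blast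
  then show "carrier N \<noteq> {\<zero>\<^bsub>N\<^esub>}" using linear_to_zr[OF coordinateD(1)[OF \<beta>]] by auto
  fix U V
  assume "submodule U Rxy N \<and> submodule V Rxy N \<and> U \<inter> V = {\<zero>\<^bsub>N\<^esub>} \<and> U <+>\<^bsub>N\<^esub> V = carrier N"
  then have UV: "submodule U Rxy N" "submodule V Rxy N" "U \<inter> V = {\<zero>\<^bsub>N\<^esub>}" by auto
  show "U = {\<zero>\<^bsub>N\<^esub>} \<or> V = {\<zero>\<^bsub>N\<^esub>}"
  proof (rule ccontr)
    assume "\<not> (U = {\<zero>\<^bsub>N\<^esub>} \<or> V = {\<zero>\<^bsub>N\<^esub>})"
    then have "\<exists>m\<in>U. m \<noteq> \<zero>\<^bsub>N\<^esub>" "\<exists>m\<in>V. m \<noteq> \<zero>\<^bsub>N\<^esub>" using UV by auto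
    then have "\<exists>m\<in>U \<inter> V. m \<noteq> \<zero>\<^bsub>N\<^esub>"
      using UV(1,2) unfolding submodule_iff by (intro coordinate_uniform[OF \<beta>]) auto
    then show False using UV(3) by simp
  qed
qed

lemma coordinate_not_fin_gen:
  assumes \<beta>: "coordinate S \<beta>" and S: "0 \<in> S"
  shows "\<not> fin_gen Rxy N"
proof
  assume "fin_gen Rxy N"
  then obtain T where T: "finite T" "T \<subseteq> carrier N"
    "\<And>n. n \<in> carrier N \<Longrightarrow> \<exists>c\<in>T \<rightarrow> carrier Rxy. n = (\<Oplus>\<^bsub>N\<^esub>s\<in>T. c s \<odot>\<^bsub>N\<^esub> s)"
    unfolding fin_gen_def by blast
  note closed = bounded_denominator_closed[OF coordinateD(1)[OF \<beta>]]
  obtain k where k: "\<And>s. s \<in> T \<Longrightarrow> bounded_denominator \<beta> k s"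
  proof -
    have "\<exists>k. \<forall>s\<in>T. bounded_denominator \<beta> k s"
      using T(1,2)
    proof (induction T)
      case (insert t T)
      then obtain k where k: "\<forall>s\<in>T. bounded_denominator \<beta> k s" by auto
      obtain k' where "bounded_denominator \<beta> k' t" using closed(6) insert.prems by blast
      then have "\<forall>s\<in>insert t T. bounded_denominator \<beta> (max k k') s"
        using k closed(5) max.cobounded1 max.cobounded2 by blast
      then show ?case ..
    qed auto
    then show thesis using that by blast
  qed
  have bd: "bounded_denominator \<beta> k (r \<odot>\<^bsub>N\<^esub> m)" if bm: "bounded_denominator \<beta> k m" and r: "r \<in> carrier Rxy" for r m
  proof -
    obtain a b where "r = rr a b" using r by (auto simp: carrier_Rxy)
    moreover have "m \<in> carrier N" using bm by (simp add: bounded_denominator_def)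
    ultimately show ?thesis using bm smult_eq[of m a b] closed(2,3,4) by simp
  qed
  have fin: "(\<Oplus>\<^bsub>N\<^esub>s\<in>T. c s \<odot>\<^bsub>N\<^esub> s) \<in> {m. bounded_denominator \<beta> k m}" if c: "c \<in> T \<rightarrow> carrier Rxy" for c
  proof -
    have bC: "bounded_denominator \<beta> k m \<Longrightarrow> m \<in> carrier N" for m
      by (simp add: bounded_denominator_def)
    show ?thesis
      by (rule finsum_partial_hom[OF N.abelian_monoid_axioms N.abelian_monoid_axioms, where P = "\<lambda>m. m",
            THEN conjunct1])
        (use T(1) closed(1,2) bC bd[OF k] funcset_mem[OF c] in simp_all, use bC in blast)
  qed
  obtain m where "m \<in> carrier N" "\<not> bounded_denominator \<beta> k m"
    using coordinate_unbounded[OF \<beta> S] by blast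
  then show False using T(3)[of m] fin by auto
qed

text \<open>A homomorphism into N is a functional on its source, so it suffices to extend
  \<open>\<beta>\<close> composed with \<open>g\<close> along \<open>f\<close>. Then
  \<open>h b\<close> is the element whose coordinates are the values of \<open>\<phi>\<close> at xb
  and b, and all laws follow from injectivity of the coordinates.\<close>

lemma coordinate_pure_injective:
  assumes \<beta>: "coordinate S \<beta>" and S: "S \<in> {{0}, range fps_to_fls, UNIV}"
  shows "pure_injective TYPE('u) Rxy N"
  unfolding pure_injective_def
proof (intro allI impI)
  fix A B :: "('f fps fps set, 'u) module" and f g
  assume "module Rxy A \<and> module Rxy B \<and> pure_mono Rxy A B f \<and> g \<in> mod_hom Rxy A N"
  then have mA: "module Rxy A" and mB: "module Rxy B" and f: "pure_mono Rxy A B f"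
    and g: "g \<in> mod_hom Rxy A N" by auto
  interpret A: Rxy_module A by (rule Rxy_module.intro[OF mA])
  interpret B: Rxy_module B by (rule Rxy_module.intro[OF mB])
  note gD = g[unfolded mod_hom_iff[OF mA module]]
  have fh: "f \<in> mod_hom Rxy A B" and finj: "inj_on f (carrier A)" using f by (auto simp: pure_mono_def)
  note fD = fh[unfolded mod_hom_iff[OF mA mB]]
  have \<beta>D: "linear_to fps_to_fls \<beta>" "\<And>m. m \<in> carrier N \<Longrightarrow> \<beta> (rr 0 1 \<odot>\<^bsub>N\<^esub> m) \<in> S"
    using coordinateD[OF \<beta>] by auto
  have pure: "\<exists>a'\<in>carrier A. rr (fps_X ^ n) 0 \<odot>\<^bsub>A\<^esub> (rr 0 1 \<odot>\<^bsub>A\<^esub> a') = a"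
    if b: "b \<in> carrier B" and a: "a \<in> carrier A"
      and eq: "rr (fps_X ^ n) 0 \<odot>\<^bsub>B\<^esub> (rr 0 1 \<odot>\<^bsub>B\<^esub> b) = f a" for n b a
  proof -
    \<comment> \<open>The condition y^n x z = a is a system with one equation and one unknown, whose
      coefficient \<open>rr 0 (fps_X ^ n)\<close> is the ring element y^n x.\<close>
    have sing: "(\<Oplus>\<^bsub>M\<^esub>j\<in>{..<1::nat}. rr 0 (fps_X ^ n) \<odot>\<^bsub>M\<^esub> c j) =
        rr (fps_X ^ n) 0 \<odot>\<^bsub>M\<^esub> (rr 0 1 \<odot>\<^bsub>M\<^esub> c 0)"
      if M: "module Rxy M" and c: "c 0 \<in> carrier M" for c and M :: "('f fps fps set, 'u) module"
    proof -
      interpret M: Rxy_module M by (rule Rxy_module.intro[OF M])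
      have "{..<1::nat} = {0}" by auto
      then have "(\<Oplus>\<^bsub>M\<^esub>j\<in>{..<1::nat}. rr 0 (fps_X ^ n) \<odot>\<^bsub>M\<^esub> c j) = rr 0 (fps_X ^ n) \<odot>\<^bsub>M\<^esub> c 0"
        using c M.N.finsum_insert[of "{}" 0 "\<lambda>j. rr 0 (fps_X ^ n) \<odot>\<^bsub>M\<^esub> c j"] by simp
      then show ?thesis using M.smult_eq[OF c, of 0 "fps_X ^ n"] c by simp
    qed
    have "\<exists>c\<in>{..<1::nat} \<rightarrow> carrier A. \<forall>i<(1::nat). (\<Oplus>\<^bsub>A\<^esub>j\<in>{..<1::nat}. rr 0 (fps_X ^ n) \<odot>\<^bsub>A\<^esub> c j) = a"
    proof -
      have *: "(\<forall>i<k. \<forall>j<l. r i j \<in> carrier Rxy) \<and> (\<forall>i<k. a i \<in> carrier A) \<and>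
        (\<exists>b\<in>{..<l} \<rightarrow> carrier B. \<forall>i<k. (\<Oplus>\<^bsub>B\<^esub>j\<in>{..<l}. r i j \<odot>\<^bsub>B\<^esub> b j) = f (a i)) \<Longrightarrow>
        \<exists>c\<in>{..<l} \<rightarrow> carrier A. \<forall>i<k. (\<Oplus>\<^bsub>A\<^esub>j\<in>{..<l}. r i j \<odot>\<^bsub>A\<^esub> c j) = a i" for k l :: nat and r a
        using f unfolding pure_mono_def by blast
      show ?thesis
        using sing[OF mB, of "\<lambda>_. b"] eq a b
        by (intro *[of 1 1 "\<lambda>_ _. rr 0 (fps_X ^ n)" "\<lambda>_. a"]) (auto intro!: bexI[of _ "\<lambda>_. b"])
    qed
    then obtain c where c: "c \<in> {..<1::nat} \<rightarrow> carrier A"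
      "(\<Oplus>\<^bsub>A\<^esub>j\<in>{..<1::nat}. rr 0 (fps_X ^ n) \<odot>\<^bsub>A\<^esub> c j) = a" by blast
    have "c 0 \<in> carrier A" using c(1) by auto
    then show ?thesis using sing[OF mA, of c] c(2) by auto
  qed
  have "A.linear_to fps_to_fls (\<lambda>a. \<beta> (g a))"
    using gD linear_toD[OF \<beta>D(1)] by (simp add: A.linear_to_def)
  then obtain \<phi> where \<phi>: "B.linear_to fps_to_fls \<phi>" "\<And>a. a \<in> carrier A \<Longrightarrow> \<phi> (f a) = \<beta> (g a)"
    "\<And>b. b \<in> carrier B \<Longrightarrow> \<phi> (rr 0 1 \<odot>\<^bsub>B\<^esub> b) \<in> S"
    using B.pure_extension[OF A.dual_module_axioms, of f "\<lambda>a. \<beta> (g a)" S] fD finj pure gD \<beta>D(2) S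
    by (smt (verit))
  have "\<exists>m\<in>carrier N. \<beta> (rr 0 1 \<odot>\<^bsub>N\<^esub> m) = \<phi> (rr 0 1 \<odot>\<^bsub>B\<^esub> b) \<and> \<beta> m = \<phi> b" if "b \<in> carrier B" for b
    using coordinateD(4)[OF \<beta> \<phi>(3)[OF that]] .
  then obtain h where h: "\<And>b. b \<in> carrier B \<Longrightarrow> h b \<in> carrier N"
    "\<And>b. b \<in> carrier B \<Longrightarrow> \<beta> (rr 0 1 \<odot>\<^bsub>N\<^esub> h b) = \<phi> (rr 0 1 \<odot>\<^bsub>B\<^esub> b)"
    "\<And>b. b \<in> carrier B \<Longrightarrow> \<beta> (h b) = \<phi> b" by metis
  note lin = linear_toD[OF \<beta>D(1)] linear_to_zr[OF \<beta>D(1)]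
    and \<phi>lin = B.linear_toD[OF \<phi>(1)] B.linear_to_zr[OF \<phi>(1)]
  note uniq = coordinateD(3)[OF \<beta>]
  have "h \<in> mod_hom Rxy B N"
    unfolding mod_hom_iff[OF mB module]
  proof (intro conjI ballI allI)
    fix b assume b: "b \<in> carrier B"
    show "h b \<in> carrier N" using h b by simp
    show "h (rr d 0 \<odot>\<^bsub>B\<^esub> b) = rr d 0 \<odot>\<^bsub>N\<^esub> h b" for d
      using h b by (intro uniq) (simp_all add: lin \<phi>lin B.xi_sm xi_sm)
    show "h (rr 0 1 \<odot>\<^bsub>B\<^esub> b) = rr 0 1 \<odot>\<^bsub>N\<^esub> h b"
      using h b by (intro uniq) (simp_all add: lin \<phi>lin)
    fix c assume c: "c \<in> carrier B"
    show "h (b \<oplus>\<^bsub>B\<^esub> c) = h b \<oplus>\<^bsub>N\<^esub> h c"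
      using h b c by (intro uniq) (simp_all add: lin \<phi>lin B.xi_add xi_add)
  qed
  moreover have "h (f a) = g a" if a: "a \<in> carrier A" for a
  proof (rule uniq)
    have fa: "f a \<in> carrier B" using fD a by blast
    show "h (f a) \<in> carrier N" "g a \<in> carrier N" using h fa gD a by auto
    show "\<beta> (h (f a)) = \<beta> (g a)" using h fa \<phi>(2) a by simp
    have "\<phi> (rr 0 1 \<odot>\<^bsub>B\<^esub> f a) = \<phi> (f (rr 0 1 \<odot>\<^bsub>A\<^esub> a))" using fD a by simp
    also have "\<dots> = \<beta> (rr 0 1 \<odot>\<^bsub>N\<^esub> g a)" using \<phi>(2)[of "rr 0 1 \<odot>\<^bsub>A\<^esub> a"] gD a by simp
    finally show "\<beta> (rr 0 1 \<odot>\<^bsub>N\<^esub> h (f a)) = \<beta> (rr 0 1 \<odot>\<^bsub>N\<^esub> g a)" using h fa by simp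
  qed
  ultimately show "\<exists>h\<in>mod_hom Rxy B N. \<forall>a\<in>carrier A. h (f a) = g a" by blast
qed

theorem coordinate_ZCM_point:
  assumes \<beta>: "coordinate S \<beta>" and S: "S \<in> {{0}, range fps_to_fls, UNIV}"
  shows "ZCM_point TYPE('u) N \<and> \<not> fin_gen Rxy N"
proof -
  have S0: "0 \<in> S" using S by (auto intro: range_eqI[of _ _ 0])
  have "\<forall>m\<in>carrier N. rr fps_X 0 \<odot>\<^bsub>N\<^esub> m = \<zero>\<^bsub>N\<^esub> \<longrightarrow> m = \<zero>\<^bsub>N\<^esub>"
    using coordinate_torsion_free[OF \<beta>] by blast
  then show ?thesis
    unfolding ZCM_point_def cohen_macaulay_iff
    using module coordinate_indecomposable[OF \<beta> S0] coordinate_not_fin_gen[OF \<beta> S0]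
      coordinate_pure_injective[OF \<beta> S] by blast
qed

end

section \<open>The three modules\<close>

text \<open>The map \<open>\<psi>\<close> presents M as pairs with x(a, b) = (0, a). For an
  isomorphism h the first component of h(m) is thus the second component of h(xm), so the second
  component alone determines h.\<close>

lemma (in Rxy_module) mod_iso_iff_coordinate:
  fixes M :: "('f fps fps set, 'n) module"
  assumes add: "\<And>u v. u \<in> carrier M \<Longrightarrow> v \<in> carrier M \<Longrightarrow> u \<oplus>\<^bsub>M\<^esub> v \<in> carrier M"
      "\<And>u v. u \<in> carrier M \<Longrightarrow> v \<in> carrier M \<Longrightarrow>
        \<psi> (u \<oplus>\<^bsub>M\<^esub> v) = (fst (\<psi> u) + fst (\<psi> v), snd (\<psi> u) + snd (\<psi> v))"
    and smult: "\<And>a b u. u \<in> carrier M \<Longrightarrow> rr a b \<odot>\<^bsub>M\<^esub> u \<in> carrier M"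
      "\<And>a b u. u \<in> carrier M \<Longrightarrow> \<psi> (rr a b \<odot>\<^bsub>M\<^esub> u) =
        (fps_to_fls a * fst (\<psi> u), fps_to_fls a * snd (\<psi> u) + fps_to_fls b * fst (\<psi> u))"
    and bij: "bij_betw \<psi> (carrier M) (S \<times> UNIV)"
  shows "mod_iso Rxy N M \<longleftrightarrow> (\<exists>\<beta>. coordinate S \<beta>)"
proof
  assume "mod_iso Rxy N M"
  then obtain h where h: "h \<in> mod_hom Rxy N M" "bij_betw h (carrier N) (carrier M)"
    by (auto simp: mod_iso_def)
  have hD: "\<And>m. m \<in> carrier N \<Longrightarrow> h m \<in> carrier M"
    "\<And>m n. m \<in> carrier N \<Longrightarrow> n \<in> carrier N \<Longrightarrow> h (m \<oplus>\<^bsub>N\<^esub> n) = h m \<oplus>\<^bsub>M\<^esub> h n"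
    "\<And>a b m. m \<in> carrier N \<Longrightarrow> h (rr a b \<odot>\<^bsub>N\<^esub> m) = rr a b \<odot>\<^bsub>M\<^esub> h m"
    using h(1) by (auto simp: mod_hom_def)
  define \<beta> where "\<beta> m = snd (\<psi> (h m))" for m
  have "linear_to fps_to_fls \<beta>"
    by (simp add: linear_to_def \<beta>_def hD add(2) smult(2))
  moreover have "bij_betw (\<lambda>m. (\<beta> (rr 0 1 \<odot>\<^bsub>N\<^esub> m), \<beta> m)) (carrier N) (S \<times> UNIV)"
  proof -
    have "bij_betw (\<psi> \<circ> h) (carrier N) (S \<times> UNIV)" using h(2) bij by (rule bij_betw_trans)
    then show ?thesis
      by (rule iffD1[OF bij_betw_cong, rotated]) (simp add: \<beta>_def hD smult(2))
  qed
  ultimately show "\<exists>\<beta>. coordinate S \<beta>" by (auto simp: coordinate_def)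
next
  assume "\<exists>\<beta>. coordinate S \<beta>"
  then obtain \<beta> where \<beta>: "linear_to fps_to_fls \<beta>"
    "bij_betw (\<lambda>m. (\<beta> (rr 0 1 \<odot>\<^bsub>N\<^esub> m), \<beta> m)) (carrier N) (S \<times> UNIV)"
    by (auto simp: coordinate_def)
  note lin = linear_toD[OF \<beta>(1)]
  have inj: "inj_on \<psi> (carrier M)" using bij by (rule bij_betw_imp_inj_on)
  define h where "h m = inv_into (carrier M) \<psi> (\<beta> (rr 0 1 \<odot>\<^bsub>N\<^esub> m), \<beta> m)" for m
  have h: "bij_betw h (carrier N) (carrier M)"
  proof -
    have "h = inv_into (carrier M) \<psi> \<circ> (\<lambda>m. (\<beta> (rr 0 1 \<odot>\<^bsub>N\<^esub> m), \<beta> m))"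
      by (simp add: h_def fun_eq_iff)
    then show ?thesis using bij_betw_trans[OF \<beta>(2) bij_betw_inv_into[OF bij]] by simp
  qed
  have hM: "h m \<in> carrier M" if "m \<in> carrier N" for m using bij_betwE[OF h] that by blast
  have \<psi>h: "\<psi> (h m) = (\<beta> (rr 0 1 \<odot>\<^bsub>N\<^esub> m), \<beta> m)" if "m \<in> carrier N" for m
    unfolding h_def using bij_betwE[OF \<beta>(2)] that bij_betw_inv_into_right[OF bij] by blast
  have "h (m \<oplus>\<^bsub>N\<^esub> n) = h m \<oplus>\<^bsub>M\<^esub> h n" if "m \<in> carrier N" "n \<in> carrier N" for m n
    using that by (intro inj_onD[OF inj] hM add) (simp_all add: \<psi>h add hM lin xi_add)
  moreover have "h (rr a b \<odot>\<^bsub>N\<^esub> m) = rr a b \<odot>\<^bsub>M\<^esub> h m" if m: "m \<in> carrier N" for a b m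
  proof (rule inj_onD[OF inj])
    show "\<psi> (h (rr a b \<odot>\<^bsub>N\<^esub> m)) = \<psi> (rr a b \<odot>\<^bsub>M\<^esub> h m)"
      using m linear_to_zr[OF \<beta>(1)]
      by (simp add: \<psi>h smult hM smult_eq[of m a b] xi_add xi_sm lin)
  qed (use m hM smult(1) in auto)
  ultimately have "h \<in> mod_hom Rxy N M"
    using hM by (auto simp: mod_hom_def carrier_Rxy)
  then show "mod_iso Rxy N M" using h by (auto simp: mod_iso_def)
qed

lemma (in Rxy_module) mod_iso_G_iff: "mod_iso Rxy N G_mod \<longleftrightarrow> (\<exists>\<beta>. coordinate {0} \<beta>)"
proof (rule mod_iso_iff_coordinate)
  have smult: "rr a b \<odot>\<^bsub>G_mod\<^esub> c = fps_to_fls a * c" for a b :: "'f fps" and c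
  proof -
    have "quot_map (\<lambda>p. fps_to_fls (fps_nth p 0)) (rr a b) = fps_to_fls a"
      by (rule quot_map_rr) (simp add: rr_def)
    then show ?thesis unfolding G_mod_def ring_as_module_def by (simp add: ring_of_type_algebra_simps)
  qed
  show "(0, rr a b \<odot>\<^bsub>G_mod\<^esub> c) = (fps_to_fls a * fst (0, c), fps_to_fls a * snd (0, c) + fps_to_fls b * fst (0, c))"
    for a b :: "'f fps" and c by (simp add: smult)
  show "bij_betw (Pair 0) (carrier G_mod) ({0} \<times> UNIV)"
    by (auto simp: G_mod_def ring_as_module_def ring_of_type_algebra_simps bij_betw_def inj_on_def)
qed (simp_all add: G_mod_def ring_as_module_def ring_of_type_algebra_simps)

text \<open>The element \<open>(a + bx)/y\<^sup>n\<close> of \<open>Q\<close> is determined by the pair \<open>(a/y\<^sup>n, b/y\<^sup>n)\<close> of Laurent series.\<close>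

definition frac_coords :: "'f::field fps \<Rightarrow> 'f fps \<Rightarrow> nat \<Rightarrow> 'f fls \<times> 'f fls"
  where "frac_coords a b n =
    (fps_to_fls a / fps_to_fls (fps_X ^ n), fps_to_fls b / fps_to_fls (fps_X ^ n))"

text \<open>The class of a fraction is a full fibre of \<open>frac_coords\<close>, which makes pairs
  of Laurent series canonical names for the elements of the localization.\<close>

definition Q_elem :: "'f::field fls \<times> 'f fls \<Rightarrow> ('f fps fps set \<times> 'f fps fps set) set"
  where "Q_elem v = {(rr a b, rr (fps_X ^ n) 0) | a b n. frac_coords a b n = v}"

abbreviation y_powers :: "'f::field fps fps set set"
  where "y_powers \<equiv> range (\<lambda>n::nat. Ry [^]\<^bsub>Rxy\<^esub> n)"

lemma frac_coords_eq_iff: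
  "frac_coords a b n = frac_coords c d m \<longleftrightarrow>
    fps_X ^ m * a = fps_X ^ n * c \<and> fps_X ^ m * b = fps_X ^ n * (d :: 'f::field fps)"
proof -
  have "fps_to_fls a / fps_to_fls (fps_X ^ n) = fps_to_fls c / fps_to_fls (fps_X ^ m) \<longleftrightarrow>
      fps_X ^ m * a = fps_X ^ n * c" for a c :: "'f fps"
  proof -
    have "fps_to_fls a / fps_to_fls (fps_X ^ n) = fps_to_fls c / fps_to_fls (fps_X ^ m) \<longleftrightarrow>
      fps_to_fls (fps_X ^ m * a) = fps_to_fls (fps_X ^ n * c)"
      by (simp add: fls_times_fps_to_fls frac_eq_eq mult.commute del: fps_to_fls_eq_iff)
    then show ?thesis by simp
  qed
  then show ?thesis by (simp add: frac_coords_def)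
qed

lemma frac_coords_surj: "\<exists>a b n. frac_coords a b n = (v :: 'f::field fls \<times> 'f fls)"
proof -
  obtain n a where n: "fps_to_fls (fps_X ^ n) * fst v = fps_to_fls a" by (rule fls_denominator)
  obtain m b where m: "fps_to_fls (fps_X ^ m) * snd v = fps_to_fls b" by (rule fls_denominator)
  have "frac_coords (fps_X ^ m * a) (fps_X ^ n * b) (n + m) = v"
    by (simp add: frac_coords_def fls_times_fps_to_fls power_add prod_eq_iff flip: n m)
  then show ?thesis by blast
qed

text \<open>Powers of y are nonzerodivisors in R, so the extra factor in \<open>frac_rel\<close>
  cancels and equivalence of fractions becomes equality of the Laurent pairs.\<close>

lemma frac_class_eq:
  "frac_class Rxy y_powers (rr a b) (rr (fps_X ^ n) 0) = Q_elem (frac_coords a b n)"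
proof -
  have "((rr a b, rr (fps_X ^ n) 0), (t, w)) \<in> frac_rel Rxy y_powers \<longleftrightarrow>
      (t, w) \<in> Q_elem (frac_coords a b n)" for t w
  proof
    assume "((rr a b, rr (fps_X ^ n) 0), (t, w)) \<in> frac_rel Rxy y_powers"
    then obtain k m c d where "t = rr c d" "w = rr (fps_X ^ m) 0"
      "rr (fps_X ^ k) 0 \<otimes>\<^bsub>Rxy\<^esub> (rr (fps_X ^ m) 0 \<otimes>\<^bsub>Rxy\<^esub> rr a b) =
       rr (fps_X ^ k) 0 \<otimes>\<^bsub>Rxy\<^esub> (rr (fps_X ^ n) 0 \<otimes>\<^bsub>Rxy\<^esub> rr c d)"
      by (auto simp: frac_rel_def Ry_pow carrier_Rxy)
    then show "(t, w) \<in> Q_elem (frac_coords a b n)"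
      by (auto simp: Q_elem_def frac_coords_eq_iff)
  next
    assume "(t, w) \<in> Q_elem (frac_coords a b n)"
    then obtain c d m where "t = rr c d" "w = rr (fps_X ^ m) 0" "frac_coords c d m = frac_coords a b n"
      by (auto simp: Q_elem_def)
    then show "((rr a b, rr (fps_X ^ n) 0), (t, w)) \<in> frac_rel Rxy y_powers"
      by (auto simp: frac_rel_def Ry_pow frac_coords_eq_iff intro!: exI[of _ 0])
  qed
  then show ?thesis by (auto simp: frac_class_def)
qed

lemma Q_elem_nonempty: "\<exists>a b n. (rr a b, rr (fps_X ^ n) 0) \<in> Q_elem v"
  using frac_coords_surj[of v] by (auto simp: Q_elem_def)

lemma fps_X_power_inject: "fps_X ^ m = (fps_X ^ n :: 'f::field fps) \<longleftrightarrow> m = n"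
proof
  assume "fps_X ^ m = (fps_X ^ n :: 'f fps)"
  then have "fps_nth (fps_X ^ m) m = fps_nth (fps_X ^ n :: 'f fps) m" by simp
  then show "m = n" by (simp split: if_splits)
qed simp

lemma Q_elem_inject [simp]: "Q_elem v = Q_elem w \<longleftrightarrow> v = w"
proof
  assume eq: "Q_elem v = Q_elem w"
  obtain a b n where "(rr a b, rr (fps_X ^ n) 0) \<in> Q_elem v" using Q_elem_nonempty by blast
  moreover from this have "(rr a b, rr (fps_X ^ n) 0) \<in> Q_elem w" using eq by simp
  ultimately show "v = w" unfolding Q_elem_def by (auto simp: fps_X_power_inject)
qed simp

text \<open>The operations of the localization are unions over representatives; such a union
  collapses once all representatives yield the same class.\<close>

lemma Q_elem_fold:
  assumes "\<And>a b n c d m. frac_coords a b n = v \<Longrightarrow> frac_coords c d m = w \<Longrightarrow>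
    F (rr a b) (rr (fps_X ^ n) 0) (rr c d) (rr (fps_X ^ m) 0) = z"
  shows "(\<Union>(a, s)\<in>Q_elem v. \<Union>(b, t)\<in>Q_elem w. F a s b t) = z"
proof -
  have F: "F a s b t = z" if "(a, s) \<in> Q_elem v" "(b, t) \<in> Q_elem w" for a s b t
    using that assms unfolding Q_elem_def by blast
  obtain a s b t where "(a, s) \<in> Q_elem v" "(b, t) \<in> Q_elem w"
    using Q_elem_nonempty by meson
  then show ?thesis using F by blast
qed

lemma Q_ring_simps:
  fixes v w :: "'f::field fls \<times> 'f fls"
  shows "carrier Q_ring = range (Q_elem :: 'f fls \<times> 'f fls \<Rightarrow> _)"
  "Q_elem v \<oplus>\<^bsub>Q_ring\<^esub> Q_elem w = Q_elem (fst v + fst w, snd v + snd w)"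
  "Q_elem v \<otimes>\<^bsub>Q_ring\<^esub> Q_elem w = Q_elem (fst v * fst w, fst v * snd w + snd v * fst w)"
  "\<zero>\<^bsub>Q_ring\<^esub> = Q_elem (0, 0 :: 'f fls)" "\<one>\<^bsub>Q_ring\<^esub> = Q_elem (1, 0 :: 'f fls)"
proof -
  have cls: "frac_class Rxy y_powers (rr a b) (rr 1 0) = Q_elem (frac_coords a b 0)" for a b :: "'f fps"
    using frac_class_eq[of a b 0] by simp
  have cls_n: "frac_class Rxy y_powers (rr a b) (rr (fps_X ^ n * fps_X ^ m) 0) = Q_elem (frac_coords a b (n + m))"
    for a b :: "'f fps" and n m
    using frac_class_eq[of a b "n + m"] by (simp add: power_add)
  show "\<zero>\<^bsub>Q_ring\<^esub> = Q_elem (0, 0 :: 'f fls)" "\<one>\<^bsub>Q_ring\<^esub> = Q_elem (1, 0 :: 'f fls)"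
    by (simp_all add: Q_ring_def localization_def Rxy_zero Rxy_one cls frac_coords_def)
  show "carrier Q_ring = range (Q_elem :: 'f fls \<times> 'f fls \<Rightarrow> _)"
  proof -
    have "z \<in> (carrier Rxy \<times> y_powers) // frac_rel Rxy y_powers \<longleftrightarrow> (\<exists>v. z = Q_elem v)"
      for z :: "('f fps fps set \<times> 'f fps fps set) set"
    proof
      assume "z \<in> (carrier Rxy \<times> y_powers) // frac_rel Rxy y_powers"
      then obtain a b n where "z = frac_class Rxy y_powers (rr a b) (rr (fps_X ^ n) 0)"
        by (auto simp: quotient_def frac_class_def carrier_Rxy Ry_pow)
      then show "\<exists>v. z = Q_elem v" using frac_class_eq by blast
    next
      assume "\<exists>v. z = Q_elem v"
      then obtain a b n where "z = frac_class Rxy y_powers (rr a b) (rr (fps_X ^ n) 0)"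
        using frac_coords_surj frac_class_eq by metis
      then show "z \<in> (carrier Rxy \<times> y_powers) // frac_rel Rxy y_powers"
        unfolding frac_class_def by (auto intro!: quotientI simp: Ry_pow)
    qed
    then show ?thesis by (auto simp: Q_ring_def localization_def)
  qed
  show "Q_elem v \<oplus>\<^bsub>Q_ring\<^esub> Q_elem w = Q_elem (fst v + fst w, snd v + snd w)"
  proof -
    have "frac_class Rxy y_powers
        ((rr (fps_X ^ m) 0 \<otimes>\<^bsub>Rxy\<^esub> rr a b) \<oplus>\<^bsub>Rxy\<^esub> (rr (fps_X ^ n) 0 \<otimes>\<^bsub>Rxy\<^esub> rr c d))
        (rr (fps_X ^ n) 0 \<otimes>\<^bsub>Rxy\<^esub> rr (fps_X ^ m) 0) = Q_elem (fst v + fst w, snd v + snd w)"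
      if "frac_coords a b n = v" "frac_coords c d m = w" for a b n c d m
      by (simp add: cls_n frac_coords_def fls_times_fps_to_fls field_simps power_add
          flip: that)
    then show ?thesis
      unfolding Q_ring_def localization_def by (simp, intro Q_elem_fold)
  qed
  show "Q_elem v \<otimes>\<^bsub>Q_ring\<^esub> Q_elem w = Q_elem (fst v * fst w, fst v * snd w + snd v * fst w)"
  proof -
    have "frac_class Rxy y_powers (rr a b \<otimes>\<^bsub>Rxy\<^esub> rr c d) (rr (fps_X ^ n) 0 \<otimes>\<^bsub>Rxy\<^esub> rr (fps_X ^ m) 0) =
        Q_elem (fst v * fst w, fst v * snd w + snd v * fst w)"
      if "frac_coords a b n = v" "frac_coords c d m = w" for a b n c d m
      by (simp add: cls_n frac_coords_def fls_times_fps_to_fls field_simps power_add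
          flip: that)
    then show ?thesis
      unfolding Q_ring_def localization_def by (simp, intro Q_elem_fold)
  qed
qed

lemma ring_Q_ring: "ring (Q_ring :: ('f::field fps fps set \<times> 'f fps fps set) set ring)"
proof (rule ringI)
  show "abelian_group (Q_ring :: ('f fps fps set \<times> 'f fps fps set) set ring)"
  proof (rule abelian_groupI)
    show "\<exists>u\<in>carrier Q_ring. u \<oplus>\<^bsub>Q_ring\<^esub> q = \<zero>\<^bsub>Q_ring\<^esub>"
      if q: "q \<in> carrier Q_ring" for q :: "('f fps fps set \<times> 'f fps fps set) set"
    proof -
      obtain v where "q = Q_elem v" using q by (auto simp: Q_ring_simps)
      then show ?thesis by (intro bexI[of _ "Q_elem (- fst v, - snd v)"]) (auto simp: Q_ring_simps)
    qed
  qed (auto simp: Q_ring_simps algebra_simps)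
  show "monoid (Q_ring :: ('f fps fps set \<times> 'f fps fps set) set ring)"
    by (rule monoidI) (auto simp: Q_ring_simps algebra_simps)
qed (auto simp: Q_ring_simps algebra_simps)

section \<open>The integral closure of R in Q\<close>

lemma Q_map_rr: "Q_map (rr a b) = Q_elem (fps_to_fls a, fps_to_fls b)"
  using frac_class_eq[of a b 0] by (simp add: Q_map_def Rxy_one frac_coords_def)

text \<open>Only the first component is followed: it is the image under the ring homomorphism Q ->
  F((y)) that kills x, and integrality is decided there.\<close>

lemma Q_pow: "\<exists>w. Q_elem v [^]\<^bsub>Q_ring\<^esub> (n::nat) = Q_elem w \<and> fst w = fst v ^ n"
proof (induction n)
  case (Suc n)
  then show ?case by (auto simp: Q_ring_simps)
qed (auto simp: Q_ring_simps)

lemma Q_eval_Cons: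
  "ring.eval Q_ring (c # p) q = c \<otimes>\<^bsub>Q_ring\<^esub> q [^]\<^bsub>Q_ring\<^esub> length p \<oplus>\<^bsub>Q_ring\<^esub> ring.eval Q_ring p q"
  using ring.eval.simps(2)[OF ring_Q_ring, of c p] by simp

text \<open>A polynomial with n coefficients has degree less than n, so with t = 1/a multiplying its
  value at a by t^n leaves a factor t in every term. This surplus factor is what contradicts a monic
  equation when t has constant term 0.\<close>

lemma Q_eval_bound:
  assumes t: "fps_to_fls t * fst v = 1" and p: "set p \<subseteq> Q_map ` carrier Rxy"
  shows "\<exists>w e. ring.eval Q_ring p (Q_elem v) = Q_elem w \<and>
    fps_to_fls t ^ length p * fst w = fps_to_fls (t * e)"
  using p
proof (induction p)
  case Nil
  then show ?case
    by (intro exI[of _ "(0, 0)"] exI[of _ 0])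
      (simp add: Q_ring_simps ring.eval.simps(1)[OF ring_Q_ring])
next
  case (Cons c p)
  obtain w e where w: "ring.eval Q_ring p (Q_elem v) = Q_elem w"
    "fps_to_fls t ^ length p * fst w = fps_to_fls (t * e)"
  proof -
    have "set p \<subseteq> Q_map ` carrier Rxy" using Cons.prems by simp
    then show thesis using Cons.IH that by blast
  qed
  obtain a b where "c = Q_map (rr a b)" using Cons.prems by (auto simp: carrier_Rxy)
  then have c: "c = Q_elem (fps_to_fls a, fps_to_fls b)" by (simp add: Q_map_rr)
  obtain u where u: "Q_elem v [^]\<^bsub>Q_ring\<^esub> length p = Q_elem u" "fst u = fst v ^ length p"
    using Q_pow by blast
  obtain z where z: "ring.eval Q_ring (c # p) (Q_elem v) = Q_elem z"
    "fst z = fps_to_fls a * fst v ^ length p + fst w"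
    by (simp add: Q_eval_Cons w c u Q_ring_simps)
  have "fps_to_fls t ^ Suc (length p) * fst z =
    fps_to_fls t * (fps_to_fls a * (fps_to_fls t * fst v) ^ length p + fps_to_fls t ^ length p * fst w)"
    by (simp add: z algebra_simps power_mult_distrib)
  also have "\<dots> = fps_to_fls (t * (a + t * e))"
    unfolding t w by (simp add: fls_times_fps_to_fls)
  finally show ?case using z(1) by auto
qed

text \<open>If \<open>(a, b)\<close> is integral and \<open>a \<notin> F[[y]]\<close>, put \<open>t = 1/a\<close>; multiplying a monic equation of
  degree \<open>n\<close> for \<open>a\<close> by \<open>t\<^sup>n\<close> shows that \<open>t\<close> divides \<open>1\<close> in \<open>F[[y]]\<close>. Conversely \<open>(a, b)\<close> is a root of
  \<open>(q - a)\<^sup>2\<close>.\<close>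

lemma integral_closure_Q:
  "integral_closure Q_ring (Q_map ` carrier Rxy) = Q_elem ` (range fps_to_fls \<times> (UNIV :: 'f::field fls set))"
proof (intro equalityI subsetI)
  fix q :: "('f fps fps set \<times> 'f fps fps set) set"
  assume "q \<in> integral_closure Q_ring (Q_map ` carrier Rxy)"
  then obtain p where q: "q \<in> carrier Q_ring" and p: "p \<noteq> []" "set p \<subseteq> Q_map ` carrier Rxy"
    "hd p = \<one>\<^bsub>Q_ring\<^esub>" "ring.eval Q_ring p q = \<zero>\<^bsub>Q_ring\<^esub>"
    by (auto simp: integral_closure_def)
  obtain v where v: "q = Q_elem v" using q by (auto simp: Q_ring_simps)
  obtain p' where p': "p = \<one>\<^bsub>Q_ring\<^esub> # p'" using p(1,3) by (cases p) auto
  have "fls_subdegree (fst v) \<ge> 0"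
  proof (rule ccontr)
    assume neg: "\<not> fls_subdegree (fst v) \<ge> 0"
    then have nz: "fst v \<noteq> 0" by auto
    define t where "t = fls_regpart (inverse (fst v))"
    have sub: "fls_subdegree (inverse (fst v)) = - fls_subdegree (fst v)"
      using nz by (intro fls_inverse_subdegree') simp
    have t: "fps_to_fls t = inverse (fst v)" using sub neg by (simp add: t_def)
    \<comment> \<open>A pole of \<open>fst v\<close> makes the constant term of its inverse
      vanish.\<close>
    have t0: "fps_nth t 0 = 0"
      using sub neg by (simp add: t_def fls_eq0_below_subdegree)
    have tv: "fps_to_fls t * fst v = 1" using t nz by simp
    obtain w e where w: "ring.eval Q_ring p' (Q_elem v) = Q_elem w"
      "fps_to_fls t ^ length p' * fst w = fps_to_fls (t * e)"
    proof -
      have "set p' \<subseteq> Q_map ` carrier Rxy" using p(2) p' by simp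
      then show thesis using Q_eval_bound[OF tv] that by blast
    qed
    obtain u where u: "Q_elem v [^]\<^bsub>Q_ring\<^esub> length p' = Q_elem u" "fst u = fst v ^ length p'"
      using Q_pow by blast
    have "fst v ^ length p' + fst w = 0"
      using p(4) u w by (simp add: p' v Q_eval_Cons Q_ring_simps)
    then have "fps_to_fls t ^ length p' * (fst v ^ length p' + fst w) = 0" by simp
    then have "(fps_to_fls t * fst v) ^ length p' + fps_to_fls (t * e) = 0"
      using w(2) by (simp add: distrib_left power_mult_distrib)
    then have "fps_to_fls (1 + t * e) = 0" using tv by simp
    then have "1 + t * e = 0" by (simp only: fps_to_fls_eq_0_iff)
    then have "fps_nth (1 + t * e) 0 = 0" by simp
    then show False using t0 by simp
  qed
  then have "fst v \<in> range fps_to_fls" by (metis fls_regpart_to_fls_trivial rangeI)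
  then show "q \<in> Q_elem ` (range fps_to_fls \<times> UNIV)"
    using v by (intro image_eqI[of _ _ v]) (auto simp: mem_Times_iff)
next
  fix q :: "('f fps fps set \<times> 'f fps fps set) set"
  assume "q \<in> Q_elem ` (range fps_to_fls \<times> UNIV)"
  then obtain a b where q: "q = Q_elem (fps_to_fls a, b)" by auto
  let ?p = "[\<one>\<^bsub>Q_ring\<^esub>, Q_map (rr (- 2 * a) 0), Q_map (rr (a ^ 2) 0)]"
  have "\<one>\<^bsub>Q_ring\<^esub> = Q_map (rr 1 0 :: 'f fps fps set)" by (simp add: Q_map_rr Q_ring_simps)
  then have "set ?p \<subseteq> Q_map ` carrier Rxy" by auto
  moreover have "ring.eval Q_ring ?p q = \<zero>\<^bsub>Q_ring\<^esub>"
    by (simp add: Q_eval_Cons ring.eval.simps(1)[OF ring_Q_ring] q Q_map_rr Q_ring_simps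
        fls_times_fps_to_fls power2_eq_square algebra_simps)
  ultimately show "q \<in> integral_closure Q_ring (Q_map ` carrier Rxy)"
    unfolding integral_closure_def using q by (auto simp: Q_ring_simps intro!: exI[of _ ?p])
qed

lemma inv_Q_elem [simp]: "inv_into UNIV Q_elem (Q_elem v) = v"
  by (rule inv_into_f_f) (auto simp: inj_def)

lemma Q_mod_simps:
  fixes v w :: "'f::field fls \<times> 'f fls"
  shows "carrier Q_mod = range (Q_elem :: 'f fls \<times> 'f fls \<Rightarrow> _)"
    "carrier Rtilde_mod = Q_elem ` (range fps_to_fls \<times> (UNIV :: 'f fls set))"
    "Q_elem v \<oplus>\<^bsub>Q_mod\<^esub> Q_elem w = Q_elem (fst v + fst w, snd v + snd w)"
    "Q_elem v \<oplus>\<^bsub>Rtilde_mod\<^esub> Q_elem w = Q_elem (fst v + fst w, snd v + snd w)"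
    "rr a b \<odot>\<^bsub>Q_mod\<^esub> Q_elem v =
      Q_elem (fps_to_fls a * fst v, fps_to_fls a * snd v + fps_to_fls b * fst v)"
    "rr a b \<odot>\<^bsub>Rtilde_mod\<^esub> Q_elem v =
      Q_elem (fps_to_fls a * fst v, fps_to_fls a * snd v + fps_to_fls b * fst v)"
  by (simp_all add: Q_mod_def Rtilde_mod_def ring_as_module_def Q_ring_simps Q_map_rr integral_closure_Q)

lemma (in Rxy_module) mod_iso_Q_iff: "mod_iso Rxy N Q_mod \<longleftrightarrow> (\<exists>\<beta>. coordinate UNIV \<beta>)"
  by (rule mod_iso_iff_coordinate[where \<psi> = "inv_into UNIV Q_elem"])
    (auto simp: Q_mod_simps bij_betw_def inj_on_def image_image)

lemma (in Rxy_module) mod_iso_Rtilde_iff: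
  "mod_iso Rxy N Rtilde_mod \<longleftrightarrow> (\<exists>\<beta>. coordinate (range fps_to_fls) \<beta>)"
proof (rule mod_iso_iff_coordinate[where \<psi> = "inv_into UNIV Q_elem"])
  show "rr a b \<odot>\<^bsub>Rtilde_mod\<^esub> u \<in> carrier Rtilde_mod" if "u \<in> carrier Rtilde_mod" for a b u
    using that by (auto simp: Q_mod_simps image_iff simp flip: fls_times_fps_to_fls)
  show "u \<oplus>\<^bsub>Rtilde_mod\<^esub> v \<in> carrier Rtilde_mod"
    if "u \<in> carrier Rtilde_mod" "v \<in> carrier Rtilde_mod" for u v
    using that by (auto simp: Q_mod_simps image_iff simp flip: fps_to_fls_plus)
qed (auto simp: Q_mod_simps bij_betw_def inj_on_def image_image)

text \<open>The test module that lifts a line along x is carried by N x F((y));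
  \<open>universe\<close> makes room for a copy of it in \<open>'u\<close>.\<close>

theorem theorem5p3:
  fixes N :: "('f::alg_closed_field fps fps set, 'm) module"
  assumes "CHAR('f) \<noteq> 2"
    and "module Rxy N"
    and universe: "\<exists>\<iota> :: ('m \<times> 'f fps fps) set set \<Rightarrow> 'u. inj \<iota>"
  shows "ZCM_point TYPE('u) N \<and> \<not> fin_gen Rxy N \<longleftrightarrow>
    mod_iso Rxy N Rtilde_mod \<or> mod_iso Rxy N Q_mod \<or> mod_iso Rxy N G_mod"
proof -
  interpret Rxy_module N by (rule Rxy_module.intro[OF assms(2)])
  obtain \<iota> :: "('m \<times> 'f fps fps) set set \<Rightarrow> 'u" where \<iota>: "inj \<iota>" using universe by blast
  have "ZCM_point TYPE('u) N \<and> \<not> fin_gen Rxy N \<longleftrightarrow>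
      (\<exists>S\<in>{{0}, range fps_to_fls, UNIV}. \<exists>\<beta>. coordinate S \<beta>)"
    using ZCM_point_coordinate[OF _ _ \<iota>] coordinate_ZCM_point by blast
  then show ?thesis
    unfolding mod_iso_Rtilde_iff mod_iso_Q_iff mod_iso_G_iff by blast
qed

end
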